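(* Suppose $z$ is an $n$-vertex with $n\ge4$. Then the $A$-module $(\bar b_1,\bar b_2)A$ has a rhombus filtration with three rhombus quotients. Explicitly, there is an exact sequence $$0\to\bar b_1b_nA\oplus\bar b_2b_3A\to(\bar b_1,\bar b_2)A\to\bar d_1\bar b_1A\to0.$$
   Context: Tiling. Let $\mathrm p:\mathbb R^3\to\mathbb R^2$ be linear with $\mathrm p(\mathbf e_1)=(-\frac{\sqrt3}{2},-\frac12)$, $\mathrm p(\mathbf e_2)=(\frac{\sqrt3}{2},-\frac12)$, $\mathrm p(\mathbf e_3)=(0,1)$. For $\{i,j,k\}=\{1,2,3\}$ let $R_k=\{\lambda \mathrm p(\mathbf e_i)+\mu \mathrm p(\mathbf e_j):0\le\lambda,\mu\le1\}$. Let $\mathbf M=\begin{pmatrix}0&1&0\\0&0&1\\1&-1&-1\end{pmatrix}$ with columns $\mathbf c_1,\mathbf c_2,\mathbf c_3$. A pair $(z,k)$, $z\in\mathbb Z^3$, represents the rhombus $\mathrm p(z)+R_k$. Put $\mathcal P_0=\{(0,1),(0,2),(0,3)\}$ and $\mathcal P_{i+1}=\bigcup_{(z,k)\in\mathcal P_i}\mathcal R(z,k)$, where $\mathcal R(z,1)=\{(\mathbf Mz,3),(\mathbf Mz+\mathbf c_2,1),(\mathbf Mz+\mathbf c_3,2)\}$, $\mathcal R(z,2)=\{(\mathbf Mz,1)\}$, $\mathcal R(z,3)=\{(\mathbf Mz,2)\}$. Then $\mathcal P_i\subset\mathcal P_{i+1}$ and $\bigcup_i\mathcal P_i$ is a tiling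 of the plane by rhombi (the Rauzy tiling). Algebra $A$. Let $Q$ be the quiver whose vertices are the vertices of the Rauzy tiling, with each edge replaced by two arrows in opposite directions; $\bar b$ is the arrow opposite to $b$. Let $k$ be a field. Paths are composed left to right and modules are right modules. The Rauzy algebra is $A=kQ/I$, where $I$ is generated by: (1) a path of length two along two distinct edges that are not both edges of one rhombus is zero; (2) the two paths of length two joining opposite vertices of a rhombus (along its boundary) are equal; (3) for each vertex $z$, $s_1(z)D_1(z)=s_2(z)D_2(z)=s_3(z)D_3(z)$, where $D_a(z)=L_a^+(z)-L_a^-(z)$, $L_a^{\pm}(z)=g\bar g$ if there is an arrow $g:z\to z\pm\mathrm p(\mathbf e_a)$ and $L_a^\pm(z)=0$ otherwise, and $s_a(z)\in\{\pm1\}$ is a fixed choice of signs such that whenever $z,x$ are joined by an edge parallel to $\mathrm p(\mathbf e_a)$, $s_a(x)=-s_a(z)$ and $s_c(x)=s_c(z)$ for $c\ne a$ (such signs are determined by their values at one vertex). $e_z$ is the trivial path at $z$ and $S_z$ the simple module at $z$. Local notation. An $n$-vertex is a vertex $z$ with exactly $n$ edges. Its neighbours are labelled $x_1,\dots,x_n$ counterclockwise (starting anywhere; indices mod $n$), $b_j:z\to x_j$ is the corresponding arrow, $y_j$ is the fourth vertex of the rhombus containing $z,x_j,x_{j+1}$, and $d_j:x_j\to y_j$, $c_j:x_{j+1}\to y_j$ are the corresponding arrows. $(\bar b_1,\bar b_2)A$ is the submodule of $e_{x_1}A\oplus e_{x_2}A$ generated by the element $(\bar b_1,\bar b_2)$.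 Rhombus modules. For a rhombus of the tiling with opposite vertices $z,y$ and remaining vertices $u,v$, the rhombus module $R^y_z$ is the (unique up to isomorphism) $A$-module with top $S_y$, socle $S_z$ and $\mathrm{rad}/\mathrm{soc}\cong S_u\oplus S_v$; explicitly $R^y_z=pA$ with $p$ the path of length two from $z$ to $y$ around the rhombus. A module $M$ has a rhombus filtration (with $r$ quotients) if there are submodules $0=M_0\subset M_1\subset\dots\subset M_r=M$ with each $M_j/M_{j-1}$ a rhombus module. *)

theory Defs
  imports
    "HOL-Analysis.Analysis"
    "HOL-Library.Poly_Mapping"
    "HOL-Algebra.QuotRing"
    "HOL-Algebra.Module"
begin

section \<open>The Rauzy tiling\<close>

type_synonym point = "real^2"

text \<open>In the index type \<^typ>\<open>3\<close> the elements 1, 2, 3 are pairwise distinct (with 3 = 0).\<close>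

definition proj_plane :: "real^3 \<Rightarrow> point" where
  "proj_plane v = (v $ 1) *\<^sub>R vector [- (sqrt 3 / 2), - (1/2)]
                + (v $ 2) *\<^sub>R vector [sqrt 3 / 2, - (1/2)]
                + (v $ 3) *\<^sub>R vector [0, 1]"

definition pe :: "3 \<Rightarrow> point" where
  "pe a = proj_plane (axis a 1)"

definition proj_lattice :: "int^3 \<Rightarrow> point" where
  "proj_lattice z = proj_plane (\<chi> i. real_of_int (z $ i))"

definition rauzy_matrix :: "int^3^3" where
  "rauzy_matrix = vector [vector [0, 1, 0], vector [0, 0, 1], vector [1, -1, -1]]"

definition tile_subst :: "int^3 \<Rightarrow> 3 \<Rightarrow> ((int^3) \<times> 3) set" where
  "tile_subst z k =
    (let w = rauzy_matrix *v z in
     if k = 1 then {(w, 3), (w + column 2 rauzy_matrix, 1), (w + column 3 rauzy_matrix, 2)}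
     else if k = 2 then {(w, 1)}
     else {(w, 2)})"

primrec patch :: "nat \<Rightarrow> ((int^3) \<times> 3) set" where
  "patch 0 = {(0, 1), (0, 2), (0, 3)}"
| "patch (Suc i) = (\<Union>(z, k)\<in>patch i. tile_subst z k)"

definition rauzy_tiling :: "((int^3) \<times> 3) set" where
  "rauzy_tiling = (\<Union>i. patch i)"

text \<open>
  \<open>rhombus z u y v\<close>: the points z, u, y, v, in this cyclic order, are the corners of a tile.
  Thus z, y are opposite, u, v are the remaining corners, and the sides are zu, uy, yv, vz.
  All eight labellings are covered, by the rotations and by exchanging i and j.
\<close>
definition rhombus :: "point \<Rightarrow> point \<Rightarrow> point \<Rightarrow> point \<Rightarrow> bool" where
  "rhombus z u y v \<longleftrightarrow>
    (\<exists>w k i j m. (w, k) \<in> rauzy_tiling \<and> i \<noteq> j \<and> i \<noteq> k \<and> j \<noteq> k \<and>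
      [z, u, y, v] = rotate m [proj_lattice w, proj_lattice w + pe i,
                               proj_lattice w + pe i + pe j, proj_lattice w + pe j])"

definition vertex :: "point \<Rightarrow> bool" where
  "vertex z \<longleftrightarrow> (\<exists>u y v. rhombus z u y v)"

definition edge :: "point \<Rightarrow> point \<Rightarrow> bool" where
  "edge z u \<longleftrightarrow> (\<exists>y v. rhombus z u y v)"

definition n_vertex :: "nat \<Rightarrow> point \<Rightarrow> bool" where
  "n_vertex n z \<longleftrightarrow> vertex z \<and> card {x. edge z x} = n"

text \<open>
  The neighbours \<open>x 1, \<dots>, x n\<close> of z in counterclockwise order (\<open>\<theta> j\<close> is the
  direction of \<open>x j\<close> seen from z), and the fourth vertices \<open>y 1, \<dots>, y n\<close> of the rhombi at z,
  where \<open>j mod n + 1\<close> is the cyclic successor of j in \<open>{1..n}\<close>.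
\<close>
definition local_labelling :: "nat \<Rightarrow> point \<Rightarrow> (nat \<Rightarrow> point) \<Rightarrow> (nat \<Rightarrow> point) \<Rightarrow> bool" where
  "local_labelling n z x y \<longleftrightarrow>
    bij_betw x {1..n} {w. edge z w} \<and>
    (\<exists>\<theta> :: nat \<Rightarrow> real. strict_mono_on {1..n} \<theta> \<and> \<theta> n < \<theta> 1 + 2 * pi \<and>
      (\<forall>j\<in>{1..n}. \<exists>r>0. x j = z + r *\<^sub>R vector [cos (\<theta> j), sin (\<theta> j)])) \<and>
    (\<forall>j\<in>{1..n}. rhombus z (x j) (y j) (x (j mod n + 1)))"


section \<open>The Rauzy algebra\<close>

text \<open>
  Two vertices are joined by at most one edge, so there is at most one arrow between them in each
  direction, and a path is determined by the nonempty list of vertices that it visits (read left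
  to right). The list \<open>[z]\<close> is the trivial path at z.
\<close>
definition quiver_paths :: "point list set" where
  "quiver_paths = {ps. ps \<noteq> [] \<and> (\<forall>x\<in>set ps. vertex x) \<and> successively edge ps}"

type_synonym 'k path_comb = "point list \<Rightarrow>\<^sub>0 'k"

definition path_mult :: "'k::field path_comb \<Rightarrow> 'k path_comb \<Rightarrow> 'k path_comb" where
  "path_mult f g =
    (\<Sum>p\<in>Poly_Mapping.keys f. \<Sum>q\<in>Poly_Mapping.keys g.
      if last p = hd q
      then Poly_Mapping.single (p @ tl q) (Poly_Mapping.lookup f p * Poly_Mapping.lookup g q)
      else 0)"

text \<open>
  The quiver has infinitely many vertices, so its path algebra has no unit; the field
  \<^const>\<open>one\<close> of the record is never used.
\<close>
definition path_algebra :: "'k::field path_comb ring" where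
  "path_algebra = \<lparr>carrier = {f. Poly_Mapping.keys f \<subseteq> quiver_paths}, mult = path_mult,
                   one = undefined, zero = 0, add = (+)\<rparr>"

definition sign_choice :: "(3 \<Rightarrow> point \<Rightarrow> 'k::field) \<Rightarrow> bool" where
  "sign_choice s \<longleftrightarrow>
    (\<forall>a z. vertex z \<longrightarrow> s a z \<in> {1, -1}) \<and>
    (\<forall>a z x. edge z x \<and> x - z \<in> {pe a, - pe a} \<longrightarrow>
      s a x = - s a z \<and> (\<forall>c. c \<noteq> a \<longrightarrow> s c x = s c z))"

definition loop_at :: "point \<Rightarrow> point \<Rightarrow> 'k::field path_comb" where
  "loop_at z w = (if edge z w then Poly_Mapping.single [z, w, z] 1 else 0)"

definition loop_diff :: "3 \<Rightarrow> point \<Rightarrow> 'k::field path_comb" where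
  "loop_diff a z = loop_at z (z + pe a) - loop_at z (z - pe a)"

definition rauzy_relations :: "(3 \<Rightarrow> point \<Rightarrow> 'k::field) \<Rightarrow> 'k path_comb set" where
  "rauzy_relations s =
     {Poly_Mapping.single [x, u, w] 1 |x u w.
        edge x u \<and> edge u w \<and> x \<noteq> w \<and> \<not> (\<exists>v. rhombus x u w v)}
   \<union> {Poly_Mapping.single [z, u, y] 1 - Poly_Mapping.single [z, v, y] 1 |z u y v. rhombus z u y v}
   \<union> {Poly_Mapping.map ((*) (s a z)) (loop_diff a z) - Poly_Mapping.map ((*) (s c z)) (loop_diff c z)
        |a c z. vertex z}"

text \<open>
  The two-sided ideal generated by the relations. It is closed under scalars, because scalar
  multiples of trivial paths lie in the path algebra. The library's \<^const>\<open>genideal\<close> cannot be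
  used, as it presupposes a ring with one.
\<close>
definition rauzy_ideal :: "(3 \<Rightarrow> point \<Rightarrow> 'k::field) \<Rightarrow> 'k path_comb set" where
  "rauzy_ideal s =
    \<Inter> {J. additive_subgroup J (path_algebra :: 'k path_comb ring) \<and>
         (\<forall>f\<in>carrier path_algebra. \<forall>g\<in>J. path_mult f g \<in> J \<and> path_mult g f \<in> J) \<and>
         rauzy_relations s \<subseteq> J}"

definition rauzy_algebra :: "(3 \<Rightarrow> point \<Rightarrow> 'k::field) \<Rightarrow> 'k path_comb set ring" where
  "rauzy_algebra s = path_algebra Quot rauzy_ideal s"

definition path_class :: "(3 \<Rightarrow> point \<Rightarrow> 'k::field) \<Rightarrow> point list \<Rightarrow> 'k path_comb set" where
  "path_class s ps = rauzy_ideal s +>\<^bsub>path_algebra\<^esub> Poly_Mapping.single ps 1"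


section \<open>Right modules\<close>

text \<open>
  Right modules are represented by the record type \<^typ>\<open>('a, 'b) module\<close>, where
  \<open>a \<odot>\<^bsub>M\<^esub> m\<close> stands for the product of m by a from the right. As usual for this record
  type, the fields \<^const>\<open>mult\<close> and \<^const>\<open>one\<close> of a module carry no meaning. The last axiom
  is unitality: for an algebra A with local units it says MA = M. It also makes M a
  vector space over the ground field, and all homomorphisms linear.
\<close>
locale right_module = abelian_group M
  for A :: "('a, 'c) ring_scheme" and M :: "('a, 'b, 'd) module_scheme" (structure) +
  assumes act_closed: "\<lbrakk>a \<in> carrier A; m \<in> carrier M\<rbrakk> \<Longrightarrow> a \<odot> m \<in> carrier M"
    and act_add: "\<lbrakk>a \<in> carrier A; m \<in> carrier M; m' \<in> carrier M\<rbrakk>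
      \<Longrightarrow> a \<odot> (m \<oplus> m') = a \<odot> m \<oplus> a \<odot> m'"
    and add_act: "\<lbrakk>a \<in> carrier A; a' \<in> carrier A; m \<in> carrier M\<rbrakk>
      \<Longrightarrow> (a \<oplus>\<^bsub>A\<^esub> a') \<odot> m = a \<odot> m \<oplus> a' \<odot> m"
    and act_act: "\<lbrakk>a \<in> carrier A; a' \<in> carrier A; m \<in> carrier M\<rbrakk>
      \<Longrightarrow> (a \<otimes>\<^bsub>A\<^esub> a') \<odot> m = a' \<odot> (a \<odot> m)"
    and unital: "m \<in> carrier M \<Longrightarrow> \<exists>a\<in>carrier A. a \<odot> m = m"

definition mod_hom ::
  "('a, 'c) ring_scheme \<Rightarrow> ('a, 'b, 'd) module_scheme \<Rightarrow> ('a, 'e, 'f) module_scheme \<Rightarrow> ('b \<Rightarrow> 'e) set"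
  where
  "mod_hom A M N = {f \<in> hom (add_monoid M) (add_monoid N).
     \<forall>a\<in>carrier A. \<forall>m\<in>carrier M. f (a \<odot>\<^bsub>M\<^esub> m) = a \<odot>\<^bsub>N\<^esub> f m}"

definition mod_iso ::
  "('a, 'c) ring_scheme \<Rightarrow> ('a, 'b, 'd) module_scheme \<Rightarrow> ('a, 'e, 'f) module_scheme \<Rightarrow> bool" where
  "mod_iso A M N \<longleftrightarrow> (\<exists>f\<in>mod_hom A M N. bij_betw f (carrier M) (carrier N))"

text \<open>There is an exact sequence 0 -> U -> V -> W -> 0.\<close>
definition short_exact ::
  "('a, 'c) ring_scheme \<Rightarrow> ('a, 'u, 'd) module_scheme \<Rightarrow> ('a, 'v, 'e) module_scheme
    \<Rightarrow> ('a, 'w, 'f) module_scheme \<Rightarrow> bool" where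
  "short_exact A U V W \<longleftrightarrow>
    (\<exists>f\<in>mod_hom A U V. \<exists>g\<in>mod_hom A V W.
      inj_on f (carrier U) \<and> f ` carrier U = a_kernel V W g \<and> g ` carrier V = carrier W)"

definition dsum_mod ::
  "('a, 'b, 'd) module_scheme \<Rightarrow> ('a, 'e, 'f) module_scheme \<Rightarrow> ('a, 'b \<times> 'e) module" where
  "dsum_mod M N = \<lparr>carrier = carrier M \<times> carrier N, mult = undefined, one = undefined,
     zero = (\<zero>\<^bsub>M\<^esub>, \<zero>\<^bsub>N\<^esub>),
     add = (\<lambda>(m, n) (m', n'). (m \<oplus>\<^bsub>M\<^esub> m', n \<oplus>\<^bsub>N\<^esub> n')),
     smult = (\<lambda>a (m, n). (a \<odot>\<^bsub>M\<^esub> m, a \<odot>\<^bsub>N\<^esub> n))\<rparr>"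

definition quot_mod :: "('a, 'b, 'd) module_scheme \<Rightarrow> 'b set \<Rightarrow> ('a, 'b set) module" where
  "quot_mod M N = \<lparr>carrier = a_rcosets\<^bsub>M\<^esub> N, mult = undefined, one = undefined,
     zero = N, add = set_add M,
     smult = (\<lambda>a X. \<Union>m\<in>X. N +>\<^bsub>M\<^esub> (a \<odot>\<^bsub>M\<^esub> m))\<rparr>"

definition generated_submodule ::
  "('a, 'c) ring_scheme \<Rightarrow> ('a, 'b, 'd) module_scheme \<Rightarrow> 'b \<Rightarrow> 'b set" where
  "generated_submodule A M m = \<Inter> {H. submodule H A M \<and> m \<in> H}"

definition simple_submodule ::
  "('a, 'c) ring_scheme \<Rightarrow> ('a, 'b, 'd) module_scheme \<Rightarrow> 'b set \<Rightarrow> bool" where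
  "simple_submodule A M H \<longleftrightarrow> submodule H A M \<and> H \<noteq> {\<zero>\<^bsub>M\<^esub>} \<and>
     (\<forall>K. submodule K A M \<and> K \<subseteq> H \<longrightarrow> K = {\<zero>\<^bsub>M\<^esub>} \<or> K = H)"

definition maximal_submodule ::
  "('a, 'c) ring_scheme \<Rightarrow> ('a, 'b, 'd) module_scheme \<Rightarrow> 'b set \<Rightarrow> bool" where
  "maximal_submodule A M H \<longleftrightarrow> submodule H A M \<and> H \<noteq> carrier M \<and>
     (\<forall>K. submodule K A M \<and> H \<subseteq> K \<longrightarrow> K = H \<or> K = carrier M)"

definition radical :: "('a, 'c) ring_scheme \<Rightarrow> ('a, 'b, 'd) module_scheme \<Rightarrow> 'b set" where
  "radical A M = carrier M \<inter> \<Inter> {H. maximal_submodule A M H}"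

text \<open>The sum of the simple submodules is the smallest submodule that contains all of them.\<close>
definition socle :: "('a, 'c) ring_scheme \<Rightarrow> ('a, 'b, 'd) module_scheme \<Rightarrow> 'b set" where
  "socle A M = \<Inter> {H. submodule H A M \<and> (\<forall>K. simple_submodule A M K \<longrightarrow> K \<subseteq> H)}"

definition regular_module :: "('a, 'c) ring_scheme \<Rightarrow> ('a, 'a) module" where
  "regular_module A = \<lparr>carrier = carrier A, mult = undefined, one = undefined,
     zero = \<zero>\<^bsub>A\<^esub>, add = add A, smult = (\<lambda>a m. m \<otimes>\<^bsub>A\<^esub> a)\<rparr>"

text \<open>The right A-module pA.\<close>
definition right_ideal :: "('a, 'c) ring_scheme \<Rightarrow> 'a \<Rightarrow> ('a, 'a) module" where
  "right_ideal A p = (regular_module A)\<lparr>carrier := {p \<otimes>\<^bsub>A\<^esub> a |a. a \<in> carrier A}\<rparr>"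


section \<open>Rhombus modules\<close>

text \<open>
  The simple module at z: the ground field, on which a linear combination of paths acts as its
  coefficient at the trivial path \<open>[z]\<close>. This coefficient depends only on the class in the
  algebra, because all relations are combinations of paths of length two.
\<close>
definition simple_at :: "point \<Rightarrow> ('k::field path_comb set, 'k) module" where
  "simple_at z = \<lparr>carrier = UNIV, mult = undefined, one = undefined, zero = 0, add = (+),
     smult = (\<lambda>X t. the_elem ((\<lambda>f. t * Poly_Mapping.lookup f [z]) ` X))\<rparr>"

text \<open>
  M is the rhombus module with top at y and socle at z, for the tile with opposite corners z, y
  and remaining corners u, v.
\<close>
definition is_rhombus_module_at ::
  "(3 \<Rightarrow> point \<Rightarrow> 'k::field) \<Rightarrow> point \<Rightarrow> point \<Rightarrow> point \<Rightarrow> point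
    \<Rightarrow> ('k path_comb set, 'b) module \<Rightarrow> bool" where
  "is_rhombus_module_at s z u y v M \<longleftrightarrow>
    (let A = rauzy_algebra s in
      rhombus z u y v \<and> right_module A M \<and>
      mod_iso A (quot_mod M (radical A M)) (simple_at y) \<and>
      mod_iso A (M\<lparr>carrier := socle A M\<rparr>) (simple_at z) \<and>
      socle A M \<subseteq> radical A M \<and>
      mod_iso A (quot_mod (M\<lparr>carrier := radical A M\<rparr>) (socle A M))
        (dsum_mod (simple_at u) (simple_at v)))"

definition is_rhombus_module ::
  "(3 \<Rightarrow> point \<Rightarrow> 'k::field) \<Rightarrow> ('k path_comb set, 'b) module \<Rightarrow> bool" where
  "is_rhombus_module s M \<longleftrightarrow> (\<exists>z u y v. is_rhombus_module_at s z u y v M)"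

definition has_rhombus_filtration ::
  "(3 \<Rightarrow> point \<Rightarrow> 'k::field) \<Rightarrow> ('k path_comb set, 'b) module \<Rightarrow> nat \<Rightarrow> bool" where
  "has_rhombus_filtration s M r \<longleftrightarrow>
    (\<exists>N :: nat \<Rightarrow> 'b set.
      N 0 = {\<zero>\<^bsub>M\<^esub>} \<and> N r = carrier M \<and>
      (\<forall>j\<le>r. submodule (N j) (rauzy_algebra s) M) \<and>
      (\<forall>j\<in>{1..r}. N (j - 1) \<subseteq> N j \<and>
        is_rhombus_module s (quot_mod (M\<lparr>carrier := N j\<rparr>) (N (j - 1)))))"

end

theory Submission
  imports Defs
begin

text \<open>
  Lifting vertices to the cubic lattice identifies the tiling with the set of all unit squares whose
  corners have height in an interval of length h(1,1,1), where h is the Perron eigenvector of the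
  substitution. No tile of this set is missed, because the tiles around a vertex have parents (or
  grandparents) around a common vertex, so that all stars of the set can be filled inductively. In this
  description an edge lies in exactly two rhombi, and no unit cube has all its vertices in the slab.

  The relations then bound every module with a generator m at y that is killed by all arrows except
  those to two corners u, v of a rhombus z, u, y, v: it is spanned by m and its images at u, v and z, and
  it is a rhombus module as soon as the image at z is nonzero. For n at least 4 the images of the
  generator of V under the arrows to the n-th and third neighbour lie in one component each; they generate
  the two rhombus submodules, and modulo these V has a generator of the above kind.

  The required nonvanishing of a path that goes to the opposite vertex of a rhombus and back follows from a
  trace on closed paths of length four. At each vertex the edge directions are the rays of a smooth
  complete fan in the plane, and on pairs of loops the trace is the intersection form of the toric surface
  of this fan, twisted by the signs: the third family of relations is linear equivalence of divisors.
\<close>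

section \<open>The tiling as a slab of the lattice\<close>

text \<open>Upper bounds on modules come directly from the relations. The obstacle is the lower
  bound: in an algebra given by generators and relations, a path is seen to be nonzero only by a
  functional that vanishes on the whole ideal. The relations are homogeneous of degree two, and the
  path to be detected, from a corner of a rhombus to the opposite one and back, has degree four. So
  it suffices to assign values to closed paths with four arrows and to test the relations in the
  three positions inside them. This one statement gives the socles of all three quotients and bounds
  the kernel in the exact sequence. The slab makes the tests possible. The inductive definition of
  the patches shows that tiles are present, but not that a tile is absent, which the zero relations
  and the trace require. In terms of heights, presence of a square is a pair of inequalities. The
  inverse substitution multiplies heights by \<open>beta\<close>, and the interval of heights of
  each type is cut into ranges with different parents.\<close>

definition beta :: real where
  "beta = (SOME b. 1.83928 < b \<and> b < 1.83929 \<and> b ^ 3 = b ^ 2 + b + 1)"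

text \<open>Existence is by the intermediate value theorem. Later comparisons of heights are reduced
  by the cubic equation to expressions linear in \<open>beta\<close> and \<open>beta ^ 2\<close>,
  which these bounds and those of the next lemma decide.\<close>

lemma beta_bounds: "1.83928 < beta" "beta < 1.83929"
  and beta_cubic: "beta ^ 3 = beta ^ 2 + beta + 1"
proof -
  let ?f = "\<lambda>b::real. b ^ 3 - b ^ 2 - b - 1"
  have "\<exists>b. 1.83928 \<le> b \<and> b \<le> 1.83929 \<and> ?f b = 0"
    by (rule IVT) (auto simp: power2_eq_square power3_eq_cube intro!: continuous_intros)
  then obtain b where b: "1.83928 \<le> b" "b \<le> 1.83929" "?f b = 0" by blast
  have "?f 1.83928 \<noteq> 0" "?f 1.83929 \<noteq> 0"
    by (simp_all add: power2_eq_square power3_eq_cube)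
  with b(3) have "b \<noteq> 1.83928" "b \<noteq> 1.83929" by metis+
  with b have "\<exists>b::real. 1.83928 < b \<and> b < 1.83929 \<and> b ^ 3 = b ^ 2 + b + 1"
    by (intro exI[of _ b]) auto
  from someI_ex[OF this]
  show "1.83928 < beta" "beta < 1.83929" "beta ^ 3 = beta ^ 2 + beta + 1"
    unfolding beta_def by blast+
qed

lemma beta_sq_bounds: "3.38295 < beta ^ 2" "beta ^ 2 < 3.38299"
proof -
  have "1.83928 * 1.83928 < beta * beta" "beta * beta < 1.83929 * 1.83929"
    using beta_bounds by (intro mult_strict_mono; simp)+
  then show "3.38295 < beta ^ 2" "beta ^ 2 < 3.38299" by (auto simp: power2_eq_square)
qed

text \<open>
  The transpose of the inverse of the matrix has the Perron eigenvector
  $(\beta, \beta^2 - \beta, 1)$, where $\beta$ is the tribonacci constant.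
\<close>
definition hgt :: "int^3 \<Rightarrow> real" where
  "hgt w = beta * w $ 1 + (beta ^ 2 - beta) * w $ 2 + w $ 3"

text \<open>The height gained along an edge in direction \<open>a\<close>; numerically about 1.839,
  1.544 and 1.\<close>

definition wt :: "3 \<Rightarrow> real" where
  "wt a = hgt (axis a 1)"

lemma wt_simps: "wt 1 = beta" "wt 2 = beta ^ 2 - beta" "wt 3 = 1"
  by (auto simp: wt_def hgt_def axis_def)

text \<open>The bound \<open>beta ^ 2 + 1\<close> is the sum of the three weights, that is, the
  height of (1,1,1). This vector spans the kernel of the projection, so the half-open slab contains
  at most one lift of a point of the plane.\<close>

definition slab :: "int^3 \<Rightarrow> bool" where
  "slab w \<longleftrightarrow> 0 \<le> hgt w \<and> hgt w < beta ^ 2 + 1"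

text \<open>A tile is named by its lowest corner, as all weights are positive; the upper bound says
  that its highest corner is still in the slab.\<close>

definition stile :: "(int^3) \<times> 3 \<Rightarrow> bool" where
  "stile t \<longleftrightarrow> 0 \<le> hgt (fst t) \<and> hgt (fst t) < wt (snd t)"

definition corner :: "int^3 \<Rightarrow> (int^3) \<times> 3 \<Rightarrow> bool" where
  "corner p t \<longleftrightarrow> (\<forall>i. p $ i - fst t $ i \<in> {0, 1}) \<and> p $ snd t = fst t $ snd t"

text \<open>Multiplication by the inverse of \<open>rauzy_matrix\<close>.\<close>

definition minv :: "int^3 \<Rightarrow> int^3" where
  "minv w = vector [w $ 1 + w $ 2 + w $ 3, w $ 1, w $ 2]"

text \<open>The inverse of the substitution on the tiles of the slab.\<close>
definition parent :: "(int^3) \<times> 3 \<Rightarrow> (int^3) \<times> 3" where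
  "parent t = (case t of (w, k) \<Rightarrow>
     if k = 3 then (minv w, 1)
     else if k = 1 then
       (if hgt w < beta - 1 then (minv w, 2) else (minv w - axis 2 1, 1))
     else (if hgt w < beta ^ 2 - beta - 1 then (minv w, 3) else (minv w - axis 3 1, 1)))"

section \<open>Heights under the substitution and its inverse\<close>

lemma hgt_vector: "hgt (vector [a, b, c]) = beta * a + (beta ^ 2 - beta) * b + c"
  by (simp add: hgt_def)

lemma hgt_add: "hgt (u + w) = hgt u + hgt w" and hgt_diff: "hgt (u - w) = hgt u - hgt w"
  and hgt_minus: "hgt (- w) = - hgt w" and hgt_zero: "hgt 0 = 0"
  by (simp_all add: hgt_def algebra_simps)

text \<open>The weights form a left eigenvector of the inverse matrix with eigenvalue
  \<open>beta\<close>; in the second coordinate this is the cubic equation.\<close>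

lemma hgt_minv: "hgt (minv w) = beta * hgt w"
proof -
  have *: "beta * (beta * (beta * x)) = x + beta * x + beta * (beta * x)" for x :: real
    using arg_cong[OF beta_cubic, of "\<lambda>t. t * x"]
    by (simp add: power2_eq_square power3_eq_cube algebra_simps)
  show ?thesis
    by (simp add: hgt_def minv_def power2_eq_square algebra_simps *)
qed

lemma three_neq [simp]: "(1::3) \<noteq> 2" "(2::3) \<noteq> 1" "(1::3) \<noteq> 3" "(3::3) \<noteq> 1" "(2::3) \<noteq> 3" "(3::3) \<noteq> 2"
  by simp_all

lemma column_rauzy: "column 2 rauzy_matrix = vector [1, 0, -1]" "column 3 rauzy_matrix = vector [0, 1, -1]"
  by (simp_all add: column_def rauzy_matrix_def vec_eq_iff forall_3)

lemma rauzy_mult: "rauzy_matrix *v w = vector [w $ 2, w $ 3, w $ 1 - w $ 2 - w $ 3]"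
  by (simp add: rauzy_matrix_def matrix_vector_mult_def vec_eq_iff forall_3 sum_3)

lemma tile_subst_parent: "t \<in> tile_subst (fst (parent t)) (snd (parent t))"
proof -
  obtain w k where t: "t = (w, k)" by force
  consider "k = 1" | "k = 2" | "k = 3" using exhaust_3 by blast
  then show ?thesis unfolding t
    by cases (auto simp: parent_def tile_subst_def Let_def rauzy_mult column_rauzy vec_eq_iff forall_3
      axis_def minv_def)
qed

lemma hgt_rauzy: "beta * hgt (rauzy_matrix *v w) = hgt w"
proof -
  have "minv (rauzy_matrix *v w) = w"
    by (simp add: rauzy_mult minv_def vec_eq_iff forall_3)
  then show ?thesis using hgt_minv[of "rauzy_matrix *v w"] by simp
qed

text \<open>The substitution divides heights by \<open>beta\<close>, so the unshifted children of
  tiles of types 1, 2, 3 have heights below 1, \<open>beta - 1\<close> and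
  \<open>beta ^ 2 - beta - 1\<close>. The shifts by the two columns raise heights by
  \<open>beta - 1\<close> and \<open>beta ^ 2 - beta - 1\<close>. Hence the shifted and unshifted
  children of one type occupy adjacent disjoint ranges, and the common end of these ranges is the
  threshold in \<open>parent\<close>.\<close>

lemma stile_subst:
  assumes "stile (w, k)" "t \<in> tile_subst w k"
  shows "stile t \<and> parent t = (w, k)"
proof -
  define m where "m = rauzy_matrix *v w"
  have h: "hgt w = beta * hgt m" and minv: "minv m = w"
    using hgt_rauzy[of w] by (simp_all add: m_def rauzy_mult minv_def vec_eq_iff forall_3)
  have cub: "beta * (beta ^ 2) = beta ^ 2 + beta + 1"
    using beta_cubic by (simp add: power2_eq_square power3_eq_cube)
  have bp: "beta > 0" using beta_bounds by simp
  have *: "hgt m \<ge> 0" using assms h bp by (auto simp: stile_def zero_le_mult_iff)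
  have thr: "hgt m < c" if "beta * hgt m < beta * c" for c
    using that bp by simp
  have thr1: "beta * hgt m < beta \<Longrightarrow> hgt m < 1"
    using thr[of 1] by simp
  have thr2: "beta * hgt m < beta ^ 2 - beta \<Longrightarrow> hgt m < beta - 1"
    using thr[of "beta - 1"] by (simp add: algebra_simps power2_eq_square)
  have thr3: "beta * hgt m < 1 \<Longrightarrow> hgt m < beta ^ 2 - beta - 1"
    using thr[of "beta ^ 2 - beta - 1"] cub by (simp add: algebra_simps power2_eq_square)
  have m1: "minv (m + vector [1, 0, -1]) = w + axis 2 1" "minv (m + vector [0, 1, -1]) = w + axis 3 1"
    using minv by (auto simp: minv_def vec_eq_iff forall_3 axis_def)
  note b = beta_bounds beta_sq_bounds
  consider "k = 1" | "k = 2" | "k = 3" using exhaust_3 by blast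
  then show ?thesis
  proof cases
    case 1
    with assms h have "beta * hgt m < beta" by (simp add: stile_def wt_simps)
    with thr1 have "hgt m < 1" by blast
    moreover have "t = (m, 3) \<or> t = (m + vector [1, 0, -1], 1) \<or> t = (m + vector [0, 1, -1], 2)"
      using assms 1 by (auto simp: tile_subst_def Let_def m_def column_rauzy)
    ultimately show ?thesis using * b 1
      by (elim disjE) (simp_all add: stile_def wt_simps parent_def minv m1 hgt_add hgt_vector del: vector_add_component)
  next
    case 2
    with assms h have "beta * hgt m < beta ^ 2 - beta" by (simp add: stile_def wt_simps)
    with thr2 have "hgt m < beta - 1" by blast
    moreover have "t = (m, 1)"
      using assms 2 by (auto simp: tile_subst_def Let_def m_def)
    ultimately show ?thesis using * b 2 by (simp add: stile_def wt_simps parent_def minv)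
  next
    case 3
    with assms h have "beta * hgt m < 1" by (simp add: stile_def wt_simps)
    with thr3 have "hgt m < beta ^ 2 - beta - 1" by blast
    moreover have "t = (m, 2)"
      using assms 3 by (auto simp: tile_subst_def Let_def m_def)
    ultimately show ?thesis using * b 3 by (simp add: stile_def wt_simps parent_def minv)
  qed
qed

lemma stile_patch: "t \<in> patch n \<Longrightarrow> stile t"
proof (induction n arbitrary: t)
  case 0
  then show ?case using beta_bounds beta_sq_bounds by (auto simp: stile_def hgt_zero wt_simps)
next
  case (Suc n)
  then obtain w k where "(w, k) \<in> patch n" "t \<in> tile_subst w k" by auto
  with Suc.IH stile_subst show ?case by blast
qed

lemma parent_patch:
  assumes "t \<in> patch (Suc n)" shows "parent t \<in> patch n"
proof -
  obtain w k where "(w, k) \<in> patch n" "t \<in> tile_subst w k" using assms by auto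
  with stile_subst stile_patch show ?thesis by metis
qed

lemma patch_parent: "parent t \<in> patch n \<Longrightarrow> t \<in> patch (Suc n)"
  using tile_subst_parent[of t] by (auto simp: case_prod_beta intro!: bexI[of _ "parent t"])

text \<open>Each range of heights in \<open>parent\<close>, multiplied by \<open>beta\<close> and
  lowered by the height of the subtracted unit vector, becomes the full range of the type of the
  parent.\<close>

lemma stile_parent:
  assumes "stile t" shows "stile (parent t)"
proof -
  obtain w k where t: "t = (w, k)" by force
  have bp: "beta > 0" using beta_bounds by simp
  have cub: "beta * (beta ^ 2) = beta ^ 2 + beta + 1"
    using beta_cubic by (simp add: power2_eq_square power3_eq_cube)
  have w: "0 \<le> beta * hgt w" using assms bp by (auto simp: t stile_def)
  have thr: "beta * hgt w < beta * c" if "hgt w < c" for c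
    using that bp by simp
  have thr': "beta * hgt w \<ge> beta * c" if "\<not> hgt w < c" for c
    using that bp by simp
  note b = beta_bounds beta_sq_bounds
  consider "k = 1" | "k = 2" | "k = 3" using exhaust_3 by blast
  then show ?thesis
  proof cases
    case 1
    then have "hgt w < beta" using assms by (simp add: t stile_def wt_simps)
    then show ?thesis using 1 w b thr[of beta] thr[of "beta - 1"] thr'[of "beta - 1"]
      by (auto simp add: t parent_def stile_def hgt_minv hgt_diff wt_simps wt_def[symmetric]
         algebra_simps power2_eq_square)
  next
    case 2
    then have "hgt w < beta ^ 2 - beta" using assms by (simp add: t stile_def wt_simps)
    then show ?thesis using 2 w b thr[of "beta ^ 2 - beta"] thr[of "beta ^ 2 - beta - 1"] thr'[of "beta ^ 2 - beta - 1"] cub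
      by (auto simp add: t parent_def stile_def hgt_minv hgt_diff wt_simps wt_def[symmetric]
         algebra_simps power2_eq_square)
  next
    case 3
    then have "hgt w < 1" using assms by (simp add: t stile_def wt_simps)
    then show ?thesis using 3 w thr[of 1]
      by (auto simp add: t parent_def stile_def hgt_minv wt_simps)
  qed
qed

section \<open>Corners shared by the parents of all tiles at a vertex\<close>

lemma corner_cases:
  assumes "corner p (w, k)"
  obtains a b where "k = 1" "a \<in> {0, 1}" "b \<in> {0, 1}" "w = p - vector [0, a, b]"
    | a b where "k = 2" "a \<in> {0, 1}" "b \<in> {0, 1}" "w = p - vector [a, 0, b]"
    | a b where "k = 3" "a \<in> {0, 1}" "b \<in> {0, 1}" "w = p - vector [a, b, 0]"
proof -
  have w: "w = p - (p - w)" by simp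
  have c: "\<And>i. (p - w) $ i \<in> {0, 1}" "(p - w) $ k = 0"
    using assms by (auto simp: corner_def)
  have e: "p - w = vector [(p - w) $ 1, (p - w) $ 2, (p - w) $ 3]"
    by (simp add: vec_eq_iff forall_3)
  consider "k = 1" | "k = 2" | "k = 3" using exhaust_3 by blast
  then show ?thesis
  proof cases
    case 1
    have "w = p - vector [0, (p - w) $ 2, (p - w) $ 3]"
      using w e c(2) 1 by metis
    with 1 c(1) that(1) show ?thesis by blast
  next
    case 2
    have "w = p - vector [(p - w) $ 1, 0, (p - w) $ 3]"
      using w e c(2) 2 by metis
    with 2 c(1) that(2) show ?thesis by blast
  next
    case 3
    have "w = p - vector [(p - w) $ 1, (p - w) $ 2, 0]"
      using w e c(2) 3 by metis
    with 3 c(1) that(3) show ?thesis by blast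
  qed
qed

lemma hgt_axis: "hgt (axis a 1) = wt a"
  by (simp add: wt_def)

text \<open>The twelve lattice squares with corner \<open>p\<close> are checked one by one: the
  height of \<open>p\<close> excludes the square or restricts the branch of \<open>parent\<close>,
  and the common corner can be read off. In this and the next two ranges it is \<open>minv p\<close>
  lowered by zero, one or two steps in the first direction.\<close>

lemma corner_parent_low:
  assumes "stile t" "corner p t" "hgt p < beta ^ 2 - beta"
  shows "corner (minv p) (parent t)"
proof -
  obtain w k where t: "t = (w, k)" by force
  note b = beta_bounds beta_sq_bounds
  note defs = t stile_def corner_def parent_def minv_def forall_3 axis_def hgt_diff hgt_vector wt_simps
  show ?thesis using assms(2)[unfolded t]
  proof (cases rule: corner_cases)
    case (1 a c)
    from 1(2,3) show ?thesis using assms(1,3) b 1(1,4)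
      by (elim insertE emptyE; simp add: defs)
  next
    case (2 a c)
    from 2(2,3) show ?thesis using assms(1,3) b 2(1,4)
      by (elim insertE emptyE; simp add: defs)
  next
    case (3 a c)
    from 3(2,3) show ?thesis using assms(1,3) b 3(1,4)
      by (elim insertE emptyE; simp add: defs)
  qed
qed

lemma corner_parent_mid:
  assumes "stile t" "corner p t" "beta \<le> hgt p" "hgt p < beta ^ 2"
  shows "corner (minv p - axis 1 1) (parent t)"
proof -
  obtain w k where t: "t = (w, k)" by force
  note b = beta_bounds beta_sq_bounds
  note defs = t stile_def corner_def parent_def minv_def forall_3 axis_def hgt_diff hgt_vector wt_simps
  show ?thesis using assms(2)[unfolded t]
  proof (cases rule: corner_cases)
    case (1 a c)
    from 1(2,3) show ?thesis using assms(1,3,4) b 1(1,4)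
      by (elim insertE emptyE; simp add: defs)
  next
    case (2 a c)
    from 2(2,3) show ?thesis using assms(1,3,4) b 2(1,4)
      by (elim insertE emptyE; simp add: defs)
  next
    case (3 a c)
    from 3(2,3) show ?thesis using assms(1,3,4) b 3(1,4)
      by (elim insertE emptyE; simp add: defs)
  qed
qed

lemma corner_parent_high:
  assumes "stile t" "corner p t" "beta ^ 2 \<le> hgt p"
  shows "corner (minv p - axis 1 2) (parent t)"
proof -
  obtain w k where t: "t = (w, k)" by force
  note b = beta_bounds beta_sq_bounds
  note defs = t stile_def corner_def parent_def minv_def forall_3 axis_def hgt_diff hgt_vector wt_simps
  show ?thesis using assms(2)[unfolded t]
  proof (cases rule: corner_cases)
    case (1 a c)
    from 1(2,3) show ?thesis using assms(1,3) b 1(1,4)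
      by (elim insertE emptyE; simp add: defs)
  next
    case (2 a c)
    from 2(2,3) show ?thesis using assms(1,3) b 2(1,4)
      by (elim insertE emptyE; simp add: defs)
  next
    case (3 a c)
    from 3(2,3) show ?thesis using assms(1,3) b 3(1,4)
      by (elim insertE emptyE; simp add: defs)
  qed
qed

text \<open>
  In the remaining range of heights the parents of the tiles at a vertex have no common corner,
  but the grandparents have one.
\<close>
lemma corner_grandparent:
  assumes "stile t" "corner p t" "beta ^ 2 - beta \<le> hgt p" "hgt p < beta"
  shows "corner (minv (minv p) - axis 1 1 - axis 2 1) (parent (parent t))"
proof -
  obtain w k where t: "t = (w, k)" by force
  have bp: "beta > 0" using beta_bounds by simp
  have cub: "beta * beta ^ 2 = beta ^ 2 + beta + 1"
    using beta_cubic by (simp add: power2_eq_square power3_eq_cube)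
  have l: "beta + 1 \<le> beta * hgt p"
    using mult_left_mono[OF assms(3), of beta] bp cub by (simp add: algebra_simps power2_eq_square)
  have u: "beta * hgt p < beta ^ 2"
    using assms(4) bp by (simp add: power2_eq_square)
  note b = beta_bounds beta_sq_bounds l u
  note defs = t stile_def parent_def hgt_diff hgt_vector wt_simps
    hgt_minv hgt_axis right_diff_distrib distrib_left cub power2_eq_square[symmetric]
  note defs' = corner_def minv_def forall_3 axis_def
  show ?thesis using assms(2)[unfolded t]
  proof (cases rule: corner_cases)
    case (1 a c)
    from 1(2,3) show ?thesis using assms(1,3,4) b 1(1,4)
      by (elim insertE emptyE; simp add: defs; simp add: defs')
  next
    case (2 a c)
    from 2(2,3) show ?thesis using assms(1,3,4) b 2(1,4)
      by (elim insertE emptyE; simp add: defs; simp add: defs')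
  next
    case (3 a c)
    from 3(2,3) show ?thesis using assms(1,3,4) b 3(1,4)
      by (elim insertE emptyE; simp add: defs; simp add: defs')
  qed
qed

section \<open>The stars of the corners of the initial patch\<close>

lemma patch_0: "patch 0 = {(vector [0, 0, 0], 1), (vector [0, 0, 0], 2), (vector [0, 0, 0], 3)}"
proof -
  have "(0 :: int^3) = vector [0, 0, 0]" by (simp add: vec_eq_iff forall_3)
  then show ?thesis by simp
qed

lemma rauzy_tiling_parent: "parent t \<in> rauzy_tiling \<Longrightarrow> t \<in> rauzy_tiling"
  unfolding rauzy_tiling_def using patch_parent by blast

lemma vector_axis:
  "vector [a, b, c] - axis 2 1 = (vector [a, b - 1, c] :: int^3)"
  "vector [a, b, c] - axis 3 1 = (vector [a, b, c - 1] :: int^3)"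
  "vector [a, b, c] - vector [a', b', c'] = (vector [a - a', b - b', c - c'] :: int^3)"
  "vector [a, b, c] + vector [a', b', c'] = (vector [a + a', b + b', c + c'] :: int^3)"
  by (simp_all add: vec_eq_iff forall_3 axis_def)

lemma tiles_at_origin:
  "(vector [0, 0, 0], 1) \<in> rauzy_tiling" "(vector [0, 0, 0], 2) \<in> rauzy_tiling"
  "(vector [0, 0, 0], 3) \<in> rauzy_tiling"
  unfolding rauzy_tiling_def using patch_0 by blast+

text \<open>Every tile of the slab that meets the initial patch is one of these or one of the three
  initial tiles. They are ordered so that the parent of each is an initial or an earlier
  tile.\<close>

lemma tiles_near_origin:
  "(vector [1, 0, -1], 1) \<in> rauzy_tiling"
  "(vector [0, 1, -1], 2) \<in> rauzy_tiling"
  "(vector [1, -1, 1], 1) \<in> rauzy_tiling"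
  "(vector [1, -1, 0], 1) \<in> rauzy_tiling"
  "(vector [0, 0, 1], 2) \<in> rauzy_tiling"
  "(vector [-1, 1, 1], 2) \<in> rauzy_tiling"
  "(vector [0, 0, 1], 1) \<in> rauzy_tiling"
  "(vector [0, 1, 0], 1) \<in> rauzy_tiling"
  "(vector [0, 1, -1], 1) \<in> rauzy_tiling"
  "(vector [-1, 1, 1], 3) \<in> rauzy_tiling"
  "(vector [1, -1, 0], 3) \<in> rauzy_tiling"
  "(vector [1, 0, -1], 2) \<in> rauzy_tiling"
proof -
  note b = beta_bounds beta_sq_bounds
  note defs = parent_def minv_def hgt_vector vector_axis tiles_at_origin
  show t0: "(vector [1, 0, -1], 1) \<in> rauzy_tiling"
    using b  by (intro rauzy_tiling_parent[of "(vector [1, 0, -1], 1)"]) (simp add: defs)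
  show t1: "(vector [0, 1, -1], 2) \<in> rauzy_tiling"
    using b  by (intro rauzy_tiling_parent[of "(vector [0, 1, -1], 2)"]) (simp add: defs)
  show t2: "(vector [1, -1, 1], 1) \<in> rauzy_tiling"
    using b t0 by (intro rauzy_tiling_parent[of "(vector [1, -1, 1], 1)"]) (simp add: defs)
  show t3: "(vector [1, -1, 0], 1) \<in> rauzy_tiling"
    using b t1 by (intro rauzy_tiling_parent[of "(vector [1, -1, 0], 1)"]) (simp add: defs)
  show t4: "(vector [0, 0, 1], 2) \<in> rauzy_tiling"
    using b t0 by (intro rauzy_tiling_parent[of "(vector [0, 0, 1], 2)"]) (simp add: defs)
  show t5: "(vector [-1, 1, 1], 2) \<in> rauzy_tiling"
    using b t3 by (intro rauzy_tiling_parent[of "(vector [-1, 1, 1], 2)"]) (simp add: defs)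
  show t6: "(vector [0, 0, 1], 1) \<in> rauzy_tiling"
    using b t3 by (intro rauzy_tiling_parent[of "(vector [0, 0, 1], 1)"]) (simp add: defs)
  show t7: "(vector [0, 1, 0], 1) \<in> rauzy_tiling"
    using b t2 by (intro rauzy_tiling_parent[of "(vector [0, 1, 0], 1)"]) (simp add: defs)
  show t8: "(vector [0, 1, -1], 1) \<in> rauzy_tiling"
    using b t4 by (intro rauzy_tiling_parent[of "(vector [0, 1, -1], 1)"]) (simp add: defs)
  show t9: "(vector [-1, 1, 1], 3) \<in> rauzy_tiling"
    using b t2 by (intro rauzy_tiling_parent[of "(vector [-1, 1, 1], 3)"]) (simp add: defs)
  show t10: "(vector [1, -1, 0], 3) \<in> rauzy_tiling"
    using b t8 by (intro rauzy_tiling_parent[of "(vector [1, -1, 0], 3)"]) (simp add: defs)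
  show t11: "(vector [1, 0, -1], 2) \<in> rauzy_tiling"
    using b t8 by (intro rauzy_tiling_parent[of "(vector [1, 0, -1], 2)"]) (simp add: defs)
qed

lemma patch_0_corners:
  assumes "t \<in> patch 0" "corner p t"
  shows "p \<in> {vector [0, 0, 0], vector [0, 0, 1], vector [0, 1, 0], vector [0, 1, 1], vector [1, 0, 0], vector [1, 0, 1], vector [1, 1, 0]}"
proof -
  obtain w k where t: "t = (w, k)" by force
  have w: "w = vector [0, 0, 0]" using assms(1) by (auto simp: patch_0 t simp del: patch.simps)
  then have p: "w = p - v \<longleftrightarrow> p = v" for v by (auto simp: vec_eq_iff forall_3)
  show ?thesis using assms(2)[unfolded t]
    by (cases rule: corner_cases; elim insertE emptyE; simp add: p)
qed

lemma star_at_origin: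
  assumes "p \<in> {vector [0, 0, 0], vector [0, 0, 1], vector [0, 1, 0], vector [0, 1, 1], vector [1, 0, 0], vector [1, 0, 1], vector [1, 1, 0]}" "stile t" "corner p t"
  shows "t \<in> rauzy_tiling"
proof -
  obtain w k where t: "t = (w, k)" by force
  note b = beta_bounds beta_sq_bounds
  note defs = stile_def hgt_vector tiles_at_origin tiles_near_origin wt_simps
  obtain i j l where p: "p = vector [i, j, l]" and
    ijl: "(i, j, l) \<in> {(0, 0, 0), (0, 0, 1), (0, 1, 0), (0, 1, 1), (1, 0, 0), (1, 0, 1), (1, 1, 0)}"
    using assms(1) by blast
  show ?thesis using assms(3)[unfolded t] unfolding t
  proof (cases rule: corner_cases)
    case (1 a c)
    have "w = vector [i, j - a, l - c]" using 1(4) p by (simp add: vector_axis)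
    with 1(2,3) ijl show "(w, k) \<in> rauzy_tiling" using assms(2)[unfolded t] b 1(1)
      by (elim insertE emptyE; simp add: defs)
  next
    case (2 a c)
    have "w = vector [i - a, j, l - c]" using 2(4) p by (simp add: vector_axis)
    with 2(2,3) ijl show "(w, k) \<in> rauzy_tiling" using assms(2)[unfolded t] b 2(1)
      by (elim insertE emptyE; simp add: defs)
  next
    case (3 a c)
    have "w = vector [i - a, j - c, l]" using 3(4) p by (simp add: vector_axis)
    with 3(2,3) ijl show "(w, k) \<in> rauzy_tiling" using assms(2)[unfolded t] b 3(1)
      by (elim insertE emptyE; simp add: defs)
  qed
qed

text \<open>The initial patch is closed under \<open>parent\<close>, hence so are all patches. This
  lets the induction below pass to grandparents while the index drops by one only.\<close>

lemma parent_patch_same: "t \<in> patch n \<Longrightarrow> parent t \<in> patch n"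
proof (induction n arbitrary: t)
  case 0
  then show ?case using beta_bounds beta_sq_bounds
    by (auto simp: patch_0 parent_def minv_def hgt_vector simp del: patch.simps)
next
  case (Suc n)
  then show ?case using parent_patch patch_parent by blast
qed

text \<open>Induction on the index for all vertices at once: the parents of all tiles at
  \<open>p\<close>, or else their grandparents, share a corner, where the induction hypothesis
  applies; the substitution carries the result back to \<open>p\<close>.\<close>

lemma patch_star:
  assumes "t \<in> patch n" "corner p t" "stile t'" "corner p t'"
  shows "t' \<in> rauzy_tiling"
  using assms
proof (induction n arbitrary: t t' p)
  case 0
  then show ?case using patch_0_corners star_at_origin by blast
next
  case (Suc n)
  have t: "stile t" "parent t \<in> patch n" "parent (parent t) \<in> patch n"
    using Suc.prems(1) stile_patch parent_patch parent_patch_same by blast+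
  have t': "stile (parent t')" "stile (parent (parent t'))"
    using stile_parent Suc.prems(3) by blast+
  consider "hgt p < beta ^ 2 - beta" | "beta ^ 2 - beta \<le> hgt p" "hgt p < beta"
    | "beta \<le> hgt p" "hgt p < beta ^ 2" | "beta ^ 2 \<le> hgt p" by linarith
  then show ?case
  proof cases
    case 1
    with Suc.IH[OF t(2) corner_parent_low t'(1) corner_parent_low] t Suc.prems
    show ?thesis using rauzy_tiling_parent by blast
  next
    case 2
    with Suc.IH[OF t(3) corner_grandparent t'(2) corner_grandparent] t Suc.prems
    show ?thesis using rauzy_tiling_parent by blast
  next
    case 3
    with Suc.IH[OF t(2) corner_parent_mid t'(1) corner_parent_mid] t Suc.prems
    show ?thesis using rauzy_tiling_parent by blast
  next
    case 4
    with Suc.IH[OF t(2) corner_parent_high t'(1) corner_parent_high] t Suc.prems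
    show ?thesis using rauzy_tiling_parent by blast
  qed
qed

section \<open>Every tile of the slab belongs to the tiling\<close>

lemma wt_pos: "wt a > 0"
  using exhaust_3[of a] beta_bounds beta_sq_bounds by (auto simp: wt_simps)

lemma wt_sum:
  assumes "a \<noteq> b" "a \<noteq> c" "b \<noteq> c"
  shows "wt a + wt b + wt c = beta ^ 2 + 1"
  using assms exhaust_3[of a] exhaust_3[of b] exhaust_3[of c] by (auto simp: wt_simps)

lemma other_indices:
  fixes a :: 3
  obtains b c :: 3 where "a \<noteq> b" "a \<noteq> c" "b \<noteq> c"
  using exhaust_3[of a] three_neq by metis

text \<open>The square over the edge that goes up in direction \<open>b\<close> lies in the slab if
  \<open>p\<close> is lower than the weight of \<open>c\<close>; otherwise the square that goes down
  in direction \<open>c\<close> does.\<close>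

lemma edge_in_tile:
  assumes "slab p" "slab (p + axis a 1)"
  shows "\<exists>t. stile t \<and> corner p t \<and> corner (p + axis a 1) t"
proof -
  obtain b c :: 3 where abc: "a \<noteq> b" "a \<noteq> c" "b \<noteq> c" by (rule other_indices)
  show ?thesis
  proof (cases "hgt p < wt c")
    case True
    then have "stile (p, c)" using assms(1) by (simp add: stile_def slab_def)
    moreover have "corner p (p, c)" "corner (p + axis a 1) (p, c)"
      using abc by (auto simp: corner_def axis_def)
    ultimately show ?thesis by blast
  next
    case False
    then have "stile (p - axis c 1, b)"
      using assms wt_sum[OF abc] by (simp add: stile_def slab_def hgt_add hgt_diff hgt_axis)
    moreover have "corner p (p - axis c 1, b)" "corner (p + axis a 1) (p - axis c 1, b)"
      using abc by (auto simp: corner_def axis_def)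
    ultimately show ?thesis by blast
  qed
qed

text \<open>From every point of the slab one can walk to the origin inside the slab.\<close>
lemma star_in_rauzy:
  assumes "slab w" "stile t" "corner w t"
  shows "t \<in> rauzy_tiling"
  using assms
proof (induction "nat (\<bar>w $ 1\<bar> + \<bar>w $ 2\<bar> + \<bar>w $ 3\<bar>)" arbitrary: w t rule: less_induct)
  case less
  have step: ?case if "slab w'" "w' = w - axis a 1 \<and> w $ a > 0 \<or> w' = w + axis a 1 \<and> w $ a < 0" for w' a
  proof -
    have "nat (\<bar>w' $ 1\<bar> + \<bar>w' $ 2\<bar> + \<bar>w' $ 3\<bar>) < nat (\<bar>w $ 1\<bar> + \<bar>w $ 2\<bar> + \<bar>w $ 3\<bar>)"
      using that(2) exhaust_3[of a] by (auto simp: axis_def)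
    note IH = less.hyps[OF this that(1)]
    have "\<exists>u. stile u \<and> corner w u \<and> corner w' u"
    proof (cases "w' = w + axis a 1")
      case True
      then show ?thesis using edge_in_tile[of w a] that(1) less.prems(1) by simp
    next
      case False
      then have "w = w' + axis a 1" using that(2) by auto
      then show ?thesis using edge_in_tile[of w' a] that(1) less.prems(1) by auto
    qed
    then obtain u where u: "stile u" "corner w u" "corner w' u" by blast
    then have "u \<in> rauzy_tiling" using IH by blast
    then show ?thesis using patch_star u less.prems unfolding rauzy_tiling_def by blast
  qed
  have w: "0 \<le> hgt w" "hgt w < beta ^ 2 + 1" using less.prems(1) by (auto simp: slab_def)
  show ?case
  \<comment> \<open>If no coordinate can be moved towards zero inside the slab, then
    \<open>w\<close> is zero. A positive coordinate in direction \<open>a\<close> forces a height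
    below \<open>wt a\<close>, a negative one in direction \<open>b\<close> a height of at least the
    sum of the other two weights, so the signs are not mixed; with one sign only, the height is too
    large or negative.\<close>
  proof (cases "\<exists>a. w $ a > 0 \<and> hgt w \<ge> wt a \<or> w $ a < 0 \<and> hgt w + wt a < beta ^ 2 + 1")
    case True
    then obtain a where "w $ a > 0 \<and> hgt w \<ge> wt a \<or> w $ a < 0 \<and> hgt w + wt a < beta ^ 2 + 1" by blast
    then show ?thesis
    proof
      assume "w $ a > 0 \<and> hgt w \<ge> wt a"
      then show ?thesis using w wt_pos[of a]
        by (intro step[of "w - axis a 1" a]) (auto simp: slab_def hgt_diff hgt_axis)
    next
      assume "w $ a < 0 \<and> hgt w + wt a < beta ^ 2 + 1"
      then show ?thesis using w wt_pos[of a]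
        by (intro step[of "w + axis a 1" a]) (auto simp: slab_def hgt_add hgt_axis)
    qed
  next
    case False
    have hw: "hgt w = wt 1 * w $ 1 + wt 2 * w $ 2 + wt 3 * w $ 3"
      by (simp add: hgt_def wt_simps)
    have bnd: "w $ a > 0 \<Longrightarrow> hgt w < wt a" "w $ a < 0 \<Longrightarrow> hgt w + wt a \<ge> beta ^ 2 + 1" for a
      using False by (meson not_le_imp_less)+
    have mixed: False if "w $ a > 0" "w $ b < 0" for a b
    proof -
      from that have "a \<noteq> b" by auto
      moreover obtain c :: 3 where "c \<noteq> a" "c \<noteq> b"
        using exhaust_3[of a] exhaust_3[of b] three_neq by metis
      ultimately have "wt a + wt b + wt c = beta ^ 2 + 1" by (intro wt_sum) auto
      with bnd(1)[OF that(1)] bnd(2)[OF that(2)] wt_pos[of c] show False by linarith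
    qed
    have "w = 0"
    proof (rule ccontr)
      assume "w \<noteq> 0"
      then obtain a where a: "w $ a \<noteq> 0" by (auto simp: vec_eq_iff)
      show False
      proof (cases "w $ a > 0")
        case True
        then have nn: "w $ i \<ge> 0" for i using mixed[of a i] by force
        have "wt i * w $ i \<ge> 0" for i using nn[of i] wt_pos[of i] by simp
        moreover have "wt a * 1 \<le> wt a * w $ a"
          using True wt_pos[of a] by (intro mult_left_mono) auto
        ultimately have "wt a \<le> hgt w"
          using exhaust_3[of a] hw by (smt (verit, best))
        with bnd(1)[OF True] show False by simp
      next
        case False
        with a have neg: "w $ a < 0" by simp
        then have np: "w $ i \<le> 0" for i using mixed[of i a] by force
        have "wt i * w $ i \<le> 0" for i using np[of i] wt_pos[of i] by (simp add: mult_le_0_iff)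
        moreover have "wt a * w $ a < 0" using neg wt_pos[of a] by (simp add: mult_less_0_iff)
        ultimately have "hgt w < 0"
          using exhaust_3[of a] hw by (smt (verit, best))
        with w(1) show False by simp
      qed
    qed
    then have "corner w (0, 1)" by (simp add: corner_def)
    then show ?thesis using patch_star[of "(0, 1)" 0] less.prems by auto
  qed
qed

lemma rauzy_tiling_eq: "rauzy_tiling = {t. stile t}"
proof (intro equalityI subsetI CollectI)
  fix t assume "t \<in> rauzy_tiling"
  then show "stile t" unfolding rauzy_tiling_def using stile_patch by blast
next
  fix t assume "t \<in> {t. stile t}"
  moreover obtain w k where "t = (w, k)" by force
  moreover obtain b c where "k \<noteq> b" "k \<noteq> c" "b \<noteq> c" by (rule other_indices)
  ultimately show "t \<in> rauzy_tiling"
    using star_in_rauzy[of w t] wt_sum[of k b c] wt_pos[of b] wt_pos[of c]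
    by (auto simp: stile_def slab_def corner_def)
qed

section \<open>Rhombi as unit squares of the lattice\<close>

lemma proj_lattice_add: "proj_lattice (u + w) = proj_lattice u + proj_lattice w"
  by (simp add: proj_lattice_def proj_plane_def algebra_simps)

lemma proj_lattice_axis: "proj_lattice (axis a 1) = pe a" "proj_lattice (axis a (-1)) = - pe a"
proof -
  have "(\<chi> i. real_of_int (axis a 1 $ i)) = axis a 1" "(\<chi> i. real_of_int (axis a (-1) $ i)) = - axis a 1"
    by (simp_all add: vec_eq_iff axis_def)
  moreover have "proj_plane (- x) = - proj_plane x" for x by (simp add: proj_plane_def)
  ultimately show "proj_lattice (axis a 1) = pe a" "proj_lattice (axis a (-1)) = - pe a"
    by (simp_all add: proj_lattice_def pe_def)
qed

lemma hgt_axis_scaled: "hgt (axis a r) = wt a * r"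
proof -
  have "axis a r = (\<chi> i. r * axis a 1 $ i)" by (simp add: vec_eq_iff axis_def)
  then have "hgt (axis a r) = r * hgt (axis a 1)" by (simp add: hgt_def algebra_simps)
  then show ?thesis by (simp add: hgt_axis)
qed

lemma proj_lattice_inj:
  assumes "slab u" "slab w" "proj_lattice u = proj_lattice w"
  shows "u = w"
proof -
  let ?d = "\<lambda>i. real_of_int (u $ i) - w $ i"
  have "proj_lattice u $ 1 = proj_lattice w $ 1" "proj_lattice u $ 2 = proj_lattice w $ 2"
    using assms(3) by simp_all
  then have "sqrt 3 * ?d 2 = sqrt 3 * ?d 1" "2 * ?d 3 = ?d 1 + ?d 2"
    by (simp_all add: proj_lattice_def proj_plane_def field_simps)
  then have d: "?d 2 = ?d 1" "?d 3 = ?d 1" by simp_all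
  have "hgt u - hgt w = beta * ?d 1 + (beta ^ 2 - beta) * ?d 2 + ?d 3"
    by (simp add: hgt_def algebra_simps)
  also have "\<dots> = (beta ^ 2 + 1) * ?d 1" unfolding d by (simp add: algebra_simps)
  finally have h: "hgt u - hgt w = (beta ^ 2 + 1) * ?d 1" .
  have "\<bar>hgt u - hgt w\<bar> < beta ^ 2 + 1" using assms by (auto simp: slab_def)
  then have "(beta ^ 2 + 1) * \<bar>?d 1\<bar> < (beta ^ 2 + 1) * 1"
    unfolding h by (simp add: abs_mult)
  moreover have "beta ^ 2 + 1 > 0" using beta_sq_bounds by simp
  ultimately have "\<bar>?d 1\<bar> < 1" using mult_less_cancel_left_pos by blast
  then have "u $ 1 = w $ 1" by linarith
  with d have "u $ 1 = w $ 1 \<and> u $ 2 = w $ 2 \<and> u $ 3 = w $ 3" by linarith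
  then show ?thesis by (simp add: vec_eq_iff forall_3)
qed

text \<open>A lattice square seen from an arbitrary corner \<open>w\<close>, with directed sides
  \<open>r\<close> times the unit vector of \<open>a\<close> and \<open>t\<close> times that of
  \<open>b\<close>. The signs put all four corners on an equal footing.\<close>

definition sq :: "int^3 \<Rightarrow> 3 \<Rightarrow> int \<Rightarrow> 3 \<Rightarrow> int \<Rightarrow> bool" where
  "sq w a r b t \<longleftrightarrow> a \<noteq> b \<and> r \<in> {1, -1} \<and> t \<in> {1, -1} \<and> slab w \<and> slab (w + axis a r)
    \<and> slab (w + axis b t) \<and> slab (w + axis a r + axis b t)"

lemma axis_cancel:
  fixes w :: "int^3"
  shows "w + axis a 1 + axis a (-1) = w" "w + axis a (-1) + axis a 1 = w"
    "w + axis a (-1) + axis b t + axis a 1 = w + axis b t"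
    "w + axis a 1 + axis b t + axis a (-1) = w + axis b t"
  by (simp_all add: vec_eq_iff axis_def)

lemma slab_between:
  assumes "slab u" "slab w" "hgt u \<le> hgt p" "hgt p \<le> hgt w"
  shows "slab p"
  using assms by (auto simp: slab_def)

lemma stile_iff:
  assumes "i \<noteq> j" "i \<noteq> k" "j \<noteq> k"
  shows "stile (w, k) \<longleftrightarrow> slab w \<and> slab (w + axis i 1 + axis j 1)"
  using wt_sum[OF assms] wt_pos[of i] wt_pos[of j] wt_pos[of k]
  by (auto simp: stile_def slab_def hgt_add hgt_axis)

lemma rotate_4:
  "rotate 1 [p1, p2, p3, p4] = [p2, p3, p4, p1]" "rotate 2 [p1, p2, p3, p4] = [p3, p4, p1, p2]"
  "rotate 3 [p1, p2, p3, p4] = [p4, p1, p2, p3]"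
  by (simp_all add: numeral_3_eq_3 numeral_2_eq_2)

text \<open>The four rotations of a tile correspond to the four choices of signs, and the two
  directions are exchanged by each quarter turn. From here on this is the working definition of a
  rhombus.\<close>

lemma rhombus_corners_iff:
  "rhombus z u y v \<longleftrightarrow> (\<exists>w a r b t. sq w a r b t \<and> z = proj_lattice w \<and> u = proj_lattice (w + axis a r)
     \<and> y = proj_lattice (w + axis a r + axis b t) \<and> v = proj_lattice (w + axis b t))"
  (is "_ = ?R")
proof
  assume "rhombus z u y v"
  then obtain w k i j m where tile: "(w, k) \<in> rauzy_tiling" and ijk: "i \<noteq> j" "i \<noteq> k" "j \<noteq> k"
    and rot: "[z, u, y, v] = rotate m [proj_lattice w, proj_lattice w + pe i,
                   proj_lattice w + pe i + pe j, proj_lattice w + pe j]"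
    by (auto simp: rhombus_def)
  have "slab w" "slab (w + axis i 1 + axis j 1)"
    using tile stile_iff[OF ijk] by (auto simp: rauzy_tiling_eq)
  then have sl: "slab w" "slab (w + axis i 1)" "slab (w + axis j 1)" "slab (w + axis i 1 + axis j 1)"
      "slab (w + axis j 1 + axis i 1)"
    using slab_between[of w "w + axis i 1 + axis j 1"] wt_pos[of i] wt_pos[of j]
    by (auto simp: hgt_add hgt_axis add_ac)
  have e: "w + axis j 1 + axis i 1 = w + axis i 1 + axis j 1" by (simp add: add_ac)
  have "m mod 4 = 0 \<or> m mod 4 = 1 \<or> m mod 4 = 2 \<or> m mod 4 = 3" by presburger
  moreover have "[z, u, y, v] = rotate (m mod 4) [proj_lattice w, proj_lattice w + pe i,
                   proj_lattice w + pe i + pe j, proj_lattice w + pe j]"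
    by (subst rot, subst rotate_conv_mod) simp
  ultimately have "(z = proj_lattice w \<and> u = proj_lattice (w + axis i 1)
        \<and> y = proj_lattice (w + axis i 1 + axis j 1) \<and> v = proj_lattice (w + axis j 1))
    \<or> (z = proj_lattice (w + axis i 1) \<and> u = proj_lattice (w + axis i 1 + axis j 1)
        \<and> y = proj_lattice (w + axis j 1) \<and> v = proj_lattice w)
    \<or> (z = proj_lattice (w + axis i 1 + axis j 1) \<and> u = proj_lattice (w + axis j 1)
        \<and> y = proj_lattice w \<and> v = proj_lattice (w + axis i 1))
    \<or> (z = proj_lattice (w + axis j 1) \<and> u = proj_lattice w
        \<and> y = proj_lattice (w + axis i 1) \<and> v = proj_lattice (w + axis i 1 + axis j 1))"
    by (elim disjE) (simp_all add: proj_lattice_add proj_lattice_axis rotate_4)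
  then show ?R
  proof (elim disjE)
    assume *: "z = proj_lattice w \<and> u = proj_lattice (w + axis i 1)
        \<and> y = proj_lattice (w + axis i 1 + axis j 1) \<and> v = proj_lattice (w + axis j 1)"
    then show ?R using sl ijk by (intro exI[of _ w] exI[of _ i] exI[of _ 1] exI[of _ j]) (simp add: sq_def)
  next
    assume *: "z = proj_lattice (w + axis i 1) \<and> u = proj_lattice (w + axis i 1 + axis j 1)
        \<and> y = proj_lattice (w + axis j 1) \<and> v = proj_lattice w"
    then show ?R using sl ijk
      by (intro exI[of _ "w + axis i 1"] exI[of _ j] exI[of _ 1] exI[of _ i] exI[of _ "-1"]) (simp add: sq_def axis_cancel e)
  next
    assume *: "z = proj_lattice (w + axis i 1 + axis j 1) \<and> u = proj_lattice (w + axis j 1)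
        \<and> y = proj_lattice w \<and> v = proj_lattice (w + axis i 1)"
    then show ?R using sl ijk
      by (intro exI[of _ "w + axis i 1 + axis j 1"] exI[of _ i] exI[of _ "-1"] exI[of _ j] exI[of _ "-1"]) (simp add: sq_def axis_cancel e)
  next
    assume *: "z = proj_lattice (w + axis j 1) \<and> u = proj_lattice w
        \<and> y = proj_lattice (w + axis i 1) \<and> v = proj_lattice (w + axis i 1 + axis j 1)"
    then show ?R using sl ijk
      by (intro exI[of _ "w + axis j 1"] exI[of _ j] exI[of _ "-1"] exI[of _ i] exI[of _ 1]) (simp add: sq_def axis_cancel e)
  qed
next
  assume ?R
  then obtain w a r b t where sq: "sq w a r b t" and z: "z = proj_lattice w" "u = proj_lattice (w + axis a r)"
     "y = proj_lattice (w + axis a r + axis b t)" "v = proj_lattice (w + axis b t)" by blast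
  have ab: "a \<noteq> b" and rt: "r = 1 \<or> r = -1" "t = 1 \<or> t = -1" using sq by (auto simp: sq_def)
  then obtain k where k: "a \<noteq> k" "b \<noteq> k" using exhaust_3[of a] exhaust_3[of b] three_neq by metis
  have *: "rhombus z u y v"
    if "slab q" "slab (q + axis i 1 + axis j 1)" "i \<noteq> j" "i \<noteq> k" "j \<noteq> k"
      "[z, u, y, v] = rotate m [proj_lattice q, proj_lattice q + pe i,
                   proj_lattice q + pe i + pe j, proj_lattice q + pe j]" for q i j m
    unfolding rhombus_def rauzy_tiling_eq using that stile_iff by blast
  have P: "proj_lattice q + pe i = proj_lattice (q + axis i 1)" for q i
    by (simp add: proj_lattice_add proj_lattice_axis)
  from rt show "rhombus z u y v"
  proof (elim disjE)
    assume "r = 1" "t = 1"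
    then show ?thesis using sq ab k z
      by (intro *[of w a b 0]) (auto simp: sq_def P)
  next
    assume "r = 1" "t = -1"
    moreover have e: "w + axis b (-1) + axis a 1 = w + axis a 1 + axis b (-1)" by (simp add: add_ac)
    ultimately show ?thesis using sq ab k z
      by (intro *[of "w + axis b (-1)" b a 1]) (auto simp: sq_def P rotate_4 axis_cancel e)
  next
    assume "r = -1" "t = 1"
    then show ?thesis using sq ab k z
      by (intro *[of "w + axis a (-1)" b a 3]) (auto simp: sq_def P rotate_4 axis_cancel)
  next
    assume "r = -1" "t = -1"
    then show ?thesis using sq ab k z
      by (intro *[of "w + axis a (-1) + axis b (-1)" a b 2]) (auto simp: sq_def P rotate_4 axis_cancel)
  qed
qed

lemma proj_lattice_eq_iff:
  "slab u \<Longrightarrow> slab w \<Longrightarrow> proj_lattice u = proj_lattice w \<longleftrightarrow> u = w"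
  using proj_lattice_inj by blast

lemma sq_exists:
  assumes "slab w" "slab (w + axis a r)" "r \<in> {1, -1}"
  obtains b t where "sq w a r b t"
proof -
  obtain b c :: 3 where abc: "a \<noteq> b" "a \<noteq> c" "b \<noteq> c" by (rule other_indices)
  note facts = wt_sum[OF abc] wt_pos[of a] wt_pos[of b] wt_pos[of c]
  \<comment> \<open>The height of the lower end of the edge. It alone decides which squares over the
    edge exist.\<close>
  define h where "h = (if r = 1 then hgt w else hgt w - wt a)"
  show ?thesis
  proof (cases "h < wt c")
    case True
    then have "sq w a r b 1" using assms abc facts
      by (auto simp: sq_def slab_def hgt_add hgt_axis_scaled h_def)
    then show ?thesis by (rule that)
  next
    case False
    then have "sq w a r c (-1)" using assms abc facts
      by (auto simp: sq_def slab_def hgt_add hgt_axis_scaled h_def)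
    then show ?thesis by (rule that)
  qed
qed

lemma edge_iff:
  "edge z u \<longleftrightarrow> (\<exists>w a r. r \<in> {1, -1} \<and> slab w \<and> slab (w + axis a r) \<and> z = proj_lattice w
     \<and> u = proj_lattice (w + axis a r))"
proof
  assume "edge z u"
  then show "\<exists>w a r. r \<in> {1, -1} \<and> slab w \<and> slab (w + axis a r) \<and> z = proj_lattice w
     \<and> u = proj_lattice (w + axis a r)"
    by (auto simp: edge_def rhombus_corners_iff sq_def)
next
  assume "\<exists>w a r. r \<in> {1, -1} \<and> slab w \<and> slab (w + axis a r) \<and> z = proj_lattice w
     \<and> u = proj_lattice (w + axis a r)"
  then obtain w a r where *: "r \<in> {1, -1}" "slab w" "slab (w + axis a r)" "z = proj_lattice w"
     "u = proj_lattice (w + axis a r)" by blast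
  then obtain b t where "sq w a r b t" using sq_exists by metis
  with * show "edge z u" unfolding edge_def rhombus_corners_iff by blast
qed

lemma vertex_iff: "vertex z \<longleftrightarrow> (\<exists>w. slab w \<and> z = proj_lattice w)"
proof
  assume "vertex z"
  then show "\<exists>w. slab w \<and> z = proj_lattice w"
    by (auto simp: vertex_def rhombus_corners_iff sq_def)
next
  assume "\<exists>w. slab w \<and> z = proj_lattice w"
  then obtain w where w: "slab w" "z = proj_lattice w" by blast
  \<comment> \<open>A step of height 1 fits into the slab upwards or downwards, so every point of
    the slab is the end of an edge.\<close>
  have "slab (w + axis 3 1) \<or> slab (w + axis 3 (-1))"
    using w(1) beta_sq_bounds by (auto simp: slab_def hgt_add hgt_axis_scaled wt_simps)
  with w have "edge z (proj_lattice (w + axis 3 1)) \<or> edge z (proj_lattice (w + axis 3 (-1)))"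
    unfolding edge_iff by blast
  then show "vertex z" by (auto simp: vertex_def edge_def)
qed

section \<open>Symmetries of rhombi, edges and vertices\<close>

lemma axis_cancel':
  fixes w :: "int^3"
  shows "w + axis a r + axis a (- r) = w" "w + axis a r + axis b t + axis a (- r) = w + axis b t"
  by (simp_all add: vec_eq_iff axis_def)

lemma sq_rotate: "sq w a r b t \<Longrightarrow> sq (w + axis a r) b t a (- r)"
  by (auto simp: sq_def axis_cancel')

lemma sq_flip: "sq w a r b t \<Longrightarrow> sq w b t a r"
  by (auto simp: sq_def add_ac)

lemma rhombus_rotate:
  assumes "rhombus z u y v" shows "rhombus u y v z"
proof -
  from assms obtain w a r b t where *: "sq w a r b t" "z = proj_lattice w" "u = proj_lattice (w + axis a r)"
     "y = proj_lattice (w + axis a r + axis b t)" "v = proj_lattice (w + axis b t)"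
    unfolding rhombus_corners_iff by blast
  from * sq_rotate[OF *(1)] axis_cancel'[of w a r] show ?thesis
    unfolding rhombus_corners_iff by metis
qed

lemma rhombus_flip: "rhombus z u y v \<Longrightarrow> rhombus z v y u"
proof -
  assume "rhombus z u y v"
  then obtain w a r b t where *: "sq w a r b t" "z = proj_lattice w" "u = proj_lattice (w + axis a r)"
     "y = proj_lattice (w + axis a r + axis b t)" "v = proj_lattice (w + axis b t)"
    unfolding rhombus_corners_iff by blast
  moreover have "w + axis a r + axis b t = w + axis b t + axis a r" by (simp add: add_ac)
  ultimately show ?thesis unfolding rhombus_corners_iff using sq_flip by metis
qed

lemma rhombus_opposite: "rhombus z u y v \<Longrightarrow> rhombus y u z v"
  using rhombus_rotate rhombus_flip by blast

lemma rhombus_parallelogram: "rhombus z u y v \<Longrightarrow> y = u + v - z"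
  by (auto simp: rhombus_corners_iff proj_lattice_add)

lemma edge_sym: "edge z u \<Longrightarrow> edge u z"
  unfolding edge_def using rhombus_rotate rhombus_flip by blast

lemma edge_vertex: assumes "edge z u" shows "vertex z" "vertex u"
  using assms edge_sym unfolding edge_def vertex_def by blast+

lemma rhombus_edge:
  assumes "rhombus z u y v"
  shows "edge z u" "edge u y" "edge y v" "edge v z" "edge u z" "edge y u" "edge v y" "edge z v"
    "vertex z" "vertex u" "vertex y" "vertex v"
proof -
  show *: "edge z u" "edge u y" "edge y v" "edge v z"
    using assms rhombus_rotate unfolding edge_def by blast+
  then show "edge u z" "edge y u" "edge v y" "edge z v" by (simp_all add: edge_sym)
  from * show "vertex z" "vertex u" "vertex y" "vertex v" using edge_vertex by blast+
qed

lemma axis_eq_axis: "r \<noteq> 0 \<Longrightarrow> axis a r = axis b t \<longleftrightarrow> a = b \<and> r = (t :: int)"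
  by (auto simp: axis_def vec_eq_iff split: if_splits)

lemma rhombus_distinct:
  assumes "rhombus z u y v"
  shows "z \<noteq> u" "z \<noteq> v" "z \<noteq> y" "u \<noteq> v" "u \<noteq> y" "v \<noteq> y"
proof -
  have zu: "z \<noteq> u" if "edge z u" for z u
  proof
    assume "z = u"
    with that obtain w a r where *: "r \<in> {1, -1}" "slab w" "slab (w + axis a r)"
        "proj_lattice w = proj_lattice (w + axis a r)"
      unfolding edge_iff by auto
    then have "w = w + axis a r" using proj_lattice_inj by blast
    then have "axis a r $ a = 0" by simp
    with *(1) show False by (auto simp: axis_def)
  qed
  have uv: "u \<noteq> v" if "rhombus z u y v" for z u y v
  proof -
    from that obtain w a r b t where *: "sq w a r b t" "u = proj_lattice (w + axis a r)"
        "v = proj_lattice (w + axis b t)"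
      unfolding rhombus_corners_iff by blast
    then have "w + axis a r \<noteq> w + axis b t" by (auto simp: sq_def axis_eq_axis)
    with * show ?thesis by (simp add: sq_def proj_lattice_eq_iff)
  qed
  show "z \<noteq> u" "z \<noteq> v" "u \<noteq> y" "v \<noteq> y" using rhombus_edge[OF assms] zu by blast+
  show "u \<noteq> v" "z \<noteq> y" using uv assms rhombus_rotate by blast+
qed

section \<open>Lifting adjacent rhombi to adjacent squares\<close>

lemma rhombus_lift:
  assumes "rhombus (proj_lattice w) u y v" "slab w"
  obtains a r b t where "sq w a r b t" "u = proj_lattice (w + axis a r)"
     "y = proj_lattice (w + axis a r + axis b t)" "v = proj_lattice (w + axis b t)"
proof -
  from assms obtain w' a r b t where *: "sq w' a r b t" "proj_lattice w = proj_lattice w'"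
     "u = proj_lattice (w' + axis a r)"
     "y = proj_lattice (w' + axis a r + axis b t)" "v = proj_lattice (w' + axis b t)"
    unfolding rhombus_corners_iff by blast
  then have "w = w'" using assms(2) by (simp add: sq_def proj_lattice_eq_iff)
  with * that show thesis by blast
qed

lemma rhombus_lift_edge:
  assumes "rhombus (proj_lattice w) (proj_lattice (w + axis a r)) y v" "slab w" "slab (w + axis a r)" "r \<noteq> 0"
  obtains b t where "sq w a r b t" "y = proj_lattice (w + axis a r + axis b t)" "v = proj_lattice (w + axis b t)"
proof -
  obtain a' r' b t where *: "sq w a' r' b t" "proj_lattice (w + axis a r) = proj_lattice (w + axis a' r')"
     "y = proj_lattice (w + axis a' r' + axis b t)" "v = proj_lattice (w + axis b t)"
    by (rule rhombus_lift[OF assms(1,2)])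
  then have "w + axis a r = w + axis a' r'" using assms(3) by (simp add: sq_def proj_lattice_eq_iff)
  then have "a' = a" "r' = r" using axis_eq_axis[OF assms(4), of a a' r'] by simp_all
  with * show thesis by (intro that[of b t]) simp_all
qed

text \<open>
  Two opposite vertices of the cube differ by (1,1,1), whose height is the width of the slab.
\<close>
lemma no_cube:
  assumes "a \<noteq> b" "a \<noteq> c" "b \<noteq> c" "r \<in> {1, -1}" "t \<in> {1, -1}" "q \<in> {1, -1 :: int}"
    and "slab w" "slab (w + axis a r)" "slab (w + axis b t)" "slab (w + axis c q)"
    "slab (w + axis a r + axis b t)" "slab (w + axis a r + axis c q)" "slab (w + axis b t + axis c q)"
    "slab (w + axis a r + axis b t + axis c q)"
  shows False
  using assms wt_sum[OF assms(1-3)]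
  by (elim insertE emptyE) (auto simp: slab_def hgt_add hgt_axis_scaled)

lemma slab_lift:
  assumes "vertex p" obtains w where "slab w" "p = proj_lattice w"
  using assms unfolding vertex_iff by blast

text \<open>The four rhombi would lift to four faces of one unit cube. Comparing the two lifts of
  \<open>w\<close> shows that the squares beyond \<open>u\<close> and beyond \<open>v\<close> use
  the same new direction \<open>c\<close>, and comparing the lifts of \<open>t\<close> that
  \<open>m\<close> lies in this direction from \<open>z\<close>. So all eight vertices are in the
  slab, against \<open>no_cube\<close>.\<close>

lemma cube:
  assumes "rhombus z u y v" "rhombus u y w t" "rhombus v y w t'"
  shows "\<not> rhombus z u t m"
proof
  assume m: "rhombus z u t m"
  obtain p where p: "slab p" "z = proj_lattice p"
    using slab_lift rhombus_edge(9)[OF assms(1)] by metis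
  obtain a r b s where ab: "sq p a r b s" "u = proj_lattice (p + axis a r)"
     "y = proj_lattice (p + axis a r + axis b s)" "v = proj_lattice (p + axis b s)"
    using rhombus_lift assms(1) p by metis
  have n0: "a \<noteq> b" "r \<in> {1, -1}" "s \<in> {1, -1}" "r \<noteq> 0" "s \<noteq> 0" "slab (p + axis a r)" "slab (p + axis b s)" "slab (p + axis a r + axis b s)"
    using ab(1) by (auto simp: sq_def)
  have comm: "p + axis b s + axis a r = p + axis a r + axis b s" by (simp add: add_ac)
  have "rhombus (proj_lattice (p + axis a r)) (proj_lattice (p + axis a r + axis b s)) w t"
    "rhombus (proj_lattice (p + axis b s)) (proj_lattice (p + axis b s + axis a r)) w t'"
    "rhombus (proj_lattice p) (proj_lattice (p + axis a r)) t m"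
    using assms m ab p by (simp_all add: comm)
  note lifts = this
  obtain c q where cq: "sq (p + axis a r) b s c q" "w = proj_lattice (p + axis a r + axis b s + axis c q)"
      "t = proj_lattice (p + axis a r + axis c q)"
    by (rule rhombus_lift_edge[OF lifts(1)]) (use n0 in auto)
  obtain c' q' where cq': "sq (p + axis b s) a r c' q'" "w = proj_lattice (p + axis a r + axis b s + axis c' q')"
    by (rule rhombus_lift_edge[OF lifts(2)]) (use n0 in \<open>auto simp: comm\<close>)
  have q0: "q \<noteq> 0" using cq(1) by (auto simp: sq_def)
  have "p + axis a r + axis b s + axis c q = p + axis a r + axis b s + axis c' q'"
    using cq cq' by (auto simp: sq_def comm proj_lattice_eq_iff)
  then have c': "c' = c" "q' = q" using axis_eq_axis[OF q0, of c c' q'] by simp_all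
  obtain d e where de: "sq p a r d e" "t = proj_lattice (p + axis a r + axis d e)"
    by (rule rhombus_lift_edge[OF lifts(3)]) (use n0 p in auto)
  have "p + axis a r + axis c q = p + axis a r + axis d e"
    using cq de by (auto simp: sq_def proj_lattice_eq_iff)
  then have d: "d = c" "e = q" using axis_eq_axis[OF q0, of c d e] by simp_all
  show False
    by (rule no_cube[of a b c r s q p]) (use ab(1) cq(1) cq'(1) de(1) c' d in \<open>auto simp: sq_def comm\<close>)
qed

text \<open>Over a given edge, a square going up in one direction needs the lower end of the edge to
  be below the weight of the other remaining direction, while a square going down in that other
  direction needs the opposite inequality. So squares in different directions have equal signs,
  which leaves room for two squares only.\<close>

lemma two_sides:
  assumes "rhombus z u y1 v1" "rhombus z u y2 v2" "rhombus z u y3 v3" "v1 \<noteq> v2"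
  shows "v3 \<in> {v1, v2}"
proof -
  obtain p where p: "slab p" "z = proj_lattice p"
    using slab_lift rhombus_edge(9)[OF assms(1)] by metis
  obtain a r b0 t0 where 0: "sq p a r b0 t0" "u = proj_lattice (p + axis a r)"
    using rhombus_lift assms(1) p by metis
  then have ar: "r \<noteq> 0" "u = proj_lattice (p + axis a r)" "slab (p + axis a r)"
    by (auto simp: sq_def)
  have lift: "\<exists>b t. sq p a r b t \<and> v = proj_lattice (p + axis b t)" if "rhombus z u y v" for y v
    using rhombus_lift_edge[of p a r y v] that p ar by metis
  have conflict: "t = t'" if "sq p a r b t" "sq p a r b' t'" "b \<noteq> b'" for b t b' t'
    using that wt_sum[of a b b'] by (auto simp: sq_def slab_def hgt_add hgt_axis_scaled)
  have range: "t = 1 \<or> t = -1" "b \<noteq> a" if "sq p a r b t" for b t using that by (auto simp: sq_def)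
  obtain b1 t1 b2 t2 b3 t3 where *: "sq p a r b1 t1" "sq p a r b2 t2" "sq p a r b3 t3"
     "v1 = proj_lattice (p + axis b1 t1)" "v2 = proj_lattice (p + axis b2 t2)"
     "v3 = proj_lattice (p + axis b3 t3)"
    using lift assms(1-3) by metis
  have ne: "b1 \<noteq> b2 \<or> t1 \<noteq> t2" using *(4,5) assms(4) by auto
  have "b3 = b1 \<and> t3 = t1 \<or> b3 = b2 \<and> t3 = t2"
  proof (cases "b1 = b2")
    case True
    then have "t1 \<noteq> t2" using ne by simp
    moreover have "b3 = b1" using conflict[OF *(1) *(3)] conflict[OF *(2) *(3)] True calculation by blast
    ultimately show ?thesis using range *(1-3) True by metis
  next
    case False
    have "b3 = b1 \<or> b3 = b2"
      using range(2)[OF *(1)] range(2)[OF *(2)] range(2)[OF *(3)] False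
        exhaust_3[of a] exhaust_3[of b1] exhaust_3[of b2] exhaust_3[of b3] by auto
    with conflict[OF *(1,2) False] conflict[OF *(1) *(3)] conflict[OF *(2) *(3)] False
    show ?thesis by metis
  qed
  with * show ?thesis by auto
qed

section \<open>The six edge directions in the plane\<close>

lemma pe_simps:
  "pe 1 = vector [- (sqrt 3 / 2), - (1/2)]" "pe 2 = vector [sqrt 3 / 2, - (1/2)]" "pe 3 = vector [0, 1]"
  by (simp_all add: pe_def proj_plane_def axis_def)

lemma pe_component:
  "pe 1 $ 1 = - (sqrt 3 / 2)" "pe 1 $ 2 = - (1/2)" "pe 2 $ 1 = sqrt 3 / 2" "pe 2 $ 2 = - (1/2)"
  "pe 3 $ 1 = 0" "pe 3 $ 2 = 1"
  by (simp_all add: pe_simps)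

lemma pe_distinct:
  assumes "a \<noteq> c" shows "pe a \<noteq> pe c" "pe a \<noteq> - pe c" "- pe a \<noteq> pe c" "- pe a \<noteq> - pe c"
proof -
  have s: "sqrt 3 > (0 :: real)" by simp
  have "pe a \<noteq> t *\<^sub>R pe c" if "t = 1 \<or> t = -1" for t
  proof
    assume "pe a = t *\<^sub>R pe c"
    then have "pe a $ 1 = t * pe c $ 1" "pe a $ 2 = t * pe c $ 2" by simp_all
    then show False using assms that s exhaust_3[of a] exhaust_3[of c]
      by (elim disjE) (simp_all add: pe_component)
  qed
  from this[of 1] this[of "-1"] show "pe a \<noteq> pe c" "pe a \<noteq> - pe c" "- pe a \<noteq> pe c" "- pe a \<noteq> - pe c"
    by (auto simp: minus_equation_iff[of "pe a"])
qed

lemma pe_nonzero: "pe a \<noteq> - pe a"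
proof
  assume "pe a = - pe a"
  then have "pe a $ 2 = - (pe a $ 2)" by (metis vector_uminus_component)
  then have "pe a $ 2 = 0" by linarith
  then show False using exhaust_3[of a] by (elim disjE) (simp_all add: pe_component)
qed

lemma third_index:
  fixes a b :: 3
  obtains c where "a \<noteq> c" "b \<noteq> c"
proof -
  have "\<not> (\<forall>c::3. a = c \<or> b = c)" by (metis three_neq)
  with that show thesis by blast
qed

lemma rhombus_directions:
  assumes "rhombus z u y v"
  obtains a b c where "a \<noteq> b" "a \<noteq> c" "b \<noteq> c" "u - z \<in> {pe a, - pe a}" "v - z \<in> {pe b, - pe b}"
proof -
  from assms obtain w a r b t where *: "sq w a r b t" "z = proj_lattice w" "u = proj_lattice (w + axis a r)"
     "v = proj_lattice (w + axis b t)"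
    unfolding rhombus_corners_iff by blast
  then have "a \<noteq> b" by (simp add: sq_def)
  moreover obtain c :: 3 where "a \<noteq> c" "b \<noteq> c" by (rule third_index)
  moreover have "u - z \<in> {pe a, - pe a}" "v - z \<in> {pe b, - pe b}"
    using * by (auto simp: sq_def proj_lattice_add proj_lattice_axis)
  ultimately show thesis using that by blast
qed

section \<open>The quotient of the path algebra\<close>

text \<open>The addition step puts no condition on the supports, which suits maps that are merely
  known to be additive.\<close>

lemma poly_mapping_induct_keys [consumes 1, case_names zero single add]:
  fixes f :: "'a \<Rightarrow>\<^sub>0 'b::comm_monoid_add"
  assumes "Poly_Mapping.keys f \<subseteq> S"
    and "P 0" "\<And>p c. p \<in> S \<Longrightarrow> P (Poly_Mapping.single p c)"
    and "\<And>f g. P f \<Longrightarrow> P g \<Longrightarrow> P (f + g)"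
  shows "P f"
proof -
  have f: "f = (\<Sum>p\<in>Poly_Mapping.keys f. Poly_Mapping.single p (Poly_Mapping.lookup f p))"
    by (rule poly_mapping_eqI) (simp add: lookup_sum lookup_single when_def sum.delta' in_keys_iff cong: if_cong)
  have "P (\<Sum>p\<in>K. Poly_Mapping.single p (Poly_Mapping.lookup f p))" if "finite K" "K \<subseteq> S" for K
    using that by (induction K) (auto intro: assms)
  then show ?thesis using f assms(1) by (metis finite_keys)
qed

section \<open>Multiplication of combinations of paths\<close>

abbreviation sgl :: "point list \<Rightarrow> 'k::field \<Rightarrow> 'k path_comb" where
  "sgl \<equiv> Poly_Mapping.single"

abbreviation lkp :: "'k::field path_comb \<Rightarrow> point list \<Rightarrow> 'k" where
  "lkp \<equiv> Poly_Mapping.lookup"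

text \<open>Sums over a common index set make additivity of the product a termwise
  statement.\<close>

lemma path_mult_superset:
  fixes f g :: "'k::field path_comb"
  assumes "finite K" "Poly_Mapping.keys f \<subseteq> K" "finite L" "Poly_Mapping.keys g \<subseteq> L"
  shows "path_mult f g = (\<Sum>p\<in>K. \<Sum>q\<in>L.
      if last p = hd q then sgl (p @ tl q) (lkp f p * lkp g q) else 0)"
proof -
  have "(\<Sum>q\<in>Poly_Mapping.keys g. if last p = hd q then sgl (p @ tl q) (lkp f p * lkp g q) else 0)
      = (\<Sum>q\<in>L. if last p = hd q then sgl (p @ tl q) (lkp f p * lkp g q) else 0)" for p
    using assms by (intro sum.mono_neutral_left) (auto simp: in_keys_iff)
  moreover have "(\<Sum>p\<in>Poly_Mapping.keys f. \<Sum>q\<in>L. if last p = hd q then sgl (p @ tl q) (lkp f p * lkp g q) else 0)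
      = (\<Sum>p\<in>K. \<Sum>q\<in>L. if last p = hd q then sgl (p @ tl q) (lkp f p * lkp g q) else 0)"
    using assms by (intro sum.mono_neutral_left) (auto simp: in_keys_iff intro!: sum.neutral)
  ultimately show ?thesis by (simp add: path_mult_def)
qed

lemma path_mult_single:
  "path_mult (sgl p c) (sgl q d) = (if last p = hd q then sgl (p @ tl q) (c * d) else 0)"
  by (subst path_mult_superset[of "{p}" _ "{q}"]) auto

lemma path_mult_add_left: "path_mult (f + g) h = path_mult f h + path_mult g h"
proof -
  let ?K = "Poly_Mapping.keys f \<union> Poly_Mapping.keys g"
  have "Poly_Mapping.keys (f + g) \<subseteq> ?K" by (rule Poly_Mapping.keys_add)
  then show ?thesis
    by (subst (1 2 3) path_mult_superset[of ?K _ "Poly_Mapping.keys h"])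
      (auto simp: lookup_add distrib_right single_add sum.distrib[symmetric] intro!: sum.cong)
qed

lemma path_mult_add_right: "path_mult h (f + g) = path_mult h f + path_mult h g"
proof -
  let ?K = "Poly_Mapping.keys f \<union> Poly_Mapping.keys g"
  have "Poly_Mapping.keys (f + g) \<subseteq> ?K" by (rule Poly_Mapping.keys_add)
  then show ?thesis
    by (subst (1 2 3) path_mult_superset[of "Poly_Mapping.keys h" _ ?K])
      (auto simp: lookup_add distrib_left single_add sum.distrib[symmetric] intro!: sum.cong)
qed

lemma path_mult_zero [simp]: "path_mult 0 h = 0" "path_mult h 0 = 0"
  by (simp_all add: path_mult_def)

lemma path_mult_minus: "path_mult (- f) h = - path_mult f h" "path_mult h (- f) = - path_mult h f"
proof -
  have "path_mult (f + - f) h = 0" "path_mult h (f + - f) = 0" by simp_all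
  then show "path_mult (- f) h = - path_mult f h" "path_mult h (- f) = - path_mult h f"
    unfolding path_mult_add_left path_mult_add_right by (simp_all add: eq_neg_iff_add_eq_0 add.commute)
qed

lemma path_mult_diff: "path_mult (f - g) h = path_mult f h - path_mult g h"
    "path_mult h (f - g) = path_mult h f - path_mult h g"
  using path_mult_add_left[of f "- g"] path_mult_add_right[of h f "- g"] by (simp_all add: path_mult_minus)

lemma quiver_paths_append:
  assumes "p \<in> quiver_paths" "q \<in> quiver_paths" "last p = hd q"
  shows "p @ tl q \<in> quiver_paths"
proof -
  obtain v q' where q: "q = v # q'" using assms(2) by (cases q) (auto simp: quiver_paths_def)
  have "successively edge p" "successively edge (v # q')" "v = last p" "p \<noteq> []"
    using assms q by (auto simp: quiver_paths_def)
  then have "successively edge (p @ q')"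
    by (cases q') (auto simp: successively_append_iff)
  then show ?thesis using assms q by (auto simp: quiver_paths_def)
qed

abbreviation pcar :: "'k::field path_comb set" where
  "pcar \<equiv> carrier path_algebra"

lemma pcar_def: "(f :: 'k::field path_comb) \<in> pcar \<longleftrightarrow> Poly_Mapping.keys f \<subseteq> quiver_paths"
  by (simp add: path_algebra_def)

lemma pcar_iff: "(f :: 'k::field path_comb) \<in> pcar \<longleftrightarrow> (\<forall>p. p \<notin> quiver_paths \<longrightarrow> lkp f p = 0)"
  by (auto simp: pcar_def in_keys_iff)

lemma pcar_closed:
  fixes f g :: "'k::field path_comb"
  shows "0 \<in> (pcar :: 'k path_comb set)" "f \<in> pcar \<Longrightarrow> g \<in> pcar \<Longrightarrow> f + g \<in> pcar"
    "f \<in> pcar \<Longrightarrow> - f \<in> pcar" "f \<in> pcar \<Longrightarrow> g \<in> pcar \<Longrightarrow> f - g \<in> pcar"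
    "p \<in> quiver_paths \<Longrightarrow> sgl p c \<in> (pcar :: 'k path_comb set)"
  by (auto simp: pcar_iff lookup_add lookup_minus lookup_single when_def)

lemma pcar_induct [consumes 1, case_names zero single add]:
  fixes f :: "'k::field path_comb"
  assumes "f \<in> pcar" "P 0" "\<And>p c. p \<in> quiver_paths \<Longrightarrow> P (sgl p c)"
    "\<And>f g. f \<in> pcar \<Longrightarrow> g \<in> pcar \<Longrightarrow> P f \<Longrightarrow> P g \<Longrightarrow> P (f + g)"
  shows "P f"
proof -
  from assms(1) have "Poly_Mapping.keys f \<subseteq> quiver_paths" by (simp only: pcar_def)
  then have "f \<in> pcar \<and> P f"
  proof (induction rule: poly_mapping_induct_keys)
    case (add f g)
    then show ?case using assms(4)[of f g] pcar_closed(2)[of f g] by blast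
  qed (simp_all add: assms(2,3) pcar_closed)
  then show ?thesis ..
qed

lemma path_mult_closed:
  fixes f g :: "'k::field path_comb"
  assumes "f \<in> pcar" "g \<in> pcar" shows "path_mult f g \<in> pcar"
  using assms(1)
proof (induction rule: pcar_induct)
  case (single p c)
  from assms(2) show ?case
    by (induction rule: pcar_induct)
      (use single in \<open>auto simp: path_mult_add_right path_mult_single pcar_closed quiver_paths_append\<close>)
qed (auto simp: path_mult_add_left pcar_closed)

lemma path_mult_assoc:
  fixes f g h :: "'k::field path_comb"
  assumes "f \<in> pcar" "g \<in> pcar" "h \<in> pcar"
  shows "path_mult (path_mult f g) h = path_mult f (path_mult g h)"
  using assms(1)
proof (induction rule: pcar_induct)
  case (single p c)
  from assms(2) show ?case
  proof (induction rule: pcar_induct)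
    case (single q d)
    note q = single
    from assms(3) show ?case
    proof (induction rule: pcar_induct)
      case (single r e)
      have "p \<noteq> []" "q \<noteq> []" "r \<noteq> []" using \<open>p \<in> quiver_paths\<close> q single by (auto simp: quiver_paths_def)
      then have "last (p @ tl q) = last q" if "last p = hd q" using that by (cases q) auto
      moreover have "hd (q @ tl r) = hd q" "tl (q @ tl r) = tl q @ tl r" using \<open>q \<noteq> []\<close> by auto
      ultimately show ?case by (simp add: path_mult_single mult.assoc)
    qed (simp_all add: path_mult_add_right)
  qed (simp_all add: path_mult_add_right path_mult_add_left)
qed (simp_all add: path_mult_add_left)

lemma path_algebra_simps [simp]:
  "\<zero>\<^bsub>path_algebra\<^esub> = 0" "f \<oplus>\<^bsub>path_algebra\<^esub> g = f + g" "f \<otimes>\<^bsub>path_algebra\<^esub> g = path_mult f g"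
  by (simp_all add: path_algebra_def)

lemma abelian_group_path_algebra: "abelian_group (path_algebra :: 'k::field path_comb ring)"
proof (rule abelian_groupI)
  fix x :: "'k path_comb" assume "x \<in> pcar"
  then show "\<exists>y\<in>pcar. y \<oplus>\<^bsub>path_algebra\<^esub> x = \<zero>\<^bsub>path_algebra\<^esub>"
    using pcar_closed by (intro bexI[of _ "- x"]) auto
qed (auto simp: pcar_closed add_ac)

lemma inv_path_algebra:
  fixes x :: "'k::field path_comb"
  assumes "x \<in> pcar"
  shows "inv\<^bsub>add_monoid path_algebra\<^esub> x = - x"
proof -
  interpret abelian_group "path_algebra :: 'k path_comb ring" by (rule abelian_group_path_algebra)
  show ?thesis
    by (rule group.inv_equality[OF a_group]) (use assms pcar_closed(3)[OF assms] in simp_all)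
qed

lemma additive_subgroup_path_algebra:
  fixes J :: "'k::field path_comb set"
  shows "additive_subgroup J path_algebra \<longleftrightarrow>
    J \<subseteq> pcar \<and> 0 \<in> J \<and> (\<forall>f\<in>J. \<forall>g\<in>J. f + g \<in> J) \<and> (\<forall>f\<in>J. - f \<in> J)"
proof -
  have *: "(\<forall>f\<in>J. inv\<^bsub>add_monoid path_algebra\<^esub> f \<in> J) \<longleftrightarrow> (\<forall>f\<in>J. - f \<in> J)" if "J \<subseteq> pcar"
  proof (intro ball_cong refl)
    fix f assume "f \<in> J"
    then have "f \<in> pcar" using that by blast
    then show "(inv\<^bsub>add_monoid path_algebra\<^esub> f \<in> J) = (- f \<in> J)" by (simp only: inv_path_algebra)
  qed
  show ?thesis
    unfolding additive_subgroup_def subgroup_def using * by simp blast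
qed

section \<open>The ideal of relations and its cosets\<close>

lemma lookup_map_times: "lkp (Poly_Mapping.map ((*) c) f) p = c * lkp f p"
  by (simp add: Poly_Mapping.map.rep_eq when_def)

lemma edge_path: "edge x u \<Longrightarrow> [x, u] \<in> quiver_paths"
    "edge x u \<Longrightarrow> edge u w \<Longrightarrow> [x, u, w] \<in> quiver_paths"
    "vertex x \<Longrightarrow> [x] \<in> quiver_paths"
  using edge_vertex by (auto simp: quiver_paths_def)

lemma loop_at_pcar: "loop_at z w \<in> pcar"
  by (auto simp: loop_at_def edge_sym intro!: pcar_closed edge_path)

lemma map_times_pcar: "f \<in> pcar \<Longrightarrow> Poly_Mapping.map ((*) c) f \<in> pcar"
  by (auto simp: pcar_iff lookup_map_times)

lemma rauzy_relations_pcar: "rauzy_relations s \<subseteq> pcar"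
  using rhombus_edge
  by (auto simp: rauzy_relations_def loop_diff_def intro!: pcar_closed edge_path map_times_pcar loop_at_pcar)

definition is_rel_ideal :: "(3 \<Rightarrow> point \<Rightarrow> 'k::field) \<Rightarrow> 'k path_comb set \<Rightarrow> bool" where
  "is_rel_ideal s J \<longleftrightarrow> J \<subseteq> pcar \<and> 0 \<in> J \<and> (\<forall>f\<in>J. \<forall>g\<in>J. f + g \<in> J) \<and> (\<forall>f\<in>J. - f \<in> J)
     \<and> (\<forall>f\<in>pcar. \<forall>g\<in>J. path_mult f g \<in> J \<and> path_mult g f \<in> J) \<and> rauzy_relations s \<subseteq> J"

lemma rauzy_ideal_eq: "rauzy_ideal s = \<Inter> {J. is_rel_ideal s J}"
  by (simp add: rauzy_ideal_def is_rel_ideal_def additive_subgroup_path_algebra conj_assoc)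

text \<open>The way to prove that a linear condition holds on the ideal: its solutions are shown to
  satisfy \<open>is_rel_ideal\<close>. The coefficients at trivial paths and the trace are treated
  like this.\<close>

lemma rauzy_ideal_least: "is_rel_ideal s J \<Longrightarrow> rauzy_ideal s \<subseteq> J"
  by (auto simp: rauzy_ideal_eq)

lemma is_rel_ideal_rauzy_ideal: "is_rel_ideal s (rauzy_ideal s)"
proof -
  have "is_rel_ideal s pcar"
    by (simp add: is_rel_ideal_def pcar_closed path_mult_closed rauzy_relations_pcar)
  then have "rauzy_ideal s \<subseteq> pcar" by (rule rauzy_ideal_least)
  then show ?thesis
    unfolding is_rel_ideal_def rauzy_ideal_eq by (auto simp: is_rel_ideal_def)
qed

lemma rauzy_ideal_closed:
  assumes "f \<in> rauzy_ideal s" "g \<in> rauzy_ideal s"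
  shows "f \<in> pcar" "f + g \<in> rauzy_ideal s" "- f \<in> rauzy_ideal s" "f - g \<in> rauzy_ideal s"
  using is_rel_ideal_rauzy_ideal[of s] assms unfolding is_rel_ideal_def
  by (auto simp: diff_conv_add_uminus simp del: add_uminus_conv_diff)

lemma zero_in_rauzy_ideal: "0 \<in> rauzy_ideal s"
  using is_rel_ideal_rauzy_ideal[of s] by (simp add: is_rel_ideal_def)

lemma rauzy_ideal_mult:
  assumes "f \<in> pcar" "g \<in> rauzy_ideal s"
  shows "path_mult f g \<in> rauzy_ideal s" "path_mult g f \<in> rauzy_ideal s"
  using is_rel_ideal_rauzy_ideal[of s] assms by (simp_all add: is_rel_ideal_def)

lemma relation_in_rauzy_ideal: "f \<in> rauzy_relations s \<Longrightarrow> f \<in> rauzy_ideal s"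
  using is_rel_ideal_rauzy_ideal[of s] by (auto simp: is_rel_ideal_def)

text \<open>Classes of arbitrary combinations, whereas \<open>path_class\<close> only covers single
  paths.\<close>

definition pcls :: "(3 \<Rightarrow> point \<Rightarrow> 'k::field) \<Rightarrow> 'k path_comb \<Rightarrow> 'k path_comb set" where
  "pcls s f = {i + f |i. i \<in> rauzy_ideal s}"

lemma pcls_coset: "rauzy_ideal s +>\<^bsub>path_algebra\<^esub> f = pcls s f"
  by (auto simp: a_r_coset_def r_coset_def pcls_def)

lemma path_class_pcls: "path_class s p = pcls s (sgl p 1)"
  by (simp add: path_class_def pcls_coset)

lemma in_pcls_iff: "g \<in> pcls s f \<longleftrightarrow> g - f \<in> rauzy_ideal s"
proof
  assume "g - f \<in> rauzy_ideal s"
  moreover have "g = (g - f) + f" by simp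
  ultimately show "g \<in> pcls s f" unfolding pcls_def by blast
qed (auto simp: pcls_def)

lemma pcls_eq_iff: "pcls s f = pcls s g \<longleftrightarrow> f - g \<in> rauzy_ideal s"
proof
  assume "pcls s f = pcls s g"
  moreover have "f \<in> pcls s f" by (simp add: in_pcls_iff zero_in_rauzy_ideal)
  ultimately have "f \<in> pcls s g" by simp
  then show "f - g \<in> rauzy_ideal s" by (simp add: in_pcls_iff)
next
  assume *: "f - g \<in> rauzy_ideal s"
  have "h - f \<in> rauzy_ideal s \<longleftrightarrow> h - g \<in> rauzy_ideal s" for h
  proof
    assume "h - f \<in> rauzy_ideal s"
    from rauzy_ideal_closed(2)[OF this *] show "h - g \<in> rauzy_ideal s" by simp
  next
    assume "h - g \<in> rauzy_ideal s"
    from rauzy_ideal_closed(4)[OF this *] show "h - f \<in> rauzy_ideal s" by simp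
  qed
  then show "pcls s f = pcls s g" by (auto simp: in_pcls_iff)
qed

lemma pcls_self: "f \<in> pcls s f"
  by (simp add: in_pcls_iff zero_in_rauzy_ideal)

lemma rauzy_algebra_carrier: "carrier (rauzy_algebra s) = pcls s ` pcar"
  by (auto simp: rauzy_algebra_def FactRing_def A_RCOSETS_def RCOSETS_def pcls_coset[symmetric]
     a_r_coset_def)

lemma rauzy_algebra_zero: "\<zero>\<^bsub>rauzy_algebra s\<^esub> = pcls s 0"
  by (auto simp: rauzy_algebra_def FactRing_def pcls_def)

lemma rauzy_algebra_add: "pcls s f \<oplus>\<^bsub>rauzy_algebra s\<^esub> pcls s g = pcls s (f + g)"
proof -
  have "pcls s f \<oplus>\<^bsub>rauzy_algebra s\<^esub> pcls s g = (\<Union>x\<in>pcls s f. \<Union>y\<in>pcls s g. {x + y})"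
    by (simp add: rauzy_algebra_def FactRing_def set_add_def set_mult_def)
  also have "\<dots> = pcls s (f + g)"
  proof (intro equalityI subsetI)
    fix h assume "h \<in> (\<Union>x\<in>pcls s f. \<Union>y\<in>pcls s g. {x + y})"
    then obtain x y where "x - f \<in> rauzy_ideal s" "y - g \<in> rauzy_ideal s" "h = x + y"
      by (auto simp: in_pcls_iff)
    then show "h \<in> pcls s (f + g)"
      using rauzy_ideal_closed(2)[of "x - f" s "y - g"] by (simp add: in_pcls_iff algebra_simps)
  next
    fix h assume "h \<in> pcls s (f + g)"
    then have "h - g \<in> pcls s f" by (simp add: in_pcls_iff algebra_simps)
    then show "h \<in> (\<Union>x\<in>pcls s f. \<Union>y\<in>pcls s g. {x + y})" using pcls_self[of g s]
      by (intro UN_I[of "h - g"] UN_I[of g]) auto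
  qed
  finally show ?thesis .
qed

lemma rauzy_algebra_mult:
  assumes "f \<in> pcar" "g \<in> pcar"
  shows "pcls s f \<otimes>\<^bsub>rauzy_algebra s\<^esub> pcls s g = pcls s (path_mult f g)"
proof -
  have "pcls s (path_mult x y) = pcls s (path_mult f g)" if "x \<in> pcls s f" "y \<in> pcls s g" for x y
  proof -
    from that have xy: "x - f \<in> rauzy_ideal s" "y - g \<in> rauzy_ideal s" by (simp_all add: in_pcls_iff)
    have "x \<in> pcar" using rauzy_ideal_closed(1)[OF xy(1) xy(1)] pcar_closed(2)[OF _ assms(1), of "x - f"] by simp
    then have "path_mult x (y - g) + path_mult (x - f) g \<in> rauzy_ideal s"
      using rauzy_ideal_closed(2)[OF rauzy_ideal_mult(1)[OF _ xy(2)] rauzy_ideal_mult(2)[OF assms(2) xy(1)]]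
      by blast
    then show ?thesis by (simp add: pcls_eq_iff path_mult_diff)
  qed
  then have "(\<Union>x\<in>pcls s f. \<Union>y\<in>pcls s g. pcls s (path_mult x y)) = pcls s (path_mult f g)"
    using pcls_self by blast
  then show ?thesis
    by (simp add: rauzy_algebra_def FactRing_def rcoset_mult_def pcls_coset)
qed

lemma pcls_in_carrier: "f \<in> pcar \<Longrightarrow> pcls s f \<in> carrier (rauzy_algebra s)"
  by (simp add: rauzy_algebra_carrier)

lemma rauzy_algebra_cases:
  assumes "a \<in> carrier (rauzy_algebra s)" obtains f where "f \<in> pcar" "a = pcls s f"
  using assms by (auto simp: rauzy_algebra_carrier)

lemma abelian_group_rauzy_algebra: "abelian_group (rauzy_algebra s)"
proof (rule abelian_groupI)
  fix x assume "x \<in> carrier (rauzy_algebra s)"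
  then obtain f where f: "f \<in> pcar" "x = pcls s f" by (rule rauzy_algebra_cases)
  then show "\<exists>y\<in>carrier (rauzy_algebra s). y \<oplus>\<^bsub>rauzy_algebra s\<^esub> x = \<zero>\<^bsub>rauzy_algebra s\<^esub>"
    by (intro bexI[of _ "pcls s (- f)"])
      (auto simp: rauzy_algebra_add rauzy_algebra_zero pcls_in_carrier pcar_closed)
qed (auto elim!: rauzy_algebra_cases simp: rauzy_algebra_add rauzy_algebra_zero pcls_in_carrier
   pcar_closed add_ac)

section \<open>Right modules over rings without a unit\<close>

locale rng_module = right_module A M + A: abelian_group A
  for A :: "('a, 'c) ring_scheme" and M :: "('a, 'b, 'd) module_scheme" (structure) +
  assumes mult_closed: "a \<in> carrier A \<Longrightarrow> b \<in> carrier A \<Longrightarrow> a \<otimes>\<^bsub>A\<^esub> b \<in> carrier A"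

context rng_module
begin

lemma act_zero_left: "m \<in> carrier M \<Longrightarrow> \<zero>\<^bsub>A\<^esub> \<odot> m = \<zero>"
  using add_act[of "\<zero>\<^bsub>A\<^esub>" "\<zero>\<^bsub>A\<^esub>" m] act_closed[of "\<zero>\<^bsub>A\<^esub>" m]
  by (metis A.l_zero A.zero_closed add.r_cancel_one')

lemma act_zero_right: "a \<in> carrier A \<Longrightarrow> a \<odot> \<zero> = \<zero>"
  using act_add[of a \<zero> \<zero>] act_closed[of a \<zero>] by (metis l_zero zero_closed add.r_cancel_one')

lemma act_minus_left: "a \<in> carrier A \<Longrightarrow> m \<in> carrier M \<Longrightarrow> (\<ominus>\<^bsub>A\<^esub> a) \<odot> m = \<ominus> (a \<odot> m)"
  using add_act[of "\<ominus>\<^bsub>A\<^esub> a" a m] act_zero_left[of m]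
  by (metis A.a_inv_closed A.l_neg act_closed minus_equality)

lemma act_minus_right: "a \<in> carrier A \<Longrightarrow> m \<in> carrier M \<Longrightarrow> a \<odot> (\<ominus> m) = \<ominus> (a \<odot> m)"
  using act_add[of a "\<ominus> m" m] act_zero_right[of a]
  by (metis a_inv_closed l_neg act_closed minus_equality)

section \<open>Submodules, cosets and quotient modules\<close>

lemma submoduleD:
  assumes "submodule H A M"
  shows "H \<subseteq> carrier M" "\<zero> \<in> H" "\<And>x y. x \<in> H \<Longrightarrow> y \<in> H \<Longrightarrow> x \<oplus> y \<in> H"
    "\<And>x. x \<in> H \<Longrightarrow> \<ominus> x \<in> H" "\<And>a x. a \<in> carrier A \<Longrightarrow> x \<in> H \<Longrightarrow> a \<odot> x \<in> H"
    "\<And>x y. x \<in> H \<Longrightarrow> y \<in> H \<Longrightarrow> x \<ominus> y \<in> H"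
proof -
  interpret H: submodule H A M by fact
  show *: "H \<subseteq> carrier M" "\<zero> \<in> H" "\<And>x y. x \<in> H \<Longrightarrow> y \<in> H \<Longrightarrow> x \<oplus> y \<in> H"
    "\<And>x. x \<in> H \<Longrightarrow> \<ominus> x \<in> H" "\<And>a x. a \<in> carrier A \<Longrightarrow> x \<in> H \<Longrightarrow> a \<odot> x \<in> H"
    using H.subset H.one_closed H.m_closed H.m_inv_closed H.smult_closed
    by (auto simp: a_inv_def)
  show "\<And>x y. x \<in> H \<Longrightarrow> y \<in> H \<Longrightarrow> x \<ominus> y \<in> H" using * by (simp add: a_minus_def)
qed

text \<open>Closure under negation follows from unitality: if \<open>a\<close> fixes x, then the
  negative of \<open>a\<close> sends x to its negative.\<close>

lemma submoduleI:
  assumes "H \<subseteq> carrier M" "\<zero> \<in> H" "\<And>x y. x \<in> H \<Longrightarrow> y \<in> H \<Longrightarrow> x \<oplus> y \<in> H"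
    "\<And>a x. a \<in> carrier A \<Longrightarrow> x \<in> H \<Longrightarrow> a \<odot> x \<in> H"
  shows "submodule H A M"
proof -
  have neg: "\<ominus> x \<in> H" if "x \<in> H" for x
  proof -
    have x: "x \<in> carrier M" using assms(1) that by (rule subsetD)
    obtain a where a: "a \<in> carrier A" "a \<odot> x = x" using unital[OF x] by blast
    then have "\<ominus> x = (\<ominus>\<^bsub>A\<^esub> a) \<odot> x" using act_minus_left[OF a(1) x] by simp
    then show ?thesis using assms(4)[OF A.a_inv_closed[OF a(1)] that] by simp
  qed
  show ?thesis
    by (intro submodule.intro subgroup.intro submodule_axioms.intro)
      (use assms neg in \<open>auto simp: a_inv_def\<close>)
qed

lemma submodule_right_module:
  assumes "submodule H A M" shows "right_module A (M\<lparr>carrier := H\<rparr>)"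
proof -
  note H = submoduleD[OF assms]
  have "abelian_group (M\<lparr>carrier := H\<rparr>)"
  proof (rule abelian_groupI)
    fix x assume x: "x \<in> carrier (M\<lparr>carrier := H\<rparr>)"
    then show "\<exists>y\<in>carrier (M\<lparr>carrier := H\<rparr>). y \<oplus>\<^bsub>M\<lparr>carrier := H\<rparr>\<^esub> x = \<zero>\<^bsub>M\<lparr>carrier := H\<rparr>\<^esub>"
      using H by (intro bexI[of _ "\<ominus> x"]) (auto simp: l_neg subsetD)
  qed (use H in \<open>auto simp: subset_iff a_assoc intro: a_comm\<close>)
  then show ?thesis
    by (intro right_module.intro right_module_axioms.intro)
      (use H in \<open>auto simp: subset_iff act_add add_act act_act unital\<close>)
qed

lemma submodule_rng_module: "submodule H A M \<Longrightarrow> rng_module A (M\<lparr>carrier := H\<rparr>)"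
  by (intro rng_module.intro rng_module_axioms.intro submodule_right_module A.abelian_group_axioms mult_closed)

lemma zero_submodule: "submodule {\<zero>} A M"
  by (rule submoduleI) (auto simp: act_zero_right)

lemma submodule_of_submodule:
  assumes "submodule H A M" "submodule K A M" "K \<subseteq> H"
  shows "submodule K A (M\<lparr>carrier := H\<rparr>)"
proof -
  interpret H: rng_module A "M\<lparr>carrier := H\<rparr>" by (rule submodule_rng_module) fact
  show ?thesis using submoduleD[OF assms(2)] assms(3) by (intro H.submoduleI) auto
qed

lemma submodule_abelian_subgroup:
  assumes "submodule N A M" shows "abelian_subgroup N M"
  using assms abelian_group_axioms
  by (intro abelian_subgroupI3) (auto simp: additive_subgroup_def submodule_def)

lemma coset_eq_iff:
  assumes "submodule N A M" "x \<in> carrier M" "y \<in> carrier M"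
  shows "N +> x = N +> y \<longleftrightarrow> x \<ominus> y \<in> N"
proof -
  interpret N: abelian_subgroup N M using submodule_abelian_subgroup assms(1) .
  have "x \<in> N +> y \<longleftrightarrow> x \<ominus> y \<in> N"
    using N.a_rcos_module assms by (simp add: a_minus_def)
  moreover have "N +> x = N +> y \<longleftrightarrow> x \<in> N +> y"
  proof
    assume "N +> x = N +> y"
    then show "x \<in> N +> y" using N.a_rcos_self[OF assms(2)] by simp
  next
    assume "x \<in> N +> y"
    from a_repr_independence[OF this assms(3) N.a_subgroup] show "N +> x = N +> y" by simp
  qed
  ultimately show ?thesis by simp
qed

lemma coset_self: "submodule N A M \<Longrightarrow> x \<in> carrier M \<Longrightarrow> x \<in> N +> x"
  by (rule abelian_subgroup.a_rcos_self[OF submodule_abelian_subgroup])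

lemma coset_zero_iff:
  assumes "submodule N A M" "x \<in> carrier M"
  shows "N +> x = N \<longleftrightarrow> x \<in> N"
proof -
  interpret N: abelian_subgroup N M using submodule_abelian_subgroup assms(1) .
  show ?thesis using N.a_rcos_const[of x] coset_self[OF assms] by metis
qed

lemma quot_carrier: "carrier (quot_mod M N) = (+>) N ` carrier M"
  by (auto simp: quot_mod_def A_RCOSETS_def RCOSETS_def a_r_coset_def)

lemma quot_zero: "\<zero>\<^bsub>quot_mod M N\<^esub> = N"
  by (simp add: quot_mod_def)

lemma quot_add:
  assumes "submodule N A M" "x \<in> carrier M" "y \<in> carrier M"
  shows "(N +> x) \<oplus>\<^bsub>quot_mod M N\<^esub> (N +> y) = N +> (x \<oplus> y)"
  using abelian_subgroup.a_rcos_sum[OF submodule_abelian_subgroup[OF assms(1)] assms(2,3)]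
  by (simp add: quot_mod_def)

lemma in_coset:
  assumes "submodule N A M" "x \<in> carrier M" "y \<in> N +> x"
  shows "y \<in> carrier M" "y \<ominus> x \<in> N" "N +> y = N +> x"
proof -
  interpret N: abelian_subgroup N M using submodule_abelian_subgroup assms(1) .
  show "N +> y = N +> x" using a_repr_independence[OF assms(3,2) N.a_subgroup] by simp
  show "y \<in> carrier M" using N.a_elemrcos_carrier[OF assms(2,3)] .
  then show "y \<ominus> x \<in> N" using coset_eq_iff[OF assms(1) _ assms(2), of y] \<open>N +> y = N +> x\<close> by simp
qed

lemma act_diff:
  "a \<in> carrier A \<Longrightarrow> x \<in> carrier M \<Longrightarrow> y \<in> carrier M \<Longrightarrow> a \<odot> (x \<ominus> y) = a \<odot> x \<ominus> a \<odot> y"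
  by (simp add: a_minus_def act_add act_minus_right)

lemma quot_act:
  assumes "submodule N A M" "x \<in> carrier M" "a \<in> carrier A"
  shows "a \<odot>\<^bsub>quot_mod M N\<^esub> (N +> x) = N +> (a \<odot> x)"
proof -
  have "N +> (a \<odot> y) = N +> (a \<odot> x)" if "y \<in> N +> x" for y
  proof -
    note y = in_coset[OF assms(1,2) that]
    have "a \<odot> y \<ominus> a \<odot> x = a \<odot> (y \<ominus> x)" using act_diff assms y by simp
    then show ?thesis
      using coset_eq_iff[OF assms(1) act_closed act_closed, of a y a x] submoduleD(5)[OF assms(1,3) y(2)] assms y
      by simp
  qed
  then have "(\<Union>y\<in>N +> x. N +> (a \<odot> y)) = (\<Union>y\<in>N +> x. N +> (a \<odot> x))"
    by (intro SUP_cong refl)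
  also have "\<dots> = N +> (a \<odot> x)"
    using coset_self[OF assms(1,2)] by (simp only: UN_constant) (simp split: if_split; blast)
  finally show ?thesis by (simp add: quot_mod_def)
qed

lemma quot_right_module:
  assumes N: "submodule N A M" shows "right_module A (quot_mod M N)"
proof -
  note q = quot_carrier quot_zero quot_add[OF N] quot_act[OF N]
  have N0: "N +> \<zero> = N" using coset_zero_iff[OF N zero_closed] submoduleD(2)[OF N] by blast
  have "abelian_group (quot_mod M N)"
  proof (rule abelian_groupI)
    show "\<zero>\<^bsub>quot_mod M N\<^esub> \<in> carrier (quot_mod M N)" unfolding quot_zero quot_carrier using N0 by force
  next
    fix X assume "X \<in> carrier (quot_mod M N)"
    then obtain x where x: "x \<in> carrier M" "X = N +> x" by (auto simp: q)
    have "(N +> \<zero>) \<oplus>\<^bsub>quot_mod M N\<^esub> (N +> x) = N +> x"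
      using quot_add[OF N zero_closed x(1)] x by simp
    then show "\<zero>\<^bsub>quot_mod M N\<^esub> \<oplus>\<^bsub>quot_mod M N\<^esub> X = X" using x by (simp add: N0 quot_zero)
  next
    fix X assume "X \<in> carrier (quot_mod M N)"
    then obtain x where x: "x \<in> carrier M" "X = N +> x" by (auto simp: q)
    have "(N +> \<ominus> x) \<oplus>\<^bsub>quot_mod M N\<^esub> (N +> x) = N"
      using quot_add[OF N a_inv_closed[OF x(1)] x(1)] x by (simp add: l_neg N0)
    then show "\<exists>Y\<in>carrier (quot_mod M N). Y \<oplus>\<^bsub>quot_mod M N\<^esub> X = \<zero>\<^bsub>quot_mod M N\<^esub>"
      using x by (intro bexI[of _ "N +> \<ominus> x"]) (auto simp: quot_zero quot_carrier)
  qed (auto simp: q a_ac)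
  moreover have "\<exists>a\<in>carrier A. a \<odot>\<^bsub>quot_mod M N\<^esub> X = X" if X: "X \<in> carrier (quot_mod M N)" for X
  proof -
    obtain x where x: "x \<in> carrier M" "X = N +> x" using X by (auto simp: q)
    obtain a where "a \<in> carrier A" "a \<odot> x = x" using unital[OF x(1)] by blast
    then show ?thesis using x by (intro bexI[of _ a]) (simp_all add: q)
  qed
  ultimately show ?thesis
    by (intro right_module.intro right_module_axioms.intro)
      (auto simp: q act_closed act_add add_act act_act mult_closed)
qed

lemma quot_rng_module: "submodule N A M \<Longrightarrow> rng_module A (quot_mod M N)"
  by (intro rng_module.intro rng_module_axioms.intro quot_right_module A.abelian_group_axioms mult_closed)

lemma quot_iso:
  assumes "submodule N A M" "abelian_group S" "g \<in> mod_hom A M S" "g ` carrier M = carrier S"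
    and ker: "\<And>x. x \<in> carrier M \<Longrightarrow> g x = \<zero>\<^bsub>S\<^esub> \<longleftrightarrow> x \<in> N"
  shows "mod_iso A (quot_mod M N) S"
proof -
  interpret S: abelian_group S by fact
  have hom: "g (x \<oplus> y) = g x \<oplus>\<^bsub>S\<^esub> g y" "g x \<in> carrier S" if "x \<in> carrier M" "y \<in> carrier M" for x y
    using assms(3) that by (auto simp: mod_hom_def hom_def)
  have act: "g (a \<odot> x) = a \<odot>\<^bsub>S\<^esub> g x" if "a \<in> carrier A" "x \<in> carrier M" for a x
    using assms(3) that by (auto simp: mod_hom_def)
  have eq: "g x = g y \<longleftrightarrow> N +> x = N +> y" if "x \<in> carrier M" "y \<in> carrier M" for x y
  proof -
    have "x = (x \<ominus> y) \<oplus> y" using that by (simp add: a_minus_def a_assoc l_neg)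
    then have "g x = g (x \<ominus> y) \<oplus>\<^bsub>S\<^esub> g y" using hom(1)[of "x \<ominus> y" y] that by simp
    then have "g x = g y \<longleftrightarrow> g (x \<ominus> y) = \<zero>\<^bsub>S\<^esub>"
      using that hom(2)[of "x \<ominus> y" y] hom(2)[of y y] by (metis S.add.r_cancel_one' S.l_zero minus_closed)
    then show ?thesis using ker[of "x \<ominus> y"] coset_eq_iff[OF assms(1)] that by simp
  qed
  \<comment> \<open>The induced map is evaluated at a chosen representative; by \<open>eq\<close>
    the map \<open>g\<close> is constant on cosets and separates them.\<close>
  define f where "f X = g (SOME x. x \<in> X)" for X
  have f: "f (N +> x) = g x" if "x \<in> carrier M" for x
  proof -
    define y where "y = (SOME y. y \<in> N +> x)"
    have "y \<in> N +> x" unfolding y_def using coset_self[OF assms(1) that] by (rule someI)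
    then have "y \<in> carrier M" "N +> y = N +> x" using in_coset[OF assms(1) that] by auto
    then show ?thesis using eq that by (simp add: f_def y_def)
  qed
  have "f \<in> mod_hom A (quot_mod M N) S"
    by (auto simp: mod_hom_def hom_def quot_carrier quot_add[OF assms(1)] quot_act[OF assms(1)]
        f hom act act_closed)
  moreover have "inj_on f (carrier (quot_mod M N))"
    by (auto simp: inj_on_def quot_carrier f eq)
  moreover have "f ` carrier (quot_mod M N) = carrier S"
    using assms(4) by (auto simp: quot_carrier f image_image cong: image_cong)
  ultimately show ?thesis by (auto simp: mod_iso_def bij_betw_def)
qed

lemma cyclic_submodule:
  assumes "m \<in> carrier M"
  shows "submodule {a \<odot> m |a. a \<in> carrier A} A M"
proof (rule submoduleI)
  show "{a \<odot> m |a. a \<in> carrier A} \<subseteq> carrier M" using assms act_closed by blast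
  show "\<zero> \<in> {a \<odot> m |a. a \<in> carrier A}" using act_zero_left[OF assms] A.zero_closed by force
  show "x \<oplus> y \<in> {a \<odot> m |a. a \<in> carrier A}"
    if "x \<in> {a \<odot> m |a. a \<in> carrier A}" "y \<in> {a \<odot> m |a. a \<in> carrier A}" for x y
  proof -
    from that(1) obtain a where a: "a \<in> carrier A" "x = a \<odot> m" by auto
    from that(2) obtain b where b: "b \<in> carrier A" "y = b \<odot> m" by auto
    have "x \<oplus> y = (a \<oplus>\<^bsub>A\<^esub> b) \<odot> m" "a \<oplus>\<^bsub>A\<^esub> b \<in> carrier A" using add_act assms(1) a b by simp_all
    then show ?thesis by blast
  qed
  show "b \<odot> x \<in> {a \<odot> m |a. a \<in> carrier A}" if "b \<in> carrier A" "x \<in> {a \<odot> m |a. a \<in> carrier A}" for b x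
  proof -
    from that(2) obtain a where a: "a \<in> carrier A" "x = a \<odot> m" by auto
    have "b \<odot> x = (a \<otimes>\<^bsub>A\<^esub> b) \<odot> m" "a \<otimes>\<^bsub>A\<^esub> b \<in> carrier A"
      using act_act assms(1) mult_closed that(1) a by simp_all
    then show ?thesis by blast
  qed
qed

text \<open>Unitality is what puts \<open>m\<close> itself among its multiples.\<close>

lemma generated_submodule_eq:
  assumes "m \<in> carrier M"
  shows "generated_submodule A M m = {a \<odot> m |a. a \<in> carrier A}"
proof
  have "m \<in> {a \<odot> m |a. a \<in> carrier A}" using unital[OF assms] by force
  then show "generated_submodule A M m \<subseteq> {a \<odot> m |a. a \<in> carrier A}"
    using cyclic_submodule[OF assms] by (auto simp: generated_submodule_def)
  show "{a \<odot> m |a. a \<in> carrier A} \<subseteq> generated_submodule A M m"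
    using submoduleD(5) by (auto simp: generated_submodule_def)
qed

end

text \<open>Unitality is the delicate point, since the two components have different local units. If
  a fixes m, and b fixes the defect n - na, then a + b - ab fixes both m and n.\<close>

lemma dsum_rng_module:
  assumes "rng_module A M" "rng_module A N"
  shows "rng_module A (dsum_mod M N)"
proof -
  interpret M: rng_module A M by fact
  interpret N: rng_module A N by fact
  have "abelian_group (dsum_mod M N)"
  proof (rule abelian_groupI)
    fix x assume "x \<in> carrier (dsum_mod M N)"
    then show "\<exists>y\<in>carrier (dsum_mod M N). y \<oplus>\<^bsub>dsum_mod M N\<^esub> x = \<zero>\<^bsub>dsum_mod M N\<^esub>"
      by (intro bexI[of _ "(\<ominus>\<^bsub>M\<^esub> fst x, \<ominus>\<^bsub>N\<^esub> snd x)"]) (auto simp: dsum_mod_def M.l_neg N.l_neg)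
  qed (auto simp: dsum_mod_def M.a_ac N.a_ac)
  moreover have "\<exists>a\<in>carrier A. a \<odot>\<^bsub>dsum_mod M N\<^esub> x = x" if x: "x \<in> carrier (dsum_mod M N)" for x
  proof -
    obtain m n where mn: "x = (m, n)" "m \<in> carrier M" "n \<in> carrier N" using x by (auto simp: dsum_mod_def)
    obtain a where a: "a \<in> carrier A" "a \<odot>\<^bsub>M\<^esub> m = m" using M.unital[OF mn(2)] by blast
    define n' where "n' = n \<ominus>\<^bsub>N\<^esub> a \<odot>\<^bsub>N\<^esub> n"
    have n': "n' \<in> carrier N" using mn a N.act_closed by (simp add: n'_def)
    obtain b where b: "b \<in> carrier A" "b \<odot>\<^bsub>N\<^esub> n' = n'" using N.unital[OF n'] by blast
    \<comment> \<open>a common unit for both components\<close>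
    define c where "c = a \<oplus>\<^bsub>A\<^esub> (b \<oplus>\<^bsub>A\<^esub> \<ominus>\<^bsub>A\<^esub> (a \<otimes>\<^bsub>A\<^esub> b))"
    have c: "c \<in> carrier A" using a b M.mult_closed by (simp add: c_def)
    have "c \<odot>\<^bsub>M\<^esub> m = m"
      using a b M.mult_closed mn M.act_closed by (simp add: c_def M.add_act M.act_minus_left M.act_act M.r_neg)
    moreover have "c \<odot>\<^bsub>N\<^esub> n = a \<odot>\<^bsub>N\<^esub> n \<oplus>\<^bsub>N\<^esub> b \<odot>\<^bsub>N\<^esub> n'"
      using a b M.mult_closed mn N.act_closed
      by (simp add: c_def N.add_act N.act_minus_left N.act_act n'_def N.act_diff) (simp add: a_minus_def)
    moreover have "a \<odot>\<^bsub>N\<^esub> n \<oplus>\<^bsub>N\<^esub> n' = n"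
      using a mn N.act_closed[of a n] unfolding n'_def a_minus_def
      by (metis N.a_inv_closed N.a_lcomm N.r_neg N.r_zero)
    ultimately have "c \<odot>\<^bsub>dsum_mod M N\<^esub> x = x" using b mn by (simp add: dsum_mod_def)
    with c show ?thesis by blast
  qed
  ultimately have rm: "right_module A (dsum_mod M N)"
    by (intro right_module.intro right_module_axioms.intro)
      (auto simp: dsum_mod_def M.act_closed N.act_closed M.act_add N.act_add M.add_act N.add_act M.act_act N.act_act)
  show ?thesis
    by (intro rng_module.intro rng_module_axioms.intro rm M.A.abelian_group_axioms M.mult_closed)
qed

section \<open>Consequences of the relations\<close>

text \<open>Composed paths share a vertex, so the remainder of \<open>r\<close> behind the prefix
  \<open>p\<close> has to be completed by \<open>last p\<close>.\<close>

lemma lookup_path_mult_single: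
  fixes f :: "'k::field path_comb"
  assumes "f \<in> pcar" "p \<noteq> []"
  shows "lkp (path_mult (sgl p c) f) r =
    (if take (length p) r = p then c * lkp f (last p # drop (length p) r) else 0)"
  using assms(1)
proof (induction rule: pcar_induct)
  case (single q d)
  then have q: "q = hd q # tl q" by (cases q) (auto simp: quiver_paths_def)
  have r: "take (length p) r = p \<longleftrightarrow> r = p @ drop (length p) r"
    by (metis append_eq_conv_conj append_take_drop_id)
  show ?case
  proof (cases "take (length p) r = p \<and> q = last p # drop (length p) r")
    case True
    then have "last p = hd q" "p @ tl q = r" using r q by (metis list.sel)+
    with True show ?thesis by (simp add: path_mult_single)
  next
    case False
    have "p @ tl q \<noteq> r" if "last p = hd q"
      using False that q by auto
    with False show ?thesis by (auto simp: path_mult_single lookup_single when_def)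
  qed
qed (simp_all add: path_mult_add_right lookup_add distrib_left)

text \<open>Taking the coefficient at a trivial path is multiplicative, and the relations involve
  paths of length two only.\<close>

lemma ideal_lookup_trivial:
  fixes s :: "3 \<Rightarrow> point \<Rightarrow> 'k::field"
  assumes "f \<in> rauzy_ideal s" shows "lkp f [v] = 0"
proof -
  let ?J = "{f :: 'k path_comb. f \<in> pcar \<and> (\<forall>v. lkp f [v] = 0)}"
  have trivial: "lkp (path_mult f g) [v] = lkp f [v] * lkp g [v]" if "f \<in> pcar" "g \<in> pcar"
    for f g :: "'k path_comb" and v
    using that(1)
  proof (induction rule: pcar_induct)
    case (single p c)
    then have p: "p \<noteq> []" by (auto simp: quiver_paths_def)
    have "take (length p) [v] = p \<longleftrightarrow> p = [v]" using p by (cases p) auto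
    then show ?case by (auto simp: lookup_path_mult_single[OF that(2) p] lookup_single when_def)
  qed (simp_all add: path_mult_add_left lookup_add distrib_right)
  have "lkp f [v] = 0" if "f \<in> rauzy_relations s" for f v
    using that by (auto simp: rauzy_relations_def lookup_single when_def lookup_minus
      lookup_map_times loop_diff_def loop_at_def)
  then have "is_rel_ideal s ?J"
    using rauzy_relations_pcar[of s]
    by (auto simp: is_rel_ideal_def pcar_closed lookup_add lookup_uminus trivial path_mult_closed)
  from rauzy_ideal_least[OF this] assms show ?thesis by auto
qed

text \<open>By the previous lemma the coefficient is constant on a coset, so \<open>the_elem\<close>
  in \<open>simple_at\<close> is applied to a singleton.\<close>

lemma simple_smult: "pcls s g \<odot>\<^bsub>simple_at z\<^esub> t = t * lkp g [z]"
proof -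
  have "(\<lambda>f. t * lkp f [z]) ` pcls s g = {t * lkp g [z]}"
  proof -
    have "lkp f [z] = lkp g [z]" if "f \<in> pcls s g" for f
      using that ideal_lookup_trivial[of "f - g" s z] by (simp add: in_pcls_iff lookup_minus)
    then have "(\<lambda>f. t * lkp f [z]) ` pcls s g = (\<lambda>f. t * lkp g [z]) ` pcls s g"
      by (intro image_cong) simp_all
    moreover have "pcls s g \<noteq> {}" using pcls_self[of g s] by (metis empty_iff)
    ultimately show ?thesis by (simp only: image_constant_conv if_False)
  qed
  then show ?thesis by (simp add: simple_at_def)
qed

lemma abelian_group_simple_at: "abelian_group (simple_at z :: ('k::field path_comb set, 'k) module)"
proof (rule abelian_groupI)
  fix x :: 'k
  show "\<exists>y\<in>carrier (simple_at z). y \<oplus>\<^bsub>simple_at z\<^esub> x = \<zero>\<^bsub>simple_at z\<^esub>"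
    by (intro bexI[of _ "- x"]) (simp_all add: simple_at_def)
qed (simp_all add: simple_at_def add_ac)

lemma abelian_group_dsum_simple:
  "abelian_group (dsum_mod (simple_at u :: ('k::field path_comb set, 'k) module) (simple_at v))"
proof (rule abelian_groupI)
  fix x :: "'k \<times> 'k"
  show "\<exists>y\<in>carrier (dsum_mod (simple_at u) (simple_at v)).
     y \<oplus>\<^bsub>dsum_mod (simple_at u) (simple_at v)\<^esub> x = \<zero>\<^bsub>dsum_mod (simple_at u) (simple_at v)\<^esub>"
    by (intro bexI[of _ "(- fst x, - snd x)"]) (simp_all add: dsum_mod_def simple_at_def split: prod.split)
qed (auto simp add: dsum_mod_def simple_at_def add_ac)

text \<open>Scalars act on the ideal as multiples of trivial paths.\<close>

lemma scale_ideal: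
  assumes "f \<in> rauzy_ideal s" "vertex z"
  shows "path_mult (sgl [z] c) f \<in> rauzy_ideal s"
  by (rule rauzy_ideal_mult) (simp_all add: assms pcar_closed edge_path)

lemma zero_relation:
  assumes "edge x u" "edge u w" "x \<noteq> w" "\<And>v. \<not> rhombus x u w v"
  shows "sgl [x, u, w] c \<in> rauzy_ideal s"
proof -
  have "sgl [x, u, w] 1 \<in> rauzy_relations s"
    unfolding rauzy_relations_def by (rule UnI1, rule UnI1) (use assms in blast)
  then have "path_mult (sgl [x] c) (sgl [x, u, w] 1) \<in> rauzy_ideal s"
    using scale_ideal relation_in_rauzy_ideal edge_vertex(1)[OF assms(1)] by blast
  then show ?thesis by (simp add: path_mult_single)
qed

lemma rhombus_relation:
  assumes "rhombus z u y v" shows "sgl [z, u, y] c - sgl [z, v, y] c \<in> rauzy_ideal s"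
proof -
  have "sgl [z, u, y] 1 - sgl [z, v, y] 1 \<in> rauzy_relations s"
    unfolding rauzy_relations_def by (rule UnI1, rule UnI2) (use assms in blast)
  then have "path_mult (sgl [z] c) (sgl [z, u, y] 1 - sgl [z, v, y] 1) \<in> rauzy_ideal s"
    using scale_ideal relation_in_rauzy_ideal rhombus_edge(9)[OF assms] by blast
  then show ?thesis by (simp add: path_mult_single path_mult_diff)
qed

lemma loop_relation:
  assumes "vertex z"
  shows "Poly_Mapping.map ((*) (s a z)) (loop_diff a z) - Poly_Mapping.map ((*) (s c z)) (loop_diff c z)
    \<in> rauzy_ideal s"
  unfolding rauzy_relations_def
  by (rule relation_in_rauzy_ideal, unfold rauzy_relations_def, rule UnI2) (use assms in blast)

lemma sgl_append_ideal:
  assumes "sgl p 1 \<in> rauzy_ideal s" "q \<in> quiver_paths" "last p = hd q"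
  shows "sgl (p @ tl q) c \<in> rauzy_ideal s"
  using rauzy_ideal_mult(2)[OF pcar_closed(5)[OF assms(2), of c] assms(1)] assms(3)
  by (simp add: path_mult_single)

lemma sgl_prepend_ideal:
  assumes "sgl q 1 \<in> rauzy_ideal s" "p \<in> quiver_paths" "last p = hd q"
  shows "sgl (p @ tl q) c \<in> rauzy_ideal s"
  using rauzy_ideal_mult(1)[OF pcar_closed(5)[OF assms(2), of c] assms(1)] assms(3)
  by (simp add: path_mult_single)

lemma ideal_diff_cancel: "f - g \<in> rauzy_ideal s \<Longrightarrow> g \<in> rauzy_ideal s \<Longrightarrow> f \<in> rauzy_ideal s"
  using rauzy_ideal_closed(2)[of "f - g" s g] by simp

text \<open>
  If both corners u, v carried a rhombus that continues towards w, then the two rhombi and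
  the given one would be three faces at a vertex of a cube, and the cube lemma applies.
\<close>
lemma rhombus_path_extend_zero:
  fixes s :: "3 \<Rightarrow> point \<Rightarrow> 'k::field"
  assumes rh: "rhombus z u y v" and w: "edge y w" "w \<noteq> u" "w \<noteq> v"
  shows "sgl [z, u, y, w] 1 \<in> rauzy_ideal s"
proof -
  note E = rhombus_edge[OF rh]
  have qp: "[y, w] \<in> quiver_paths" "[z, u] \<in> quiver_paths" using E w(1) edge_path(1) by blast+
  have via: "sgl [z, u, y, w] 1 \<in> rauzy_ideal s"
    if "rhombus z u y v" "edge y w" "w \<noteq> u" "sgl [u, y, w] 1 \<in> rauzy_ideal s" for u v
    using sgl_prepend_ideal[OF that(4), of "[z, u]" 1] rhombus_edge[OF that(1)] edge_path by simp
  show ?thesis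
  proof (cases "\<exists>t. rhombus u y w t")
    case False
    then have "sgl [u, y, w] 1 \<in> rauzy_ideal s" using E w by (intro zero_relation) auto
    with via[OF rh w(1,2)] show ?thesis by simp
  next
    case True
    then obtain t where t: "rhombus u y w t" by blast
    show ?thesis
    proof (cases "\<exists>t'. rhombus v y w t'")
      case False
      then have "sgl [v, y, w] 1 \<in> rauzy_ideal s" using E w by (intro zero_relation) auto
      with via[OF rhombus_flip[OF rh] w(1,3)] have "sgl [z, v, y, w] 1 \<in> rauzy_ideal s" by simp
      moreover have "path_mult (sgl [z, u, y] 1 - sgl [z, v, y] 1) (sgl [y, w] 1) \<in> rauzy_ideal s"
        by (intro rauzy_ideal_mult(2) pcar_closed(5) qp rhombus_relation rh)
      then have "sgl [z, u, y, w] 1 - sgl [z, v, y, w] 1 \<in> rauzy_ideal s"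
        by (simp add: path_mult_diff path_mult_single)
      ultimately show ?thesis using ideal_diff_cancel by blast
    next
      case True
      then obtain t' where t': "rhombus v y w t'" by blast
      note T = rhombus_edge[OF t]
      have "z \<noteq> t"
      proof
        assume "z = t"
        then have "w = y + z - u" using rhombus_parallelogram[OF t] by simp
        moreover have "v = y + z - u" by (simp add: rhombus_parallelogram[OF rh])
        ultimately show False using w(3) by simp
      qed
      moreover have "\<not> rhombus z u t m" for m using cube[OF rh t t'] .
      ultimately have "sgl [z, u, t] 1 \<in> rauzy_ideal s" using E T by (intro zero_relation) auto
      from sgl_append_ideal[OF this, of "[t, w]" 1] have "sgl [z, u, t, w] 1 \<in> rauzy_ideal s"
        using edge_path(1)[OF T(7)] by simp
      moreover have "path_mult (sgl [z, u] 1) (sgl [u, y, w] 1 - sgl [u, t, w] 1) \<in> rauzy_ideal s"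
        by (intro rauzy_ideal_mult(1) pcar_closed(5) qp rhombus_relation t)
      then have "sgl [z, u, y, w] 1 - sgl [z, u, t, w] 1 \<in> rauzy_ideal s"
        by (simp add: path_mult_diff path_mult_single)
      ultimately show ?thesis using ideal_diff_cancel by blast
    qed
  qed
qed

lemma pe_offset:
  assumes "u - y \<in> {pe a, - pe a}" "a \<noteq> c" shows "y + pe c \<noteq> u" "y - pe c \<noteq> u"
proof -
  have "(y + pe c) - y = pe c" "(y - pe c) - y = - pe c" by simp_all
  then show "y + pe c \<noteq> u" "y - pe c \<noteq> u" using assms pe_distinct[OF assms(2)] by (metis empty_iff insert_iff)+
qed

lemma pe_opposite: "y + pe a \<noteq> y - pe a"
proof
  assume "y + pe a = y - pe a"
  then have "y + pe a = y + - pe a" by simp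
  then show False using pe_nonzero[of a] by (simp only: add_left_cancel)
qed

section \<open>Action of paths on a module\<close>

locale rauzy_mod = rng_module "rauzy_algebra s" M
  for s :: "3 \<Rightarrow> point \<Rightarrow> 'k::field" and M :: "('k path_comb set, 'b, 'd) module_scheme" (structure)
begin

definition pact :: "'k path_comb \<Rightarrow> 'b \<Rightarrow> 'b" where
  "pact f m = pcls s f \<odot> m"

lemma pact_closed [simp]: "f \<in> pcar \<Longrightarrow> m \<in> carrier M \<Longrightarrow> pact f m \<in> carrier M"
  by (simp add: pact_def act_closed pcls_in_carrier)

lemma pact_add_left: "f \<in> pcar \<Longrightarrow> g \<in> pcar \<Longrightarrow> m \<in> carrier M \<Longrightarrow> pact (f + g) m = pact f m \<oplus> pact g m"
  by (simp add: pact_def add_act pcls_in_carrier rauzy_algebra_add[symmetric])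

lemma pact_mult: "f \<in> pcar \<Longrightarrow> g \<in> pcar \<Longrightarrow> m \<in> carrier M \<Longrightarrow> pact g (pact f m) = pact (path_mult f g) m"
  by (simp add: pact_def act_act[symmetric] pcls_in_carrier rauzy_algebra_mult[symmetric])

lemma pact_zero_right [simp]: "f \<in> pcar \<Longrightarrow> pact f \<zero> = \<zero>"
  by (simp add: pact_def act_zero_right pcls_in_carrier)

lemma pact_ideal: "f \<in> rauzy_ideal s \<Longrightarrow> m \<in> carrier M \<Longrightarrow> pact f m = \<zero>"
  using pcls_eq_iff[of s f 0] act_zero_left[of m] by (simp add: pact_def rauzy_algebra_zero)

lemma pact_zero_left [simp]: "m \<in> carrier M \<Longrightarrow> pact 0 m = \<zero>"
  using pact_ideal zero_in_rauzy_ideal by blast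

lemma pact_cong: "f - g \<in> rauzy_ideal s \<Longrightarrow> pact f m = pact g m"
  using pcls_eq_iff[of s f g] by (simp add: pact_def)

lemma pact_minus: "f \<in> pcar \<Longrightarrow> m \<in> carrier M \<Longrightarrow> pact (- f) m = \<ominus> pact f m"
  using pact_add_left[of "- f" f m] pcar_closed(3)[of f] by (simp add: minus_equality)

lemma pact_diff: "f \<in> pcar \<Longrightarrow> g \<in> pcar \<Longrightarrow> m \<in> carrier M \<Longrightarrow> pact (f - g) m = pact f m \<ominus> pact g m"
  using pact_add_left[of f "- g" m] pcar_closed(3)[of g] by (simp add: pact_minus a_minus_def)

lemma pact_append:
  assumes "p \<in> quiver_paths" "q \<in> quiver_paths" "last p = hd q" "m \<in> carrier M"
  shows "pact (sgl (p @ tl q) c) m = pact (sgl q c) (pact (sgl p 1) m)"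
  using assms pact_mult[of "sgl p 1" "sgl q c" m] by (simp add: pcar_closed path_mult_single)

lemma pact_append_zero:
  assumes "p \<in> quiver_paths" "q \<in> quiver_paths" "last p = hd q" "m \<in> carrier M" "pact (sgl p 1) m = \<zero>"
  shows "pact (sgl (p @ tl q) c) m = \<zero>"
  using pact_append[OF assms(1-4)] assms(2,5) by (simp add: pcar_closed)

lemma neg_zero [simp]: "\<ominus> \<zero> = \<zero>"
  using minus_equality[of \<zero> \<zero>] by simp

lemma minus_zero_iff: "x \<in> carrier M \<Longrightarrow> \<ominus> x = \<zero> \<longleftrightarrow> x = \<zero>"
proof
  assume x: "x \<in> carrier M" and "\<ominus> x = \<zero>"
  then have "\<ominus> (\<ominus> x) = \<ominus> \<zero>" by simp
  then show "x = \<zero>" using x by simp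
qed simp

lemma signed_pact_zero_iff:
  assumes "f \<in> pcar" "m \<in> carrier M" "c \<in> {1, -1}"
  shows "pact (Poly_Mapping.map ((*) c) f) m = \<zero> \<longleftrightarrow> pact f m = \<zero>"
proof -
  have "Poly_Mapping.map ((*) 1) f = f" "Poly_Mapping.map ((*) (-1)) f = - f"
    by (rule poly_mapping_eqI, simp add: lookup_map_times lookup_uminus)+
  then show ?thesis using assms by (auto simp: pact_minus minus_zero_iff)
qed

text \<open>Let a, b be the axes of \<open>u\<close>, \<open>v\<close> at \<open>y\<close> and c the
  third axis. Both loops along c vanish on \<open>m\<close>, hence so does the difference of loops
  along c and, by the third family of relations, the one along a. Of its two loops the one opposite
  to \<open>u\<close> vanishes on \<open>m\<close> as well, so the loop through \<open>u\<close> is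
  left alone and must vanish.\<close>

lemma loop_kill:
  assumes sc: "sign_choice s" and rh: "rhombus z u y v" and m: "m \<in> carrier M"
    and kill: "\<And>w. edge y w \<Longrightarrow> w \<noteq> u \<Longrightarrow> w \<noteq> v \<Longrightarrow> pact (sgl [y, w] 1) m = \<zero>"
  shows "pact (sgl [y, u, y] 1) m = \<zero>"
proof -
  obtain a b c where abc: "a \<noteq> b" "a \<noteq> c" "b \<noteq> c" "u - y \<in> {pe a, - pe a}" "v - y \<in> {pe b, - pe b}"
    using rhombus_directions[OF rhombus_opposite[OF rh]] by metis
  have vy: "vertex y" and uy: "edge y u" using rhombus_edge[OF rh] by auto
  have sgn: "s a y \<in> {1, -1}" for a using sc vy by (auto simp: sign_choice_def)
  have kl: "pact (loop_at y w) m = \<zero>" if "w \<noteq> u" "w \<noteq> v" for w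
  proof (cases "edge y w")
    case True
    then have "pact (sgl ([y, w] @ tl [w, y]) 1) m = \<zero>"
      using kill that m edge_sym edge_path by (intro pact_append_zero) auto
    then show ?thesis using True by (simp add: loop_at_def)
  qed (simp add: loop_at_def m)
  have pc: "loop_diff a y \<in> pcar" for a by (simp add: loop_diff_def pcar_closed loop_at_pcar)
  have "y + pe c \<noteq> u" "y - pe c \<noteq> u" "y + pe c \<noteq> v" "y - pe c \<noteq> v"
    using pe_offset[OF abc(4,2)] pe_offset[OF abc(5,3)] by blast+
  then have "pact (loop_diff c y) m = \<zero>"
    using m kl by (simp add: loop_diff_def pact_diff loop_at_pcar a_minus_def)
  then have "pact (Poly_Mapping.map ((*) (s c y)) (loop_diff c y)) m = \<zero>"
    using signed_pact_zero_iff[OF pc m sgn] by simp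
  moreover have "pact (Poly_Mapping.map ((*) (s a y)) (loop_diff a y)) m
      = pact (Poly_Mapping.map ((*) (s c y)) (loop_diff c y)) m"
    by (rule pact_cong[OF loop_relation[OF vy]])
  ultimately have "pact (Poly_Mapping.map ((*) (s a y)) (loop_diff a y)) m = \<zero>" by simp
  then have *: "pact (loop_diff a y) m = \<zero>"
    by (simp only: signed_pact_zero_iff[OF pc m sgn])
  have lu: "(loop_at y u :: 'k path_comb) = sgl [y, u, y] 1" using uy by (simp add: loop_at_def)
  have pu: "sgl [y, u, y] 1 \<in> (pcar :: 'k path_comb set)" using lu loop_at_pcar by metis
  consider "u = y + pe a" | "u = y - pe a" using abc(4) by (auto simp: diff_eq_eq add.commute)
  then show ?thesis
  proof cases
    case 1
    have "y - pe a \<noteq> u" "y - pe a \<noteq> v"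
      using 1 pe_opposite[of y a] pe_offset(2)[OF abc(5) abc(1)[symmetric]] by simp_all
    then have "pact (loop_at y u - loop_at y (y - pe a)) m = pact (sgl [y, u, y] 1) m"
      using m kl lu pu by (simp add: pact_diff loop_at_pcar a_minus_def)
    then have "pact (loop_diff a y) m = pact (sgl [y, u, y] 1) m"
      by (simp add: loop_diff_def 1)
    with * show ?thesis by simp
  next
    case 2
    have "y + pe a \<noteq> u" "y + pe a \<noteq> v"
      using 2 pe_opposite[of y a] pe_offset(1)[OF abc(5) abc(1)[symmetric]] by simp_all
    then have "pact (loop_at y (y + pe a) - loop_at y u) m = \<ominus> pact (sgl [y, u, y] 1) m"
      using m kl lu pu by (simp add: pact_diff loop_at_pcar a_minus_def)
    then have "pact (loop_diff a y) m = \<ominus> pact (sgl [y, u, y] 1) m"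
      by (simp add: loop_diff_def 2)
    with * show ?thesis using minus_zero_iff[OF pact_closed[OF pu m]] by simp
  qed
qed

text \<open>The path returns to \<open>y\<close>, which is the loop just treated; or it bends around
  another rhombus, whose fourth corner is neither \<open>u\<close> nor \<open>v\<close>, and can be
  rerouted through an arrow that kills \<open>m\<close>; or it is a zero relation.\<close>

lemma kill_step:
  assumes sc: "sign_choice s" and rh: "rhombus z u y v" and m: "m \<in> carrier M"
    and kill: "\<And>w. edge y w \<Longrightarrow> w \<noteq> u \<Longrightarrow> w \<noteq> v \<Longrightarrow> pact (sgl [y, w] 1) m = \<zero>"
    and w: "edge u w" "w \<noteq> z"
  shows "pact (sgl [y, u, w] 1) m = \<zero>"
proof (cases "w = y")
  case True
  then show ?thesis using loop_kill[OF sc rh m kill] by simp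
next
  case False
  note E = rhombus_edge[OF rh]
  show ?thesis
  proof (cases "\<exists>t. rhombus y u w t")
    case True
    then obtain t where t: "rhombus y u w t" by blast
    have "t \<noteq> u" using rhombus_distinct[OF t] by simp
    moreover have "t \<noteq> v"
    proof
      assume "t = v"
      then have "w = u + v - y" using rhombus_parallelogram[OF t] by simp
      then have "w = z" by (simp add: rhombus_parallelogram[OF rh])
      with w(2) show False by simp
    qed
    ultimately have "pact (sgl ([y, t] @ tl [t, w]) 1) m = \<zero>"
      using rhombus_edge[OF t] m kill edge_path by (intro pact_append_zero) auto
    moreover have "pact (sgl [y, u, w] 1) m = pact (sgl [y, t, w] 1) m"
      by (rule pact_cong[OF rhombus_relation[OF t]])
    ultimately show ?thesis by simp
  next
    case no: False
    then have "sgl [y, u, w] 1 \<in> rauzy_ideal s" using E w False by (intro zero_relation) auto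
    then show ?thesis using pact_ideal m by blast
  qed
qed

end

section \<open>Recognising rhombus modules\<close>

text \<open>The rhombus relation inside a longer path: one corner is exchanged for the
  other.\<close>

lemma path_swap:
  fixes s :: "3 \<Rightarrow> point \<Rightarrow> 'k::field"
  assumes rh: "rhombus a b c d" and p: "p \<in> quiver_paths" "last p = a" and r: "c # r \<in> quiver_paths"
  shows "sgl (p @ b # c # r) k - sgl (p @ d # c # r) k \<in> rauzy_ideal s"
proof -
  have "path_mult (sgl p k) (path_mult (sgl [a, b, c] 1 - sgl [a, d, c] 1) (sgl (c # r) 1)) \<in> rauzy_ideal s"
    by (intro rauzy_ideal_mult pcar_closed(5) p r rhombus_relation rh)
  then show ?thesis using p(2) by (simp add: path_mult_diff path_mult_single)
qed

lemma mod_homI: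
  assumes "\<And>x. x \<in> carrier M \<Longrightarrow> g x \<in> carrier N"
    and "\<And>x y. x \<in> carrier M \<Longrightarrow> y \<in> carrier M \<Longrightarrow> g (x \<oplus>\<^bsub>M\<^esub> y) = g x \<oplus>\<^bsub>N\<^esub> g y"
    and "\<And>f x. f \<in> pcar \<Longrightarrow> x \<in> carrier M \<Longrightarrow> g (pcls s f \<odot>\<^bsub>M\<^esub> x) = pcls s f \<odot>\<^bsub>N\<^esub> g x"
  shows "g \<in> mod_hom (rauzy_algebra s) M N"
  unfolding mod_hom_def hom_def using assms by (auto simp: rauzy_algebra_carrier)

lemma simple_at_simps:
  "carrier (simple_at z) = UNIV" "\<zero>\<^bsub>simple_at z\<^esub> = 0" "a \<oplus>\<^bsub>simple_at z\<^esub> b = a + b"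
  by (simp_all add: simple_at_def)

lemma dsum_simps:
  "carrier (dsum_mod M N) = carrier M \<times> carrier N" "\<zero>\<^bsub>dsum_mod M N\<^esub> = (\<zero>\<^bsub>M\<^esub>, \<zero>\<^bsub>N\<^esub>)"
  "(a, b) \<oplus>\<^bsub>dsum_mod M N\<^esub> (a', b') = (a \<oplus>\<^bsub>M\<^esub> a', b \<oplus>\<^bsub>N\<^esub> b')"
  "r \<odot>\<^bsub>dsum_mod M N\<^esub> (a, b) = (r \<odot>\<^bsub>M\<^esub> a, r \<odot>\<^bsub>N\<^esub> b)"
  by (simp_all add: dsum_mod_def)

text \<open>All assumptions but the last bound the module by four dimensions; \<open>nonzero\<close>
  is the only lower bound.\<close>

locale rhombus_gen = rauzy_mod s M
  for s :: "3 \<Rightarrow> point \<Rightarrow> 'k::field" and M :: "('k path_comb set, 'b) module" (structure) +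
  fixes z u y v :: point and m :: 'b
  assumes sc: "sign_choice s" and rh: "rhombus z u y v" and m: "m \<in> carrier M"
    and gen: "carrier M = {a \<odot> m |a. a \<in> carrier (rauzy_algebra s)}"
    and unit: "pact (sgl [y] 1) m = m"
    and kill: "\<And>w. edge y w \<Longrightarrow> w \<noteq> u \<Longrightarrow> w \<noteq> v \<Longrightarrow> pact (sgl [y, w] 1) m = \<zero>"
    and nonzero: "pact (sgl [y, u, z] 1) m \<noteq> \<zero>"
begin

lemmas E = rhombus_edge[OF rh]
lemmas D = rhombus_distinct[OF rh] rhombus_distinct[OF rh, symmetric]

lemma qp: "[y] \<in> quiver_paths" "[u] \<in> quiver_paths" "[v] \<in> quiver_paths" "[z] \<in> quiver_paths"
  "[y, u] \<in> quiver_paths" "[y, v] \<in> quiver_paths" "[u, z] \<in> quiver_paths" "[v, z] \<in> quiver_paths"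
  "[y, u, z] \<in> quiver_paths" "[y, v, z] \<in> quiver_paths" "[y, v, y] \<in> quiver_paths" "[y, u, y] \<in> quiver_paths"
  using E by (simp_all add: quiver_paths_def)

lemma kill_u: "edge u w \<Longrightarrow> w \<noteq> z \<Longrightarrow> pact (sgl [y, u, w] 1) m = \<zero>"
  using kill_step[OF sc rh m kill] .

lemma kill_v: "edge v w \<Longrightarrow> w \<noteq> z \<Longrightarrow> pact (sgl [y, v, w] 1) m = \<zero>"
  by (rule kill_step[OF sc rhombus_flip[OF rh] m]) (use kill in auto)

lemma swap_uv: "pact (sgl [y, v, z] c) m = pact (sgl [y, u, z] c) m"
  by (rule pact_cong[OF rhombus_relation[OF rhombus_flip[OF rhombus_opposite[OF rh]]]])

text \<open>The case that remains after \<open>rhombus_path_extend_zero\<close> is a step back to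
  \<open>u\<close> or \<open>v\<close>. Going around the rhombus twice replaces y, u, z, u by y, v,
  z, u and then by y, v, y, u, and the loop y, v, y kills \<open>m\<close>; the case of
  \<open>v\<close> is symmetric.\<close>

lemma kill_z:
  assumes "edge z w" shows "pact (sgl [y, u, z, w] 1) m = \<zero>"
proof -
  have zw: "[z, w] \<in> quiver_paths" using assms edge_path(1) by blast
  have ryz: "rhombus y u z v" using rh rhombus_opposite by blast
  consider "w \<noteq> u" "w \<noteq> v" | "w = u" | "w = v" by blast
  then show ?thesis
  proof cases
    case 1
    then show ?thesis using pact_ideal[OF rhombus_path_extend_zero[OF ryz assms] m] by blast
  next
    case 2
    have r: "rhombus v z u y" using rh rhombus_rotate by blast
    have "pact (sgl [y, u, z, u] 1) m = pact (sgl [y, v, z, u] 1) m"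
      using pact_cong[OF path_swap[OF ryz qp(1) _ zw, of 1 s]] 2 by simp
    also have "\<dots> = pact (sgl [y, v, y, u] 1) m"
      using pact_cong[OF path_swap[OF r qp(6) _ qp(2), of 1 s]] by simp
    also have "\<dots> = \<zero>"
      using pact_append_zero[OF qp(11) qp(5) _ m kill_v[OF E(7) D(3)[symmetric]], of 1] by simp
    finally show ?thesis using 2 by simp
  next
    case 3
    have r: "rhombus u z v y" using rh rhombus_rotate rhombus_flip by blast
    have "pact (sgl [y, u, z, v] 1) m = pact (sgl [y, u, y, v] 1) m"
      using pact_cong[OF path_swap[OF r qp(5) _ qp(3), of 1 s]] by simp
    also have "\<dots> = \<zero>"
      using pact_append_zero[OF qp(12) qp(6) _ m kill_u[OF E(2) D(3)[symmetric]], of 1] by simp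
    finally show ?thesis using 3 by simp
  qed
qed

section \<open>Normal forms and coordinates\<close>

definition F :: "'k \<Rightarrow> 'k \<Rightarrow> 'k \<Rightarrow> 'k \<Rightarrow> 'k path_comb" where
  "F a b c d = sgl [y] a + sgl [y, u] b + sgl [y, v] c + sgl [y, u, z] d"

lemma F_pcar [simp]: "F a b c d \<in> pcar"
  by (simp add: F_def pcar_closed qp)

lemma F_add: "F a b c d + F a' b' c' d' = F (a + a') (b + b') (c + c') (d + d')"
  by (simp add: F_def single_add algebra_simps)

lemma F_zero: "F 0 0 0 0 = 0" by (simp add: F_def)

text \<open>Only paths that stay in the rhombus and move towards \<open>z\<close> can act on
  \<open>m\<close> without killing it. The two such paths from \<open>y\<close> to \<open>z\<close>
  act equally, so their coefficients are added.\<close>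

definition red :: "'k path_comb \<Rightarrow> 'k path_comb" where
  "red f = F (lkp f [y]) (lkp f [y, u]) (lkp f [y, v]) (lkp f [y, u, z] + lkp f [y, v, z])"

lemma pact_red_single:
  assumes p: "p \<in> quiver_paths" shows "pact (sgl p c) m = pact (red (sgl p c)) m"
proof -
  obtain x p1 where p1: "p = x # p1" using p by (cases p) (auto simp: quiver_paths_def)
  have redz: "red (sgl p c) = 0" if "p \<noteq> [y]" "p \<noteq> [y, u]" "p \<noteq> [y, v]" "p \<noteq> [y, u, z]" "p \<noteq> [y, v, z]"
    using that by (simp add: red_def lookup_single when_def F_zero)
  show ?thesis
  proof (cases "x = y")
    case False
    have "pact (sgl p c) m = pact (sgl p c) (pact (sgl [y] 1) m)" by (simp add: unit)
    also have "\<dots> = pact (path_mult (sgl [y] 1) (sgl p c)) m"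
      using p qp m by (intro pact_mult) (auto intro: pcar_closed)
    also have "\<dots> = \<zero>" using False p1 m by (simp add: path_mult_single)
    finally show ?thesis using redz False p1 m by simp
  next
    case x: True
    show ?thesis
    proof (cases p1)
      case Nil
      then show ?thesis using p1 x D by (simp add: red_def F_def lookup_single when_def)
    next
      case (Cons w1 p2)
      have e1: "edge y w1" using p p1 x Cons by (auto simp: quiver_paths_def)
      have p12: "w1 # p2 \<in> quiver_paths" using p p1 x Cons by (auto simp: quiver_paths_def)
      show ?thesis
      proof (cases "w1 = u \<or> w1 = v")
        case False
        then have "pact (sgl p c) m = \<zero>"
          using pact_append_zero[OF edge_path(1)[OF e1] p12 _ m kill[OF e1], of c] p1 x Cons by simp
        then show ?thesis using False redz p1 x Cons m by simp
      next
        case w1: True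
        show ?thesis
        proof (cases p2)
          case Nil
          then show ?thesis using p1 x Cons w1 D by (auto simp: red_def F_def lookup_single when_def)
        next
          case (Cons w2 p3)
          note p2 = \<open>p1 = w1 # p2\<close> Cons
          have e2: "edge w1 w2" using p12 p2 by (auto simp: quiver_paths_def)
          have p23: "w2 # p3 \<in> quiver_paths" using p12 p2 by (auto simp: quiver_paths_def)
          have q3: "[y, w1, w2] \<in> quiver_paths" using e1 e2 edge_path(2) by blast
          show ?thesis
          proof (cases "w2 = z")
            case False
            then have "pact (sgl [y, w1, w2] 1) m = \<zero>" using w1 e2 kill_u kill_v by auto
            then have "pact (sgl p c) m = \<zero>"
              using pact_append_zero[OF q3 p23 _ m, of c] p1 x p2 by simp
            then show ?thesis using False redz p1 x p2 m by simp
          next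
            case w2: True
            show ?thesis
            proof (cases p3)
              case Nil
              then show ?thesis using p1 x p2 w1 w2 D swap_uv by (auto simp: red_def F_def lookup_single when_def)
            next
              case (Cons w3 p4)
              have e3: "edge z w3" using p23 w2 Cons by (auto simp: quiver_paths_def)
              have p34: "w3 # p4 \<in> quiver_paths" using p23 Cons by (auto simp: quiver_paths_def)
              have q4: "[y, w1, z, w3] \<in> quiver_paths" using e1 e2 e3 w2 edge_vertex by (auto simp: quiver_paths_def)
              have "pact (sgl [y, u, z, w3] 1) m = \<zero>" by (rule kill_z[OF e3])
              moreover have "pact (sgl [y, u, z, w3] 1) m = pact (sgl [y, v, z, w3] 1) m"
                using pact_cong[OF path_swap[OF rhombus_opposite[OF rh] qp(1) _ edge_path(1)[OF e3], of 1 s]] by simp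
              ultimately have "pact (sgl [y, w1, z, w3] 1) m = \<zero>" using w1 by auto
              then have "pact (sgl p c) m = \<zero>"
                using pact_append_zero[OF q4 p34 _ m, of c] p1 x p2 w2 Cons by simp
              then show ?thesis using redz p1 x p2 Cons m by simp
            qed
          qed
        qed
      qed
    qed
  qed
qed

lemma red_pcar [simp]: "red f \<in> pcar" by (simp add: red_def)

lemma pact_red:
  assumes "f \<in> pcar" shows "pact f m = pact (red f) m"
  using assms
proof (induction rule: pcar_induct)
  case zero
  then show ?case by (simp add: red_def F_zero)
next
  case (single p c)
  then show ?case by (rule pact_red_single)
next
  case (add f g)
  have "red (f + g) = red f + red g" by (simp add: red_def F_add lookup_add add_ac)
  then show ?case using add m by (simp add: pact_add_left)
qed

definition \<Phi> :: "'k \<times> 'k \<times> 'k \<times> 'k \<Rightarrow> 'b" where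
  "\<Phi> = (\<lambda>(a, b, c, d). pact (F a b c d) m)"

lemma \<Phi>_closed [simp]: "\<Phi> q \<in> carrier M"
  using m by (simp add: \<Phi>_def split: prod.split)

lemma \<Phi>_add: "\<Phi> (a, b, c, d) \<oplus> \<Phi> (a', b', c', d') = \<Phi> (a + a', b + b', c + c', d + d')"
  using m by (simp add: \<Phi>_def F_add[symmetric] pact_add_left)

lemma \<Phi>_zero: "\<Phi> (0, 0, 0, 0) = \<zero>" using m by (simp add: \<Phi>_def F_zero)

text \<open>With this formula all questions on submodules become linear algebra in four coordinates,
  indexed by the corners \<open>y\<close>, \<open>u\<close>, \<open>v\<close>,
  \<open>z\<close>.\<close>

lemma \<Phi>_act:
  assumes f: "f \<in> pcar"
  shows "pcls s f \<odot> \<Phi> (a, b, c, d) = \<Phi> (a * lkp f [y], a * lkp f [y, u] + b * lkp f [u],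
     a * lkp f [y, v] + c * lkp f [v],
     a * (lkp f [y, u, z] + lkp f [y, v, z]) + b * lkp f [u, z] + c * lkp f [v, z] + d * lkp f [z])"
proof -
  let ?g = "path_mult (F a b c d) f"
  have g: "?g = path_mult (sgl [y] a) f + path_mult (sgl [y, u] b) f + path_mult (sgl [y, v] c) f
      + path_mult (sgl [y, u, z] d) f"
    by (simp add: F_def path_mult_add_left)
  note L = lookup_path_mult_single[OF f]
  have l: "lkp ?g [y] = a * lkp f [y]" "lkp ?g [y, u] = a * lkp f [y, u] + b * lkp f [u]"
     "lkp ?g [y, v] = a * lkp f [y, v] + c * lkp f [v]"
     "lkp ?g [y, u, z] = a * lkp f [y, u, z] + b * lkp f [u, z] + d * lkp f [z]"
     "lkp ?g [y, v, z] = a * lkp f [y, v, z] + c * lkp f [v, z]"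
    unfolding g using D by (simp_all add: lookup_add L)
  have "pcls s f \<odot> \<Phi> (a, b, c, d) = pact ?g m"
    using f m by (simp add: \<Phi>_def pact_mult[symmetric]) (simp add: pact_def)
  also have "\<dots> = pact (red ?g) m" using f by (intro pact_red path_mult_closed) simp_all
  finally show ?thesis by (simp add: red_def l \<Phi>_def algebra_simps)
qed

lemma \<Phi>_surj: "x \<in> carrier M \<Longrightarrow> \<exists>q. x = \<Phi> q"
proof -
  assume "x \<in> carrier M"
  then obtain f where f: "f \<in> pcar" "x = pcls s f \<odot> m"
    unfolding gen by (auto simp: rauzy_algebra_carrier)
  then have "x = pact (red f) m" using pact_red[OF f(1)] by (simp add: pact_def)
  then show ?thesis by (auto simp: red_def \<Phi>_def intro!: exI[of _ "(lkp f [y], lkp f [y, u], lkp f [y, v], lkp f [y, u, z] + lkp f [y, v, z])"])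
qed

text \<open>The first nonzero coordinate is carried to \<open>z\<close> by the rest of the path,
  with a suitable scalar. This concerns coordinates only and precedes injectivity of \<Phi>, which
  it implies: if \<Phi> vanished at a nonzero \<open>q\<close>, the image of the generator at
  \<open>z\<close> would vanish too.\<close>

lemma \<Phi>_essential:
  assumes "q \<noteq> (0, 0, 0, 0)"
  shows "\<exists>f\<in>pcar. pcls s f \<odot> \<Phi> q = \<Phi> (0, 0, 0, t)"
proof -
  obtain a b c d where q: "q = (a, b, c, d)" by (cases q) auto
  consider "a \<noteq> 0" | "a = 0" "b \<noteq> 0" | "a = 0" "b = 0" "c \<noteq> 0" | "a = 0" "b = 0" "c = 0" "d \<noteq> 0"
    using assms q by auto
  then show ?thesis
  proof cases
    case 1
    then show ?thesis using D by (intro bexI[of _ "sgl [y, u, z] (t / a)"]) (simp_all add: q \<Phi>_act pcar_closed qp lookup_single when_def)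
  next
    case 2
    then show ?thesis using D by (intro bexI[of _ "sgl [u, z] (t / b)"]) (simp_all add: q \<Phi>_act pcar_closed qp lookup_single when_def)
  next
    case 3
    then show ?thesis using D by (intro bexI[of _ "sgl [v, z] (t / c)"]) (simp_all add: q \<Phi>_act pcar_closed qp lookup_single when_def)
  next
    case 4
    then show ?thesis using D by (intro bexI[of _ "sgl [z] (t / d)"]) (simp_all add: q \<Phi>_act pcar_closed qp lookup_single when_def)
  qed
qed

lemma \<Phi>_socle_nonzero: "\<Phi> (0, 0, 0, 1) \<noteq> \<zero>"
  using nonzero by (simp add: \<Phi>_def F_def)

lemma \<Phi>_zero_iff: "\<Phi> q = \<zero> \<longleftrightarrow> q = (0, 0, 0, 0)"
proof
  assume 0: "\<Phi> q = \<zero>"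
  show "q = (0, 0, 0, 0)"
  proof (rule ccontr)
    assume "q \<noteq> (0, 0, 0, 0)"
    from \<Phi>_essential[OF this, of 1] obtain f where "f \<in> pcar" "pcls s f \<odot> \<zero> = \<Phi> (0, 0, 0, 1)"
      using 0 by auto
    then show False using \<Phi>_socle_nonzero act_zero_right pcls_in_carrier by metis
  qed
qed (simp add: \<Phi>_zero)

lemma \<Phi>_inj: "\<Phi> q = \<Phi> q' \<longleftrightarrow> q = q'"
proof
  obtain a b c d a' b' c' d' where q: "q = (a, b, c, d)" "q' = (a', b', c', d')" by (cases q, cases q') auto
  assume "\<Phi> q = \<Phi> q'"
  then have "\<Phi> q \<oplus> \<Phi> (- a', - b', - c', - d') = \<Phi> q' \<oplus> \<Phi> (- a', - b', - c', - d')" by simp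
  then have "\<Phi> (a - a', b - b', c - c', d - d') = \<zero>" by (simp add: q \<Phi>_add \<Phi>_zero)
  then show "q = q'" by (simp add: \<Phi>_zero_iff q)
qed simp

lemma gen_\<Phi>: "m = \<Phi> (1, 0, 0, 0)"
  using unit by (simp add: \<Phi>_def F_def)

definition co :: "'b \<Rightarrow> 'k \<times> 'k \<times> 'k \<times> 'k" where
  "co x = (THE q. x = \<Phi> q)"

lemma co_\<Phi> [simp]: "co (\<Phi> q) = q"
  unfolding co_def by (rule the_equality) (auto simp: \<Phi>_inj)

section \<open>Radical and socle\<close>

definition R :: "'b set" where "R = {\<Phi> (0, b, c, d) |b c d. True}"
definition L :: "'b set" where "L = {\<Phi> (0, 0, 0, d) |d. True}"

lemma \<Phi>_in_R [simp]: "\<Phi> (a, b, c, d) \<in> R \<longleftrightarrow> a = 0"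
  by (auto simp: R_def \<Phi>_inj)

lemma \<Phi>_in_L [simp]: "\<Phi> (a, b, c, d) \<in> L \<longleftrightarrow> a = 0 \<and> b = 0 \<and> c = 0"
  by (auto simp: L_def \<Phi>_inj)

lemma R_submodule: "submodule R (rauzy_algebra s) M"
proof (rule submoduleI)
  show "\<zero> \<in> R" using \<Phi>_zero[symmetric] by simp
  show "x \<oplus> x' \<in> R" if "x \<in> R" "x' \<in> R" for x x'
  proof -
    from that obtain b c d b' c' d' where "x = \<Phi> (0, b, c, d)" "x' = \<Phi> (0, b', c', d')" by (auto simp: R_def)
    then show ?thesis by (simp add: \<Phi>_add)
  qed
  show "a \<odot> x \<in> R" if a: "a \<in> carrier (rauzy_algebra s)" and "x \<in> R" for a x
  proof -
    obtain f where f: "f \<in> pcar" "a = pcls s f" using a by (rule rauzy_algebra_cases)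
    from that(2) obtain b c d where "x = \<Phi> (0, b, c, d)" by (auto simp: R_def)
    then show ?thesis using f by (simp add: \<Phi>_act)
  qed
qed (auto simp: R_def)

lemma L_submodule: "submodule L (rauzy_algebra s) M"
proof (rule submoduleI)
  show "\<zero> \<in> L" using \<Phi>_zero[symmetric] by simp
  show "x \<oplus> x' \<in> L" if "x \<in> L" "x' \<in> L" for x x'
  proof -
    from that obtain d d' where "x = \<Phi> (0, 0, 0, d)" "x' = \<Phi> (0, 0, 0, d')" by (auto simp: L_def)
    then show ?thesis by (simp add: \<Phi>_add)
  qed
  show "a \<odot> x \<in> L" if a: "a \<in> carrier (rauzy_algebra s)" and "x \<in> L" for a x
  proof -
    obtain f where f: "f \<in> pcar" "a = pcls s f" using a by (rule rauzy_algebra_cases)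
    from that(2) obtain d where "x = \<Phi> (0, 0, 0, d)" by (auto simp: L_def)
    then show ?thesis using f by (simp add: \<Phi>_act)
  qed
qed (auto simp: L_def)

text \<open>A scalar multiple of the trivial path at \<open>y\<close> turns an element with nonzero
  first coordinate into the generator. So \<open>R\<close> contains every proper submodule.\<close>

lemma submodule_not_in_R:
  assumes K: "submodule K (rauzy_algebra s) M" and "\<not> K \<subseteq> R" shows "K = carrier M"
proof -
  obtain x where x: "x \<in> K" "x \<notin> R" using assms(2) by blast
  have "x \<in> carrier M" using submoduleD(1)[OF K] x(1) by (rule subsetD)
  then obtain p where p: "x = \<Phi> p" using \<Phi>_surj by blast
  obtain a b c d where "p = (a, b, c, d)" by (cases p) auto
  with p have q: "x = \<Phi> (a, b, c, d)" by simp
  have a: "a \<noteq> 0"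
  proof
    assume "a = 0"
    then have "x \<in> R" using q by simp
    with x(2) show False ..
  qed
  have "pcls s (sgl [y] (1 / a)) \<odot> x = \<Phi> (1, 0, 0, 0)"
    using D a by (simp add: q \<Phi>_act pcar_closed qp lookup_single when_def)
  then have e: "pcls s (sgl [y] (1 / a)) \<odot> x = m" using gen_\<Phi> by (rule trans[OF _ sym])
  have pm: "pcls s (sgl [y] (1 / a)) \<in> carrier (rauzy_algebra s)"
    by (intro pcls_in_carrier pcar_closed(5) qp)
  have mK: "m \<in> K" using submoduleD(5)[OF K pm x(1)] unfolding e .
  show ?thesis
  proof (rule antisym[OF submoduleD(1)[OF K]])
    show "carrier M \<subseteq> K"
    proof
      fix x' assume "x' \<in> carrier M"
      then obtain a' where "a' \<in> carrier (rauzy_algebra s)" "x' = a' \<odot> m" unfolding gen by blast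
      then show "x' \<in> K" using submoduleD(5)[OF K _ mK] by simp
    qed
  qed
qed

lemma L_minimal:
  assumes K: "submodule K (rauzy_algebra s) M" and "K \<noteq> {\<zero>}" shows "L \<subseteq> K"
proof
  fix x assume "x \<in> L"
  then obtain t where t: "x = \<Phi> (0, 0, 0, t)" by (auto simp: L_def)
  obtain x0 where x0: "x0 \<in> K" "x0 \<noteq> \<zero>" using assms submoduleD(2)[OF K] by blast
  have "x0 \<in> carrier M" using submoduleD(1)[OF K] x0(1) by (rule subsetD)
  then obtain q where q: "x0 = \<Phi> q" using \<Phi>_surj by blast
  then have "q \<noteq> (0, 0, 0, 0)" using x0 \<Phi>_zero by auto
  from \<Phi>_essential[OF this, of t] obtain f where "f \<in> pcar" "pcls s f \<odot> x0 = x" using q t by auto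
  then show "x \<in> K" using submoduleD(5)[OF K pcls_in_carrier x0(1), of f] by simp
qed

lemma radical_eq: "radical (rauzy_algebra s) M = R"
proof -
  have R: "R \<subseteq> carrier M" "R \<noteq> carrier M"
  proof -
    show "R \<subseteq> carrier M" by (auto simp: R_def)
    have "\<Phi> (1, 0, 0, 0) \<notin> R" by (auto simp: R_def \<Phi>_inj)
    then show "R \<noteq> carrier M" using \<Phi>_closed by metis
  qed
  have "maximal_submodule (rauzy_algebra s) M H \<longleftrightarrow> H = R" for H
  proof
    assume H: "maximal_submodule (rauzy_algebra s) M H"
    then have "submodule H (rauzy_algebra s) M" "H \<noteq> carrier M"
        and max: "\<And>K. submodule K (rauzy_algebra s) M \<Longrightarrow> H \<subseteq> K \<Longrightarrow> K = H \<or> K = carrier M"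
      by (simp_all add: maximal_submodule_def)
    then have "H \<subseteq> R" using submodule_not_in_R by blast
    from max[OF R_submodule this] R(2) show "H = R" by simp
  next
    assume "H = R"
    then show "maximal_submodule (rauzy_algebra s) M H"
      unfolding maximal_submodule_def using R R_submodule submodule_not_in_R by (metis subset_antisym)
  qed
  then show ?thesis using R by (auto simp: radical_def)
qed

lemma socle_eq: "socle (rauzy_algebra s) M = L"
proof -
  have "\<Phi> (0, 0, 0, 1) \<in> L" by simp
  then have L: "L \<noteq> {\<zero>}" using \<Phi>_socle_nonzero by blast
  have sL: "simple_submodule (rauzy_algebra s) M L"
    unfolding simple_submodule_def using L_submodule L L_minimal by (metis subset_antisym)
  have "K = L" if "simple_submodule (rauzy_algebra s) M K" for K
  proof -
    have "L \<subseteq> K" using that L_minimal by (simp add: simple_submodule_def)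
    then have "L = {\<zero>} \<or> L = K" using that L_submodule by (simp add: simple_submodule_def)
    with L show ?thesis by simp
  qed
  note un = this
  show ?thesis unfolding socle_def
  proof (rule antisym)
    show "\<Inter> {H. submodule H (rauzy_algebra s) M \<and> (\<forall>K. simple_submodule (rauzy_algebra s) M K \<longrightarrow> K \<subseteq> H)} \<subseteq> L"
    proof (rule Inter_lower, rule CollectI, intro conjI L_submodule allI impI)
      fix K assume "simple_submodule (rauzy_algebra s) M K"
      then show "K \<subseteq> L" using un by simp
    qed
    show "L \<subseteq> \<Inter> {H. submodule H (rauzy_algebra s) M \<and> (\<forall>K. simple_submodule (rauzy_algebra s) M K \<longrightarrow> K \<subseteq> H)}"
      using sL by (intro Inter_greatest) simp
  qed
qed

section \<open>The isomorphisms with the simple modules\<close>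

lemma \<Phi>_cases:
  assumes "x \<in> carrier M" obtains a b c d where "x = \<Phi> (a, b, c, d)"
proof -
  obtain q where q: "x = \<Phi> q" using \<Phi>_surj[OF assms] by blast
  show thesis by (cases q) (use q that in simp)
qed

lemma top_iso: "mod_iso (rauzy_algebra s) (quot_mod M R) (simple_at y)"
proof (rule quot_iso[OF R_submodule abelian_group_simple_at])
  let ?g = "\<lambda>x. fst (co x)"
  show "?g \<in> mod_hom (rauzy_algebra s) M (simple_at y)"
  proof (rule mod_homI)
    fix x x' assume x: "x \<in> carrier M" "x' \<in> carrier M"
    obtain a b c d where "x = \<Phi> (a, b, c, d)" using x(1) by (rule \<Phi>_cases)
    moreover obtain a' b' c' d' where "x' = \<Phi> (a', b', c', d')" using x(2) by (rule \<Phi>_cases)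
    ultimately show "?g (x \<oplus> x') = ?g x \<oplus>\<^bsub>simple_at y\<^esub> ?g x'" by (simp add: \<Phi>_add simple_at_simps)
  next
    fix f :: "'k path_comb" and x assume f: "f \<in> pcar" and x: "x \<in> carrier M"
    obtain a b c d where "x = \<Phi> (a, b, c, d)" using x by (rule \<Phi>_cases)
    then show "?g (pcls s f \<odot> x) = pcls s f \<odot>\<^bsub>simple_at y\<^esub> ?g x" by (simp add: \<Phi>_act[OF f] simple_smult)
  qed (simp add: simple_at_simps)
  have "t \<in> ?g ` carrier M" for t by (rule image_eqI[of _ _ "\<Phi> (t, 0, 0, 0)"]) simp_all
  then show "?g ` carrier M = carrier (simple_at y)" by (auto simp: simple_at_simps)
  show "?g x = \<zero>\<^bsub>simple_at y\<^esub> \<longleftrightarrow> x \<in> R" if "x \<in> carrier M" for x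
    using that by (rule \<Phi>_cases) (simp add: simple_at_simps)
qed

lemma socle_iso: "mod_iso (rauzy_algebra s) (M\<lparr>carrier := L\<rparr>) (simple_at z)"
proof -
  let ?g = "\<lambda>x. snd (snd (snd (co x)))"
  have "?g \<in> mod_hom (rauzy_algebra s) (M\<lparr>carrier := L\<rparr>) (simple_at z)"
  proof (rule mod_homI)
    fix x x' assume "x \<in> carrier (M\<lparr>carrier := L\<rparr>)" "x' \<in> carrier (M\<lparr>carrier := L\<rparr>)"
    then obtain d d' where "x = \<Phi> (0, 0, 0, d)" "x' = \<Phi> (0, 0, 0, d')" by (auto simp: L_def)
    then show "?g (x \<oplus>\<^bsub>M\<lparr>carrier := L\<rparr>\<^esub> x') = ?g x \<oplus>\<^bsub>simple_at z\<^esub> ?g x'"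
      by (simp add: \<Phi>_add simple_at_simps)
  next
    fix f :: "'k path_comb" and x assume f: "f \<in> pcar" and "x \<in> carrier (M\<lparr>carrier := L\<rparr>)"
    then obtain d where "x = \<Phi> (0, 0, 0, d)" by (auto simp: L_def)
    then show "?g (pcls s f \<odot>\<^bsub>M\<lparr>carrier := L\<rparr>\<^esub> x) = pcls s f \<odot>\<^bsub>simple_at z\<^esub> ?g x"
      by (simp add: \<Phi>_act[OF f] simple_smult)
  qed (simp add: simple_at_simps)
  moreover have "bij_betw ?g L (carrier (simple_at z))"
  proof -
    have "t \<in> ?g ` L" for t by (rule image_eqI[of _ _ "\<Phi> (0, 0, 0, t)"]) simp_all
    then have "?g ` L = carrier (simple_at z)" by (auto simp: simple_at_simps)
    moreover have "inj_on ?g L" by (auto simp: inj_on_def L_def)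
    ultimately show ?thesis by (simp add: bij_betw_def)
  qed
  ultimately show ?thesis unfolding mod_iso_def by (intro bexI[of _ ?g]) simp_all
qed

lemma middle_iso:
  "mod_iso (rauzy_algebra s) (quot_mod (M\<lparr>carrier := R\<rparr>) L) (dsum_mod (simple_at u) (simple_at v))"
proof -
  have LR: "L \<subseteq> R" by (auto simp: L_def R_def)
  interpret R: rng_module "rauzy_algebra s" "M\<lparr>carrier := R\<rparr>" by (rule submodule_rng_module[OF R_submodule])
  let ?g = "\<lambda>x. (fst (snd (co x)), fst (snd (snd (co x))))"
  show ?thesis
  proof (rule R.quot_iso[OF submodule_of_submodule[OF R_submodule L_submodule LR] abelian_group_dsum_simple])
    show "?g \<in> mod_hom (rauzy_algebra s) (M\<lparr>carrier := R\<rparr>) (dsum_mod (simple_at u) (simple_at v))"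
    proof (rule mod_homI)
      fix x x' assume "x \<in> carrier (M\<lparr>carrier := R\<rparr>)" "x' \<in> carrier (M\<lparr>carrier := R\<rparr>)"
      then obtain b c d b' c' d' where "x = \<Phi> (0, b, c, d)" "x' = \<Phi> (0, b', c', d')" by (auto simp: R_def)
      then show "?g (x \<oplus>\<^bsub>M\<lparr>carrier := R\<rparr>\<^esub> x') = ?g x \<oplus>\<^bsub>dsum_mod (simple_at u) (simple_at v)\<^esub> ?g x'"
        by (simp add: \<Phi>_add dsum_simps simple_at_simps)
    next
      fix f :: "'k path_comb" and x assume f: "f \<in> pcar" and "x \<in> carrier (M\<lparr>carrier := R\<rparr>)"
      then obtain b c d where "x = \<Phi> (0, b, c, d)" by (auto simp: R_def)
      then show "?g (pcls s f \<odot>\<^bsub>M\<lparr>carrier := R\<rparr>\<^esub> x) = pcls s f \<odot>\<^bsub>dsum_mod (simple_at u) (simple_at v)\<^esub> ?g x"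
        by (simp add: \<Phi>_act[OF f] dsum_simps simple_smult)
    qed (simp add: dsum_simps simple_at_simps)
    have "q \<in> ?g ` R" for q
      by (rule image_eqI[of _ _ "\<Phi> (0, fst q, snd q, 0)"]) simp_all
    then show "?g ` carrier (M\<lparr>carrier := R\<rparr>) = carrier (dsum_mod (simple_at u) (simple_at v))"
      by (auto simp: dsum_simps simple_at_simps)
    show "?g x = \<zero>\<^bsub>dsum_mod (simple_at u) (simple_at v)\<^esub> \<longleftrightarrow> x \<in> L" if x: "x \<in> carrier (M\<lparr>carrier := R\<rparr>)" for x
    proof -
      obtain b c d where "x = \<Phi> (0, b, c, d)" using x by (auto simp: R_def)
      then show ?thesis by (simp add: dsum_simps simple_at_simps)
    qed
  qed
qed

theorem rhombus_module: "is_rhombus_module s M"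
proof -
  have "L \<subseteq> R" by (auto simp: L_def)
  then have "is_rhombus_module_at s z u y v M"
    unfolding is_rhombus_module_at_def Let_def radical_eq socle_eq
    by (intro conjI rh right_module_axioms top_iso socle_iso middle_iso)
  then show ?thesis unfolding is_rhombus_module_def by blast
qed

text \<open>Every nonzero element reaches the generator of the socle. This will show that the kernel
  in the exact sequence is no larger than the two rhombus submodules.\<close>

lemma essential:
  assumes "x \<in> carrier M" "x \<noteq> \<zero>"
  obtains a where "a \<in> carrier (rauzy_algebra s)" "a \<odot> x = pact (sgl [y, u, z] 1) m"
proof -
  obtain q where q: "x = \<Phi> q" using \<Phi>_surj assms(1) by blast
  then have "q \<noteq> (0, 0, 0, 0)" using assms(2) \<Phi>_zero by auto
  from \<Phi>_essential[OF this, of 1] obtain f where "f \<in> pcar" "pcls s f \<odot> x = \<Phi> (0, 0, 0, 1)" using q by auto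
  then show thesis using that[of "pcls s f"] pcls_in_carrier[of f s] by (simp add: \<Phi>_def F_def)
qed

end

section \<open>A trace form on loops of length four\<close>

text \<open>The rays from \<open>z\<close> to \<open>a\<close> and \<open>c\<close> bound a cone of
  the fan at \<open>z\<close>.\<close>

definition spans :: "point \<Rightarrow> point \<Rightarrow> point \<Rightarrow> bool" where
  "spans z a c \<longleftrightarrow> (\<exists>y. rhombus z a y c)"

definition axis_of :: "point \<Rightarrow> point \<Rightarrow> 3" where
  "axis_of z a = (THE d. a - z \<in> {pe d, - pe d})"

lemma axis_of_eq: "a - z \<in> {pe d, - pe d} \<Longrightarrow> axis_of z a = d"
  unfolding axis_of_def
proof (rule the_equality)
  fix e assume a: "a - z \<in> {pe d, - pe d}" and e: "a - z \<in> {pe e, - pe e}"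
  show "e = d"
  proof (rule ccontr)
    assume "e \<noteq> d"
    from pe_distinct[OF this] a e show False by (metis insertE singletonD)
  qed
qed

lemma axis_of_pe [simp]: "axis_of z (z + pe d) = d" "axis_of z (z - pe d) = d"
  by (rule axis_of_eq, simp)+

lemma edge_axis:
  assumes "edge z a" obtains d where "a = z + pe d \<or> a = z - pe d"
proof -
  from assms obtain w d r where "r \<in> {1, -1}" "z = proj_lattice w" "a = proj_lattice (w + axis d r)"
    unfolding edge_iff by blast
  then have "a = z + pe d \<or> a = z - pe d" by (auto simp: proj_lattice_add proj_lattice_axis)
  then show thesis by (rule that)
qed

lemma spans_sym: "spans z a c \<Longrightarrow> spans z c a"
  unfolding spans_def using rhombus_flip by blast

lemma spans_edge: "spans z a c \<Longrightarrow> edge z a" "spans z a c \<Longrightarrow> edge z c"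
  unfolding spans_def using rhombus_edge(1,8) by blast+

lemma spans_axis: "spans z a c \<Longrightarrow> axis_of z a \<noteq> axis_of z c"
  unfolding spans_def using rhombus_directions axis_of_eq by metis

definition ind :: "bool \<Rightarrow> 'k::field" where "ind b = (if b then 1 else 0)"

section \<open>Squares over an edge and self-intersection numbers\<close>

lemma spans_sq_iff:
  assumes w: "slab w" "slab (w + axis d r)" "r \<in> {1, -1}" and b: "b \<noteq> d" and t: "t \<in> {1, -1}"
  shows "spans (proj_lattice w) (proj_lattice (w + axis d r)) (proj_lattice (w + axis b t)) \<longleftrightarrow> sq w d r b t"
proof
  assume "sq w d r b t"
  then show "spans (proj_lattice w) (proj_lattice (w + axis d r)) (proj_lattice (w + axis b t))"
    unfolding spans_def rhombus_corners_iff by blast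
next
  assume "spans (proj_lattice w) (proj_lattice (w + axis d r)) (proj_lattice (w + axis b t))"
  then obtain y where y: "rhombus (proj_lattice w) (proj_lattice (w + axis d r)) y (proj_lattice (w + axis b t))"
    unfolding spans_def by blast
  have "r \<noteq> 0" using w by auto
  obtain b' t' where *: "sq w d r b' t'" "proj_lattice (w + axis b t) = proj_lattice (w + axis b' t')"
    by (rule rhombus_lift_edge[OF y w(1,2) \<open>r \<noteq> 0\<close>])
  have t': "t' \<in> {1, -1}" using *(1) by (simp add: sq_def)
  have eq: "proj_lattice (axis b t) = proj_lattice (axis b' t')" using *(2) by (simp add: proj_lattice_add)
  have "b = b'"
  proof (rule ccontr)
    assume "b \<noteq> b'"
    from pe_distinct[OF this] eq t t' show False by (auto simp: proj_lattice_axis)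
  qed
  moreover have "t = t'"
    using eq t t' pe_nonzero[of b] pe_nonzero[of b, symmetric] calculation by (auto simp: proj_lattice_axis)
  ultimately show "sq w d r b t" using *(1) by simp
qed

lemma sq_height:
  assumes "slab w" "slab (w + axis d r)" "r \<in> {1, -1}" "d \<noteq> b" "d \<noteq> c" "b \<noteq> c"
  defines "h \<equiv> (if r = 1 then hgt w else hgt w - wt d)"
  shows "sq w d r b 1 \<longleftrightarrow> h < wt c" "sq w d r b (-1) \<longleftrightarrow> wt b \<le> h"
  using assms wt_sum[OF assms(4-6)] wt_pos[of b] wt_pos[of c] wt_pos[of d]
  by (auto simp: sq_def slab_def hgt_add hgt_axis_scaled h_def)

text \<open>
  Up to sign, the self-intersection number of the divisor of the ray from z to a on the toric surface
  whose fan consists of the edge directions at z. By the next lemma the choice of b is immaterial.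
\<close>
definition selfint :: "point \<Rightarrow> point \<Rightarrow> 'k::field" where
  "selfint z a = (let b = (SOME b. b \<noteq> axis_of z a) in ind (spans z a (z + pe b)) - ind (spans z a (z - pe b)))"

text \<open>Let h be the height of the lower end of the edge. For the two axes \<open>b\<close>,
  \<open>c\<close> across the edge the values are [h < wt c] - [wt b <= h] and [h < wt b] -
  [wt c <= h]; they agree because [h < t] + [t <= h] = 1 for every t.\<close>

lemma selfint_eq:
  assumes "edge z a" "b \<noteq> axis_of z a"
  shows "ind (spans z a (z + pe b)) - ind (spans z a (z - pe b)) = (selfint z a :: 'k::field)"
proof -
  from assms(1) obtain w d r where w: "r \<in> {1, -1}" "slab w" "slab (w + axis d r)"
     "z = proj_lattice w" "a = proj_lattice (w + axis d r)"
    unfolding edge_iff by blast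
  have "a - z \<in> {pe d, - pe d}" using w by (auto simp: proj_lattice_add proj_lattice_axis)
  then have d: "axis_of z a = d" by (rule axis_of_eq)
  let ?h = "if r = 1 then hgt w else hgt w - wt d"
  have val: "ind (spans z a (z + pe b)) - ind (spans z a (z - pe b)) = (ind (?h < wt c) - ind (wt b \<le> ?h) :: 'k)"
    if "d \<noteq> b" "d \<noteq> c" "b \<noteq> c" for b c
  proof -
    have "z + pe b = proj_lattice (w + axis b 1)" "z - pe b = proj_lattice (w + axis b (-1))"
      by (simp_all add: w proj_lattice_add proj_lattice_axis)
    then show ?thesis
      using spans_sq_iff[OF w(2,3,1) that(1)[symmetric]] sq_height[OF w(2,3,1) that] w(4,5) by simp
  qed
  have indep: "ind (spans z a (z + pe b)) - ind (spans z a (z - pe b)) = (ind (spans z a (z + pe c)) - ind (spans z a (z - pe c)) :: 'k)"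
    if "b \<noteq> d" "c \<noteq> d" for b c
  proof (cases "b = c")
    case False
    have "ind (?h < wt c) - ind (wt b \<le> ?h) = (ind (?h < wt b) - ind (wt c \<le> ?h) :: 'k)"
      by (auto simp: ind_def)
    with val[of b c] val[of c b] that False show ?thesis by simp
  qed simp
  define b' where "b' = (SOME b. b \<noteq> axis_of z a)"
  have "b' \<noteq> axis_of z a" unfolding b'_def by (rule someI[of _ b]) (rule assms(2))
  then show ?thesis
    unfolding selfint_def Let_def b'_def[symmetric] using indep[of b b'] assms(2) by (simp add: d)
qed

text \<open>A path of two edges between opposite corners lifts to a sum of two signed unit vectors.
  As the directions of the rhombus are different, the sum determines its summands up to
  order.\<close>

lemma closing:
  assumes "rhombus z a b v" "edge b w" "edge w z"
  shows "w \<in> {a, v}"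
proof -
  from assms(1) obtain p d r e t where p: "sq p d r e t" "z = proj_lattice p" "a = proj_lattice (p + axis d r)"
     "b = proj_lattice (p + axis d r + axis e t)" "v = proj_lattice (p + axis e t)"
    unfolding rhombus_corners_iff by blast
  from edge_sym[OF assms(3)] obtain p1 i q where 1: "q \<in> {1, -1}" "slab p1" "slab (p1 + axis i q)"
    "z = proj_lattice p1" "w = proj_lattice (p1 + axis i q)" unfolding edge_iff by blast
  from edge_sym[OF assms(2)] obtain p2 j q' where 2: "q' \<in> {1, -1}" "slab p2" "slab (p2 + axis j q')"
    "w = proj_lattice p2" "b = proj_lattice (p2 + axis j q')" unfolding edge_iff by blast
  have sl: "slab p" "slab (p + axis d r + axis e t)" using p(1) by (simp_all add: sq_def)
  have "p1 = p" using p(2) 1(2,4) sl proj_lattice_inj by metis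
  then have "p2 = p + axis i q" using 1(3,5) 2(2,4) proj_lattice_inj by metis
  then have "p + axis i q + axis j q' = p + axis d r + axis e t" using p(4) 2(3,5) sl(2) proj_lattice_inj by metis
  then have eq: "axis i q + axis j q' = axis d r + axis e t" by (simp add: add.assoc)
  have de: "d \<noteq> e" "r \<noteq> 0" "t \<noteq> 0" using p(1) by (auto simp: sq_def)
  have c: "(if x = i then q else 0) + (if x = j then q' else 0) = (if x = d then r else 0) + (if x = e then t else 0)" for x
    using arg_cong[OF eq, of "\<lambda>g. g $ x"] by (simp add: axis_def)
  have "i = d \<and> q = r \<or> i = e \<and> q = t"
    using c[of i] c[of d] c[of e] c[of j] de 1(1) 2(1) by (auto split: if_splits)
  then show ?thesis using 1(5) p(3,5) \<open>p1 = p\<close> by auto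
qed

section \<open>The trace and the three families of relations\<close>

context
  fixes s :: "3 \<Rightarrow> point \<Rightarrow> 'k::field"
  assumes sc: "sign_choice s"
begin

definition pairing :: "point \<Rightarrow> point \<Rightarrow> point \<Rightarrow> 'k" where
  "pairing z a c = ind (spans z a c) * (s (axis_of z a) z * s (axis_of z c) z)"

text \<open>The sign is the one with which the loop through \<open>a\<close> occurs in
  \<open>loop_diff\<close>.\<close>

definition signed_selfint :: "point \<Rightarrow> point \<Rightarrow> 'k" where
  "signed_selfint z a = (if a = z + pe (axis_of z a) then 1 else - 1) * selfint z a"

text \<open>
  A trace on closed paths of length four. On pairs of loops it is the intersection form of the
  toric surface of the fan at z, twisted by the signs.
\<close>
definition tr :: "point list \<Rightarrow> 'k" where
  "tr l = (case l of [z, a, b, c, z'] \<Rightarrow>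
     if z' \<noteq> z then 0
     else if b = z then (if a = c then signed_selfint z a else pairing z a c)
     else pairing z a (z + b - a) | _ \<Rightarrow> 0)"

text \<open>In the last case \<open>z + b - a\<close> is the fourth corner if z, a, b are corners of
  a rhombus. By \<open>closing\<close>, \<open>c\<close> is then \<open>a\<close> or this corner,
  and the rhombus relation demands the same value for both; hence the value does not depend on
  \<open>c\<close>.\<close>

lemma tr_5: "tr [z, a, b, c, z'] = (if z' \<noteq> z then 0
     else if b = z then (if a = c then signed_selfint z a else pairing z a c) else pairing z a (z + b - a))"
  by (simp add: tr_def)

lemma tr_length: "length l \<noteq> 5 \<Longrightarrow> tr l = 0"
  by (auto simp: tr_def split: list.splits)

lemma pairing_sym: "pairing z a c = pairing z c a"
  using spans_sym[of z a c] spans_sym[of z c a] by (auto simp: pairing_def ind_def mult.commute)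

lemma pairing_zero: "\<not> spans z a c \<Longrightarrow> pairing z a c = 0"
  by (simp add: pairing_def ind_def)

lemma sgn_sq: "vertex z \<Longrightarrow> s a z * s a z = 1"
proof -
  assume "vertex z"
  then have "s a z \<in> {1, -1}" using sc unfolding sign_choice_def by blast
  then show ?thesis by auto
qed

text \<open>The positions of a relation of length two within a path of length four: at the start, in
  the middle, at the end.\<close>

lemma path_contexts:
  assumes "p \<in> quiver_paths" "q \<in> quiver_paths"
  obtains "length p + length q \<noteq> 4"
    | x w c x' where "p = [x]" "q = [w, c, x']" "edge w c" "edge c x'"
    | x0 x w x0' where "p = [x0, x]" "q = [w, x0']" "edge x0 x" "edge w x0'"
    | x0 x1 x w where "p = [x0, x1, x]" "q = [w]" "edge x0 x1" "edge x1 x"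
proof (cases "length p + length q = 4")
  case True
  have ne: "p \<noteq> []" "q \<noteq> []" and ed: "successively edge p" "successively edge q"
    using assms by (auto simp: quiver_paths_def)
  from ne have "length p > 0" "length q > 0" by auto
  then consider "length p = 1" "length q = 3" | "length p = 2" "length q = 2" | "length p = 3" "length q = 1"
    using True by linarith
  then show thesis
  proof cases
    case 1
    then obtain x w c x' where "p = [x]" "q = [w, c, x']"
      by (auto simp: length_Suc_conv numeral_3_eq_3)
    with ed that(2) show thesis by simp
  next
    case 2
    then obtain x x0 w x0' where "p = [x0, x]" "q = [w, x0']"
      by (auto simp: length_Suc_conv numeral_2_eq_2)
    with ed that(3) show thesis by simp
  next
    case 3
    then obtain x0 x1 x w where "p = [x0, x1, x]" "q = [w]"
      by (auto simp: length_Suc_conv numeral_3_eq_3)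
    with ed that(4) show thesis by simp
  qed
qed (rule that(1))

text \<open>A closed path with nonzero trace stays in one rhombus, or repeats one edge back and
  forth, or consists of two loops along adjacent sides of a rhombus. In each case every turn with
  different ends follows two sides of a rhombus.\<close>

lemma tr_zero_relation:
  assumes pq: "p \<in> quiver_paths" "q \<in> quiver_paths"
    and e: "edge (last p) u" "edge u (hd q)" "last p \<noteq> hd q" and no: "\<And>v. \<not> rhombus (last p) u (hd q) v"
  shows "tr (p @ u # q) = 0"
  using pq
proof (cases rule: path_contexts)
  case 1
  then show ?thesis by (intro tr_length) simp
next
  case (2 x w c x')
  have "\<not> spans x u (x + w - u)"
  proof
    assume "spans x u (x + w - u)"
    then obtain y where y: "rhombus x u y (x + w - u)" by (auto simp: spans_def)
    have "y = w" using rhombus_parallelogram[OF y] by simp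
    with y no[of "x + w - u"] 2 show False by simp
  qed
  then show ?thesis using 2 e(3) by (simp add: tr_5 pairing_zero)
next
  case (3 x0 x w x0')
  have e': "edge u w" "x \<noteq> w" and no': "\<And>v. \<not> rhombus x u w v" using e no 3 by simp_all
  show ?thesis
  proof (cases "x0' = x0")
    case True
    have "\<not> spans x0 x w" if "u = x0"
    proof
      assume "spans x0 x w"
      then obtain y where y: "rhombus x0 x y w" by (auto simp: spans_def)
      have "rhombus x x0 w y" using rhombus_flip[OF rhombus_rotate[OF y]] rhombus_rotate rhombus_flip y by blast
      with no' that show False by blast
    qed
    moreover have "\<not> spans x0 x (x0 + u - x)" if "u \<noteq> x0"
    proof
      assume "spans x0 x (x0 + u - x)"
      then obtain y where y: "rhombus x0 x y (x0 + u - x)" by (auto simp: spans_def)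
      have "y = u" using rhombus_parallelogram[OF y] by simp
      with y have r: "rhombus x0 x u (x0 + u - x)" by simp
      have "w = x0 + u - x" using closing[OF r e'(1)] 3(4) True e'(2) by auto
      with r have "rhombus x0 x u w" by simp
      then have "rhombus x u w x0" by (rule rhombus_rotate)
      with no' show False by blast
    qed
    ultimately show ?thesis using 3 True e'(2) by (simp add: tr_5 pairing_zero)
  qed (simp add: 3 tr_5)
next
  case (4 x0 x1 x w)
  have e': "edge x u" "edge u w" "x \<noteq> w" and no': "\<And>v. \<not> rhombus x u w v" using e no 4 by simp_all
  show ?thesis
  proof (cases "w = x0")
    case True
    have "\<not> spans x0 x1 (x0 + x - x1)"
    proof
      assume "spans x0 x1 (x0 + x - x1)"
      then obtain y where y: "rhombus x0 x1 y (x0 + x - x1)" by (auto simp: spans_def)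
      have "y = x" using rhombus_parallelogram[OF y] by simp
      with y have r: "rhombus x0 x1 x (x0 + x - x1)" by simp
      have r': "rhombus x x1 x0 (x0 + x - x1)" "rhombus x (x0 + x - x1) x0 x1"
        using rhombus_opposite[OF r] rhombus_flip[OF rhombus_opposite[OF r]] by simp_all
      have "u = x1 \<or> u = x0 + x - x1" using closing[OF r e'(1)] e'(2) True by auto
      with r' True no' show False by metis
    qed
    then show ?thesis using 4 True e'(3) by (simp add: tr_5 pairing_zero)
  qed (simp add: 4 tr_5)
qed

text \<open>At the start this is symmetry of the pairing, and at the end the replaced vertex does
  not enter the value. In the middle, exchanging the base point \<open>x0\<close> for the opposite
  corner compares two loops with a path around their rhombus, and here the two cases of
  \<open>tr\<close> have to agree; otherwise both sides vanish by \<open>closing\<close>.\<close>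

lemma tr_rhombus_relation:
  assumes pq: "p \<in> quiver_paths" "q \<in> quiver_paths" and rhomb: "rhombus (last p) u (hd q) v"
  shows "tr (p @ u # q) = tr (p @ v # q)"
  using pq
proof (cases rule: path_contexts)
  case 1
  then show ?thesis by (simp add: tr_length)
next
  case (2 x w c x')
  then have rh': "rhombus x u w v" using rhomb by simp
  have "x \<noteq> w" using rhombus_distinct[OF rh'] by simp
  moreover have "x + w - u = v" "x + w - v = u" using rhombus_parallelogram[OF rh'] by simp_all
  ultimately show ?thesis using 2 pairing_sym[of x u v] by (simp add: tr_5)
next
  case (3 x0 x w x0')
  have rh': "rhombus x u w v" using rhomb 3 by simp
  have dist: "x \<noteq> w" "u \<noteq> v" using rhombus_distinct[OF rh'] by simp_all
  have aux: "tr [x0, x, x0, w, x0] = tr [x0, x, v', w, x0]" if "rhombus x x0 w v'" for v'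
  proof -
    have "v' \<noteq> x0" using rhombus_distinct[OF that] by simp
    moreover have "x0 + v' - x = w" using rhombus_parallelogram[OF that] by simp
    ultimately show ?thesis using dist by (simp add: tr_5)
  qed
  have zero: "tr [x0, x, u', w, x0] = 0" if "rhombus x u' w v'" "u' \<noteq> x0" "v' \<noteq> x0" "edge w x0" for u' v'
  proof -
    have "\<not> spans x0 x (x0 + u' - x)"
    proof
      assume "spans x0 x (x0 + u' - x)"
      then obtain y where y: "rhombus x0 x y (x0 + u' - x)" by (auto simp: spans_def)
      have "y = u'" using rhombus_parallelogram[OF y] by simp
      with y have r: "rhombus x0 x u' (x0 + u' - x)" by simp
      from closing[OF r rhombus_edge(2)[OF that(1)] that(4)] dist have "w = x0 + u' - x" by auto
      then have "v' = x0" using rhombus_parallelogram[OF that(1)] by (simp add: algebra_simps)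
      with that show False by simp
    qed
    then show ?thesis using that(2) by (simp add: tr_5 pairing_zero)
  qed
  have "tr [x0, x, u, w, x0'] = tr [x0, x, v, w, x0']"
  proof (cases "x0' = x0")
    case True
    then have ed: "edge w x0" using 3(4) by simp
    consider "u = x0" | "v = x0" | "u \<noteq> x0" "v \<noteq> x0" by blast
    then show ?thesis
    proof cases
      case 1
      then show ?thesis using aux[of v] rh' True by simp
    next
      case 2
      then show ?thesis using aux[of u] rhombus_flip[OF rh'] True by simp
    next
      case 3
      then show ?thesis using zero[OF rh' 3 ed] zero[OF rhombus_flip[OF rh'] 3(2,1) ed] True by simp
    qed
  qed (simp add: tr_5)
  with 3 show ?thesis by simp
next
  case (4 x0 x1 x w)
  then have "x \<noteq> w" using rhombus_distinct[OF rhomb] by simp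
  then show ?thesis using 4 by (auto simp: tr_5)
qed

text \<open>The trace of the signed difference of loops at \<open>x\<close> along axis
  \<open>a\<close>, placed between \<open>p\<close> and \<open>q\<close>. The third family of
  relations asks for independence of \<open>a\<close>.\<close>

definition loops :: "point list \<Rightarrow> point \<Rightarrow> point list \<Rightarrow> 3 \<Rightarrow> 'k" where
  "loops p x q a = s a x * ((if edge x (x + pe a) then tr (p @ (x + pe a) # q) else 0)
      - (if edge x (x - pe a) then tr (p @ (x - pe a) # q) else 0))"

lemma pe_pm: "z + pe a \<noteq> z - pe a" "z - pe a \<noteq> z + pe a" "z + pe a \<noteq> z" "z - pe a \<noteq> z"
proof -
  show *: "z + pe a \<noteq> z - pe a" by (rule pe_opposite)
  then show "z - pe a \<noteq> z + pe a" by metis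
  have "pe a \<noteq> 0" using pe_nonzero[of a] by auto
  then show "z + pe a \<noteq> z" "z - pe a \<noteq> z" by simp_all
qed

text \<open>Linear equivalence tested against the divisor of the ray to \<open>c\<close>. Along the
  axis of \<open>c\<close> only the loop through \<open>c\<close> counts, since opposite rays bound
  no cone. Along another axis the two factors \<open>s a x\<close> cancel and the difference of
  incidences is the self-intersection by \<open>selfint_eq\<close>.\<close>

lemma loops_outer:
  assumes e: "edge x c"
    and val: "\<And>w. edge x w \<Longrightarrow> tr (p @ w # q) = (if w = c then signed_selfint x c else pairing x w c)"
  shows "loops p x q a = s (axis_of x c) x * selfint x c"
proof -
  define d where "d = axis_of x c"
  have vx: "vertex x" using edge_vertex[OF e] by simp
  have same: "pairing x w c = 0" if "axis_of x w = d" for w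
    using spans_axis[of x w c] that by (intro pairing_zero) (auto simp: d_def)
  obtain d' where d': "c = x + pe d' \<or> c = x - pe d'" using edge_axis[OF e] by blast
  then have "d' = d" by (auto simp: d_def)
  with d' have cd: "c = x + pe d \<or> c = x - pe d" by simp
  show ?thesis
  proof (cases "a = d")
    case True
    from cd show ?thesis
    proof
      assume c: "c = x + pe d"
      then show ?thesis using e val same[of "x - pe d"] pe_pm[of x d]
        by (simp add: loops_def True signed_selfint_def d_def[symmetric])
    next
      assume c: "c = x - pe d"
      then show ?thesis using e val same[of "x + pe d"] pe_pm[of x d]
        by (simp add: loops_def True signed_selfint_def d_def[symmetric])
    qed
  next
    case False
    have ne: "x + pe a \<noteq> c" "x - pe a \<noteq> c"
    proof -
      have "axis_of x (x + pe a) \<noteq> axis_of x c" "axis_of x (x - pe a) \<noteq> axis_of x c"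
        using False by (simp_all add: d_def)
      then show "x + pe a \<noteq> c" "x - pe a \<noteq> c" by metis+
    qed
    have v: "(if edge x w then tr (p @ w # q) else 0) = ind (spans x c w) * (s a x * s d x)"
      if "w \<noteq> c" "axis_of x w = a" for w
    proof (cases "edge x w")
      case True
      have "spans x w c = spans x c w" using spans_sym by blast
      then show ?thesis using True val[OF True] that by (simp add: pairing_def d_def)
    next
      case False
      then have "\<not> spans x c w" using spans_edge by blast
      then show ?thesis using False by (simp add: ind_def)
    qed
    have "loops p x q a = s a x * (ind (spans x c (x + pe a)) * (s a x * s d x) - ind (spans x c (x - pe a)) * (s a x * s d x))"
      unfolding loops_def using v[OF ne(1)] v[OF ne(2)] by simp
    also have "\<dots> = (s a x * s a x) * s d x * (ind (spans x c (x + pe a)) - ind (spans x c (x - pe a)))"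
      by (simp add: algebra_simps)
    also have "ind (spans x c (x + pe a)) - ind (spans x c (x - pe a)) = (selfint x c :: 'k)"
      by (rule selfint_eq[OF e]) (use False in \<open>simp add: d_def\<close>)
    also have "s a x * s a x * s d x * selfint x c = s d x * selfint x c"
      by (simp add: sgn_sq[OF vx])
    finally show ?thesis by (simp add: d_def)
  qed
qed

text \<open>The path is x0, x, w, x, x0: the relation sits at \<open>x\<close>, but the value is
  taken in the fan at \<open>x0\<close>. Translation along the edge matches the rays across it. The
  ray from \<open>x\<close> to \<open>x0\<close> is opposite to the one from \<open>x0\<close> to
  \<open>x\<close>, which is compensated by the sign change of \<open>s\<close> along the edge, on
  the axis of the edge only.\<close>

lemma loops_inner:
  assumes e: "edge x0 x"
    and val: "\<And>w. edge x w \<Longrightarrow> tr (p @ w # q) = (if w = x0 then signed_selfint x0 x else pairing x0 x (x0 + w - x))"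
  shows "loops p x q a = s (axis_of x0 x) x0 * selfint x0 x"
proof -
  define d where "d = axis_of x0 x"
  have vx: "vertex x0" "vertex x" using edge_vertex[OF e] by simp_all
  have same: "pairing x0 x w = 0" if "axis_of x0 w = d" for w
    using spans_axis[of x0 x w] that by (intro pairing_zero) (auto simp: d_def)
  obtain d' where d': "x = x0 + pe d' \<or> x = x0 - pe d'" using edge_axis[OF e] by blast
  then have "d' = d" by (auto simp: d_def)
  with d' have cd: "x = x0 + pe d \<or> x = x0 - pe d" by simp
  have "x - x0 \<in> {pe d, - pe d}" using cd by auto
  then have sgn: "s d x = - s d x0" "\<And>b. b \<noteq> d \<Longrightarrow> s b x = s b x0"
    using sc e unfolding sign_choice_def by blast+
  show ?thesis
  proof (cases "a = d")
    case True
    from cd show ?thesis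
    proof
      assume c: "x = x0 + pe d"
      then have "x - pe d = x0" "x0 + (x + pe d) - x = x0 + pe d" "x + pe d \<noteq> x0"
        using pe_pm(1)[of x d] by auto
      then show ?thesis using val[of "x0"] val[of "x + pe d"] edge_sym[OF e] same[of "x0 + pe d"] sgn(1)
        by (simp add: loops_def True signed_selfint_def d_def[symmetric] c[symmetric])
    next
      assume c: "x = x0 - pe d"
      then have f: "x + pe d = x0" "x0 + (x - pe d) - x = x0 - pe d" "x - pe d \<noteq> x0"
        using pe_pm(2)[of x d] by auto
      have "x \<noteq> x0 + pe d" using c pe_pm[of x0 d] by simp
      then show ?thesis using f val[of "x0"] val[of "x - pe d"] edge_sym[OF e] same[of "x0 - pe d"] sgn(1)
        by (simp add: loops_def True signed_selfint_def d_def[symmetric])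
    qed
  next
    case False
    have v: "(if edge x (x + g) then tr (p @ (x + g) # q) else 0) = ind (spans x0 x (x0 + g)) * (s d x0 * s a x0)"
      if "g \<in> {pe a, - pe a}" for g
    proof -
      have ax: "axis_of x0 (x0 + g) = a" using that by (intro axis_of_eq) simp
      have "x + g \<noteq> x0"
      proof
        assume "x + g = x0"
        then have "x - x0 = - g" by (auto simp: algebra_simps)
        then have "x - x0 \<in> {pe a, - pe a}" using that by auto
        then have "axis_of x0 x = a" by (rule axis_of_eq)
        with False show False by (simp add: d_def)
      qed
      show ?thesis
      proof (cases "edge x (x + g)")
        case True
        then show ?thesis using val[OF True] \<open>x + g \<noteq> x0\<close> ax by (simp add: pairing_def d_def)
      next
        case ne: False
        have "\<not> spans x0 x (x0 + g)"
        proof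
          assume "spans x0 x (x0 + g)"
          then obtain y where y: "rhombus x0 x y (x0 + g)" by (auto simp: spans_def)
          have "y = x + g" using rhombus_parallelogram[OF y] by simp
          with rhombus_edge(2)[OF y] ne show False by simp
        qed
        then show ?thesis using ne by (simp add: ind_def)
      qed
    qed
    have "loops p x q a = s a x * (ind (spans x0 x (x0 + pe a)) * (s d x0 * s a x0) - ind (spans x0 x (x0 - pe a)) * (s d x0 * s a x0))"
      unfolding loops_def using v[of "pe a"] v[of "- pe a", unfolded add_uminus_conv_diff] by simp
    also have "\<dots> = (s a x0 * s a x0) * s d x0 * (ind (spans x0 x (x0 + pe a)) - ind (spans x0 x (x0 - pe a)))"
      using sgn(2)[OF False] by (simp add: algebra_simps)
    also have "ind (spans x0 x (x0 + pe a)) - ind (spans x0 x (x0 - pe a)) = (selfint x0 x :: 'k)"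
      by (rule selfint_eq[OF e]) (use False in \<open>simp add: d_def\<close>)
    also have "s a x0 * s a x0 * s d x0 * selfint x0 x = s d x0 * selfint x0 x"
      by (simp add: sgn_sq[OF vx(1)])
    finally show ?thesis by (simp add: d_def)
  qed
qed

lemma loops_indep:
  assumes pq: "p \<in> quiver_paths" "q \<in> quiver_paths" "last p = x" "hd q = x"
  shows "loops p x q a = loops p x q c"
  using pq(1,2)
proof (cases rule: path_contexts)
  case 1
  then show ?thesis by (simp add: loops_def tr_length)
next
  case (2 x2 w2 c' x')
  have pq': "p @ w # q = [x, w, x, c', x']" for w using 2(1,2) pq(3,4) by simp
  show ?thesis
  proof (cases "x' = x")
    case True
    have "edge x c'" using 2 pq by simp
    from loops_outer[OF this, of p q] show ?thesis by (simp add: pq' tr_5 True)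
  qed (simp add: loops_def pq' tr_5)
next
  case (3 x0 x2 w2 x0')
  have pq': "p @ w # q = [x0, x, w, x, x0']" for w using 3(1,2) pq(3,4) by simp
  show ?thesis
  proof (cases "x0' = x0")
    case True
    have "edge x0 x" using 3 pq by simp
    from loops_inner[OF this, of p q] show ?thesis by (simp add: pq' tr_5 True)
  qed (simp add: loops_def pq' tr_5)
next
  case (4 x0 x1 x2 w2)
  have pq': "p @ w # q = [x0, x1, x, w, x]" for w using 4(1,2) pq(3,4) by simp
  show ?thesis
  proof (cases "x = x0")
    case True
    have "edge x x1" using 4 True by simp
    from loops_outer[OF this, of p q] show ?thesis
      using pairing_sym[of x _ x1] by (simp add: pq' tr_5 True[symmetric] eq_commute[of x1])
  qed (simp add: loops_def pq' tr_5)
qed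

section \<open>Linear extension and vanishing on the ideal\<close>

definition trace :: "'k path_comb \<Rightarrow> 'k" where
  "trace f = (\<Sum>l\<in>Poly_Mapping.keys f. lkp f l * tr l)"

lemma trace_superset: "finite K \<Longrightarrow> Poly_Mapping.keys f \<subseteq> K \<Longrightarrow> trace f = (\<Sum>l\<in>K. lkp f l * tr l)"
  unfolding trace_def by (intro sum.mono_neutral_left) (auto simp: in_keys_iff)

lemma trace_zero: "trace 0 = 0" by (simp add: trace_def)

lemma trace_add: "trace (f + g) = trace f + trace g"
proof -
  let ?K = "Poly_Mapping.keys f \<union> Poly_Mapping.keys g"
  have "Poly_Mapping.keys (f + g) \<subseteq> ?K" by (rule Poly_Mapping.keys_add)
  then show ?thesis
    by (subst (1 2 3) trace_superset[of ?K]) (auto simp: lookup_add distrib_right sum.distrib)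
qed

lemma trace_minus: "trace (- f) = - trace f"
  using trace_add[of f "- f"] by (simp add: trace_zero eq_neg_iff_add_eq_0 add.commute)

lemma trace_single: "trace (sgl l c) = c * tr l"
  by (subst trace_superset[of "{l}"]) auto

text \<open>The trace with a context on each side. The condition that it vanishes for all contexts
  is stable under multiplication from both sides, unlike vanishing of the trace alone.\<close>

definition theta :: "point list \<Rightarrow> 'k \<Rightarrow> point list \<Rightarrow> 'k \<Rightarrow> 'k path_comb \<Rightarrow> 'k" where
  "theta p c q d f = trace (path_mult (path_mult (sgl p c) f) (sgl q d))"

lemma theta_add: "theta p c q d (f + g) = theta p c q d f + theta p c q d g"
  by (simp add: theta_def path_mult_add_left path_mult_add_right trace_add)

lemma theta_minus: "theta p c q d (- f) = - theta p c q d f"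
  by (simp add: theta_def path_mult_minus trace_minus)

lemma theta_diff: "theta p c q d (f - g) = theta p c q d f - theta p c q d g"
  using theta_add[of p c q d f "- g"] by (simp add: theta_minus)

lemma theta_zero: "theta p c q d 0 = 0"
  by (simp add: theta_def trace_zero)

lemma theta_single:
  assumes "p \<noteq> []" "q \<noteq> []"
  shows "theta p c q d (sgl [x, u, w] k) = (if last p = x \<and> hd q = w then c * k * d * tr (p @ u # q) else 0)"
proof -
  have "hd q = w \<Longrightarrow> w # tl q = q" using assms(2) by (cases q) auto
  then show ?thesis
    using assms by (auto simp: theta_def path_mult_single trace_single trace_zero)
qed

lemma theta_loop:
  assumes "p \<in> quiver_paths" "q \<in> quiver_paths"
  shows "theta p c q d (Poly_Mapping.map ((*) (s a x)) (loop_diff a x)) =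
    (if last p = x \<and> hd q = x then c * d * loops p x q a else 0)"
proof -
  have m: "Poly_Mapping.map ((*) (s a x)) (loop_at x w) = (if edge x w then sgl [x, w, x] (s a x) else 0)" for w
    by (rule poly_mapping_eqI) (simp add: lookup_map_times loop_at_def lookup_single when_def)
  have md: "Poly_Mapping.map ((*) (s a x)) (loop_diff a x) = Poly_Mapping.map ((*) (s a x)) (loop_at x (x + pe a))
     - Poly_Mapping.map ((*) (s a x)) (loop_at x (x - pe a))"
    by (rule poly_mapping_eqI) (simp add: lookup_map_times loop_diff_def lookup_minus right_diff_distrib)
  have "p \<noteq> []" "q \<noteq> []" using assms by (auto simp: quiver_paths_def)
  then show ?thesis
    unfolding md theta_diff m by (simp add: theta_single theta_zero loops_def algebra_simps)
qed

lemma theta_relation: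
  assumes pq: "p \<in> quiver_paths" "q \<in> quiver_paths" and f: "f \<in> rauzy_relations s"
  shows "theta p c q d f = 0"
proof -
  have ne: "p \<noteq> []" "q \<noteq> []" using assms by (auto simp: quiver_paths_def)
  from f consider x u w where "f = sgl [x, u, w] 1" "edge x u" "edge u w" "x \<noteq> w" "\<not> (\<exists>v. rhombus x u w v)"
    | z u y v where "f = sgl [z, u, y] 1 - sgl [z, v, y] 1" "rhombus z u y v"
    | a b z where "f = Poly_Mapping.map ((*) (s a z)) (loop_diff a z) - Poly_Mapping.map ((*) (s b z)) (loop_diff b z)"
    unfolding rauzy_relations_def by blast
  then show ?thesis
  proof cases
    case 1
    then show ?thesis using tr_zero_relation[OF pq, of u] ne by (auto simp: theta_single)
  next
    case 2
    then show ?thesis using tr_rhombus_relation[OF pq, of u v] ne by (auto simp: theta_diff theta_single)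
  next
    case 3
    then show ?thesis using loops_indep[OF pq, of z a b] by (auto simp: theta_diff theta_loop[OF pq])
  qed
qed

text \<open>Multiplication by a path is absorbed into a context, so the common kernel of all
  \<open>theta\<close> is an ideal; it contains the relations by
  \<open>theta_relation\<close>.\<close>

lemma theta_ideal:
  assumes f: "f \<in> rauzy_ideal s" and pq: "p \<in> quiver_paths" "q \<in> quiver_paths"
  shows "theta p c q d f = 0"
proof -
  let ?J = "{f. f \<in> pcar \<and> (\<forall>p\<in>quiver_paths. \<forall>q\<in>quiver_paths. \<forall>c d. theta p c q d f = 0)}"
  have left: "theta p c q d (path_mult g f) = 0"
    if g: "g \<in> pcar" and f: "f \<in> ?J" and pq: "p \<in> quiver_paths" "q \<in> quiver_paths" for g f p q c d
    using g
  proof (induction rule: pcar_induct)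
    case (single r e)
    have "theta p c q d (path_mult (sgl r e) f)
      = trace (path_mult (path_mult (path_mult (sgl p c) (sgl r e)) f) (sgl q d))"
      using f pq single by (simp add: theta_def path_mult_assoc pcar_closed)
    also have "\<dots> = (if last p = hd r then theta (p @ tl r) (c * e) q d f else 0)"
      by (simp add: theta_def path_mult_single trace_zero)
    finally show ?case using f pq quiver_paths_append[OF pq(1) single] by simp
  qed (simp_all add: theta_zero theta_add path_mult_add_left)
  have right: "theta p c q d (path_mult f g) = 0"
    if g: "g \<in> pcar" and f: "f \<in> ?J" and pq: "p \<in> quiver_paths" "q \<in> quiver_paths" for g f p q c d
    using g
  proof (induction rule: pcar_induct)
    case (single r e)
    have "theta p c q d (path_mult f (sgl r e))
      = trace (path_mult (path_mult (sgl p c) f) (path_mult (sgl r e) (sgl q d)))"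
      using f pq single by (simp add: theta_def path_mult_assoc path_mult_closed pcar_closed)
    also have "\<dots> = (if last r = hd q then theta p c (r @ tl q) (e * d) f else 0)"
      by (simp add: theta_def path_mult_single trace_zero)
    finally show ?case using f pq quiver_paths_append[OF single pq(2)] by simp
  qed (simp_all add: theta_zero theta_add path_mult_add_right)
  have "is_rel_ideal s ?J"
    unfolding is_rel_ideal_def
  proof (intro conjI ballI)
    show "rauzy_relations s \<subseteq> ?J"
    proof
      fix f assume f: "f \<in> rauzy_relations s"
      have "f \<in> pcar" by (rule subsetD[OF rauzy_relations_pcar f])
      then show "f \<in> ?J" using theta_relation[OF _ _ f] by simp
    qed
  next
    fix f g :: "'k path_comb" assume f: "f \<in> pcar" and g: "g \<in> ?J"
    then show "path_mult f g \<in> ?J" "path_mult g f \<in> ?J"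
      using left[OF f g] right[OF f g] by (simp_all add: path_mult_closed)
  qed (auto simp: pcar_closed theta_zero theta_add theta_minus)
  from rauzy_ideal_least[OF this] f pq show ?thesis by auto
qed

text \<open>The trace of this path is the pairing of the adjacent rays from \<open>y\<close> to
  \<open>u\<close> and \<open>v\<close>, a product of two signs.\<close>

theorem rhombus_loop_nonzero:
  assumes "rhombus z u y v" shows "sgl [y, u, z, u, y] 1 \<notin> rauzy_ideal s"
proof
  assume *: "sgl [y, u, z, u, y] 1 \<in> rauzy_ideal s"
  note E = rhombus_edge[OF assms]
  have q: "[y] \<in> quiver_paths" using E edge_path(3) by blast
  have "theta [y] 1 [y] 1 (sgl [y, u, z, u, y] 1) = tr [y, u, z, u, y]"
    by (simp add: theta_def path_mult_single trace_single)
  moreover have "z \<noteq> y" using rhombus_distinct[OF assms] by simp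
  then have "tr [y, u, z, u, y] = pairing y u (y + z - u)" by (simp add: tr_5)
  moreover have "y + z - u = v" by (simp add: rhombus_parallelogram[OF assms])
  moreover have "spans y u v" unfolding spans_def using rhombus_opposite[OF assms] by blast
  ultimately have "s (axis_of y u) y * s (axis_of y v) y = 0"
    using theta_ideal[OF * q q, of 1 1] by (simp add: pairing_def ind_def)
  moreover have "s a y \<noteq> 0" for a using sgn_sq[OF E(11), of a] by auto
  ultimately show False by simp
qed

end

section \<open>The module generated by the pair of arrows\<close>

text \<open>Stated for all larger finite sets, so that the sets found for two summands can be
  united.\<close>

lemma local_unit:
  fixes f :: "'k::field path_comb"
  assumes "f \<in> pcar"
  shows "\<exists>W. finite W \<and> W \<subseteq> Collect vertex \<and>
    (\<forall>W'. finite W' \<longrightarrow> W \<subseteq> W' \<longrightarrow> path_mult f (\<Sum>v\<in>W'. sgl [v] 1) = f)"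
  using assms
proof (induction rule: pcar_induct)
  case zero
  show ?case by (intro exI[of _ "{}"]) simp
next
  case (single p c)
  have p: "p \<noteq> []" "vertex (last p)" using single by (auto simp: quiver_paths_def)
  have "path_mult (sgl p c) (\<Sum>v\<in>W'. sgl [v] 1) = (if last p \<in> W' then sgl p c else 0)" if "finite W'" for W'
    using that
  proof (induction W')
    case (insert v W')
    then show ?case by (auto simp: path_mult_add_right path_mult_single)
  qed simp
  then show ?case using p by (intro exI[of _ "{last p}"]) auto
next
  case (add f g)
  then obtain W1 W2 where W: "finite W1" "finite W2" "W1 \<subseteq> Collect vertex" "W2 \<subseteq> Collect vertex"
    "\<And>W'. finite W' \<Longrightarrow> W1 \<subseteq> W' \<Longrightarrow> path_mult f (\<Sum>v\<in>W'. sgl [v] 1) = f"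
    "\<And>W'. finite W' \<Longrightarrow> W2 \<subseteq> W' \<Longrightarrow> path_mult g (\<Sum>v\<in>W'. sgl [v] 1) = g"
    by metis
  then show ?case by (intro exI[of _ "W1 \<union> W2"]) (simp add: path_mult_add_left)
qed

section \<open>The regular module and its right ideals\<close>

lemma regular_simps:
  "carrier (regular_module A) = carrier A" "\<zero>\<^bsub>regular_module A\<^esub> = \<zero>\<^bsub>A\<^esub>"
  "a \<oplus>\<^bsub>regular_module A\<^esub> b = a \<oplus>\<^bsub>A\<^esub> b" "r \<odot>\<^bsub>regular_module A\<^esub> a = a \<otimes>\<^bsub>A\<^esub> r"
  by (simp_all add: regular_module_def)

lemma right_ideal_simps:
  "carrier (right_ideal A p) = {p \<otimes>\<^bsub>A\<^esub> a |a. a \<in> carrier A}" "\<zero>\<^bsub>right_ideal A p\<^esub> = \<zero>\<^bsub>A\<^esub>"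
  "a \<oplus>\<^bsub>right_ideal A p\<^esub> b = a \<oplus>\<^bsub>A\<^esub> b" "r \<odot>\<^bsub>right_ideal A p\<^esub> a = a \<otimes>\<^bsub>A\<^esub> r"
  by (simp_all add: right_ideal_def regular_module_def)

lemma regular_rng_module:
  fixes s :: "3 \<Rightarrow> point \<Rightarrow> 'k::field"
  shows "rng_module (rauzy_algebra s) (regular_module (rauzy_algebra s))"
proof -
  interpret A: abelian_group "rauzy_algebra s" by (rule abelian_group_rauzy_algebra)
  have closed: "a \<otimes>\<^bsub>rauzy_algebra s\<^esub> b \<in> carrier (rauzy_algebra s)"
    if "a \<in> carrier (rauzy_algebra s)" "b \<in> carrier (rauzy_algebra s)" for a b
    using that by (elim rauzy_algebra_cases) (simp add: rauzy_algebra_mult pcls_in_carrier path_mult_closed)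
  have "abelian_group (regular_module (rauzy_algebra s))"
  proof (rule abelian_groupI)
    fix x assume "x \<in> carrier (regular_module (rauzy_algebra s))"
    then show "\<exists>y\<in>carrier (regular_module (rauzy_algebra s)).
        y \<oplus>\<^bsub>regular_module (rauzy_algebra s)\<^esub> x = \<zero>\<^bsub>regular_module (rauzy_algebra s)\<^esub>"
      by (intro bexI[of _ "\<ominus>\<^bsub>rauzy_algebra s\<^esub> x"]) (simp_all add: regular_simps A.l_neg)
  qed (simp_all add: regular_simps A.a_ac)
  moreover have "\<exists>a\<in>carrier (rauzy_algebra s). a \<odot>\<^bsub>regular_module (rauzy_algebra s)\<^esub> m = m"
    if m: "m \<in> carrier (regular_module (rauzy_algebra s))" for m
  proof -
    have "m \<in> carrier (rauzy_algebra s)" using m by (simp add: regular_simps)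
    then obtain f where f: "f \<in> pcar" "m = pcls s f" by (rule rauzy_algebra_cases)
    from local_unit[OF f(1)] obtain W where W: "finite W" "W \<subseteq> Collect vertex" "path_mult f (\<Sum>v\<in>W. sgl [v] 1) = f"
      by blast
    have "(\<Sum>v\<in>W. sgl [v] 1) \<in> (pcar :: 'k path_comb set)"
      using W(1,2) by (induction W) (auto intro!: pcar_closed edge_path(3))
    with f W show ?thesis
      by (intro bexI[of _ "pcls s (\<Sum>v\<in>W. sgl [v] 1)"]) (simp_all add: regular_simps rauzy_algebra_mult pcls_in_carrier)
  qed
  ultimately have "right_module (rauzy_algebra s) (regular_module (rauzy_algebra s))"
    by (intro right_module.intro right_module_axioms.intro)
      (auto elim!: rauzy_algebra_cases simp: regular_simps closed rauzy_algebra_mult rauzy_algebra_add pcls_in_carrier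
        path_mult_closed pcar_closed path_mult_add_left path_mult_add_right path_mult_assoc)
  then show ?thesis
    by (intro rng_module.intro rng_module_axioms.intro A.abelian_group_axioms closed)
qed

lemma right_ideal_submodule:
  assumes "p \<in> carrier (rauzy_algebra s)"
  shows "submodule (carrier (right_ideal (rauzy_algebra s) p)) (rauzy_algebra s) (regular_module (rauzy_algebra s))"
proof -
  interpret R: rng_module "rauzy_algebra s" "regular_module (rauzy_algebra s)" by (rule regular_rng_module)
  show ?thesis using R.cyclic_submodule[of p] assms by (simp add: regular_simps right_ideal_simps)
qed

lemma right_ideal_rng_module:
  assumes "p \<in> carrier (rauzy_algebra s)"
  shows "rng_module (rauzy_algebra s) (right_ideal (rauzy_algebra s) p)"
proof -
  interpret R: rng_module "rauzy_algebra s" "regular_module (rauzy_algebra s)" by (rule regular_rng_module)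
  have "right_ideal (rauzy_algebra s) p = regular_module (rauzy_algebra s)\<lparr>carrier := carrier (right_ideal (rauzy_algebra s) p)\<rparr>"
    by (simp add: right_ideal_def)
  then show ?thesis using R.submodule_rng_module[OF right_ideal_submodule[OF assms]] by simp
qed

text \<open>The assumptions of \<open>rhombus_gen\<close>, expressed in the module itself modulo
  \<open>N\<close>. All three quotients of the filtration are instances, the lowest one with
  \<open>N\<close> zero.\<close>

lemma (in rauzy_mod) quotient_rhombus_gen:
  assumes N: "submodule N (rauzy_algebra s) M" and sc: "sign_choice s" and rh: "rhombus z u y v"
    and m: "m \<in> carrier M"
    and gen: "\<And>h. h \<in> carrier M \<Longrightarrow> \<exists>a\<in>carrier (rauzy_algebra s). \<exists>n\<in>N. h = n \<oplus> a \<odot> m"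
    and unit: "pact (sgl [y] 1) m = m"
    and kill: "\<And>w. edge y w \<Longrightarrow> w \<noteq> u \<Longrightarrow> w \<noteq> v \<Longrightarrow> pact (sgl [y, w] 1) m \<in> N"
    and nonzero: "pact (sgl [y, u, z] 1) m \<notin> N"
  shows "rhombus_gen s (quot_mod M N) z u y v (N +> m)"
proof -
  interpret Q: rng_module "rauzy_algebra s" "quot_mod M N" by (rule quot_rng_module[OF N])
  interpret Q: rauzy_mod s "quot_mod M N" ..
  note E = rhombus_edge[OF rh]
  have act: "Q.pact f (N +> m) = N +> pact f m" if "f \<in> pcar" for f
    using quot_act[OF N m pcls_in_carrier[OF that]] by (simp add: Q.pact_def pact_def)
  have pc: "sgl [y] 1 \<in> (pcar :: 'k path_comb set)" "sgl [y, u, z] 1 \<in> (pcar :: 'k path_comb set)"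
    by (intro pcar_closed edge_path E)+
  show ?thesis
  proof (unfold_locales)
    show "sign_choice s" "rhombus z u y v" by fact+
    show "N +> m \<in> carrier (quot_mod M N)" using m by (simp add: quot_carrier)
    show "carrier (quot_mod M N) = {a \<odot>\<^bsub>quot_mod M N\<^esub> (N +> m) |a. a \<in> carrier (rauzy_algebra s)}"
    proof (intro equalityI subsetI)
      fix X assume "X \<in> carrier (quot_mod M N)"
      then obtain h where h: "h \<in> carrier M" "X = N +> h" by (auto simp: quot_carrier)
      from gen[OF h(1)] obtain a k where a: "a \<in> carrier (rauzy_algebra s)" "k \<in> N" "h = k \<oplus> a \<odot> m" by blast
      have k: "k \<in> carrier M" using submoduleD(1)[OF N] a(2) by (rule subsetD)
      have am: "a \<odot> m \<in> carrier M" using act_closed a(1) m by simp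
      have "h \<ominus> a \<odot> m = k" using k am by (simp add: a(3) a_minus_def a_assoc r_neg)
      then have "X = N +> a \<odot> m" using coset_eq_iff[OF N h(1) am] a(2) h(2) by simp
      then show "X \<in> {a \<odot>\<^bsub>quot_mod M N\<^esub> (N +> m) |a. a \<in> carrier (rauzy_algebra s)}"
        using quot_act[OF N m a(1)] a(1) by auto
    next
      fix X assume "X \<in> {a \<odot>\<^bsub>quot_mod M N\<^esub> (N +> m) |a. a \<in> carrier (rauzy_algebra s)}"
      then show "X \<in> carrier (quot_mod M N)" using quot_act[OF N m] m act_closed by (auto simp: quot_carrier)
    qed
    show "Q.pact (sgl [y] 1) (N +> m) = N +> m" using act[OF pc(1)] unit by simp
    show "Q.pact (sgl [y, w] 1) (N +> m) = \<zero>\<^bsub>quot_mod M N\<^esub>" if "edge y w" "w \<noteq> u" "w \<noteq> v" for w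
    proof -
      have yw: "sgl [y, w] 1 \<in> (pcar :: 'k path_comb set)" by (intro pcar_closed edge_path that)
      show ?thesis
        using act[OF yw] coset_zero_iff[OF N pact_closed[OF yw m]] kill[OF that] by (simp add: quot_zero)
    qed
    show "Q.pact (sgl [y, u, z] 1) (N +> m) \<noteq> \<zero>\<^bsub>quot_mod M N\<^esub>"
      using act[OF pc(2)] coset_zero_iff[OF N pact_closed[OF pc(2) m]] nonzero by (simp add: quot_zero)
  qed
qed

text \<open>The point \<open>xn\<close> stands for the last neighbour. The bound on n survives as
  \<open>dist\<close>: the last neighbour differs from the second and the third, the first from the
  third.\<close>

locale local_config =
  fixes s :: "3 \<Rightarrow> point \<Rightarrow> 'k::field" and z x1 x2 x3 xn y1 y2 yn :: point
  assumes sc: "sign_choice s"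
    and r1: "rhombus z x1 y1 x2" and r2: "rhombus z x2 y2 x3" and rn: "rhombus z xn yn x1"
    and dist: "x1 \<noteq> x3" "xn \<noteq> x2" "xn \<noteq> x3"
begin

abbreviation "A \<equiv> rauzy_algebra s"
abbreviation "cl l \<equiv> pcls s (sgl l 1)"

lemma ne: "x1 \<noteq> x2" "x2 \<noteq> x3" "xn \<noteq> x1"
  using rhombus_distinct[OF r1] rhombus_distinct[OF r2] rhombus_distinct[OF rn] by simp_all

lemmas E1 = rhombus_edge[OF r1] and E2 = rhombus_edge[OF r2] and En = rhombus_edge[OF rn]

lemma pc [simp]:
  "sgl [x1, z] c \<in> (pcar :: 'k path_comb set)" "sgl [x2, z] c \<in> (pcar :: 'k path_comb set)"
  "sgl [x1] c \<in> (pcar :: 'k path_comb set)" "sgl [x2] c \<in> (pcar :: 'k path_comb set)"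
  "sgl [z] c \<in> (pcar :: 'k path_comb set)" "sgl [z, xn] c \<in> (pcar :: 'k path_comb set)"
  "sgl [z, x3] c \<in> (pcar :: 'k path_comb set)" "sgl [y1, x1] c \<in> (pcar :: 'k path_comb set)"
  "sgl [x1, z, xn] c \<in> (pcar :: 'k path_comb set)" "sgl [x2, z, x3] c \<in> (pcar :: 'k path_comb set)"
  "sgl [y1, x1, z] c \<in> (pcar :: 'k path_comb set)"
  "sgl [z, x1, y1] c \<in> (pcar :: 'k path_comb set)" "sgl [xn] c \<in> (pcar :: 'k path_comb set)"
  "sgl [x3] c \<in> (pcar :: 'k path_comb set)" "sgl [xn, z, x1] c \<in> (pcar :: 'k path_comb set)"
  "sgl [x3, z, x2] c \<in> (pcar :: 'k path_comb set)"
  by (intro pcar_closed(5), use E1 E2 En in \<open>simp add: quiver_paths_def\<close>)+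

lemma cl_zero: "sgl l c \<in> rauzy_ideal s \<Longrightarrow> pcls s (sgl l c) = pcls s 0"
  by (simp add: pcls_eq_iff)

text \<open>By \<open>two_sides\<close> the edge from \<open>z\<close> to \<open>x1\<close> lies
  only in the rhombi towards \<open>x2\<close> and \<open>xn\<close>.\<close>

lemma kill1: assumes "edge z w" "w \<noteq> x1" "w \<noteq> x2" "w \<noteq> xn" shows "sgl [x1, z, w] 1 \<in> rauzy_ideal s"
proof (rule zero_relation)
  fix v show "\<not> rhombus x1 z w v"
  proof
    assume "rhombus x1 z w v"
    then have "rhombus z x1 v w" using rhombus_rotate rhombus_flip by blast
    from two_sides[OF r1 rhombus_flip[OF rn] this] assms dist(2) show False by auto
  qed
qed (use assms E1 in auto)

lemma kill2: assumes "edge z w" "w \<noteq> x1" "w \<noteq> x2" "w \<noteq> x3" shows "sgl [x2, z, w] 1 \<in> rauzy_ideal s"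
proof (rule zero_relation)
  fix v show "\<not> rhombus x2 z w v"
  proof
    assume "rhombus x2 z w v"
    then have "rhombus z x2 v w" using rhombus_rotate rhombus_flip by blast
    from two_sides[OF r2 rhombus_flip[OF r1] this] assms dist(1) show False by auto
  qed
qed (use assms E2 in auto)

section \<open>The modules of the exact sequence\<close>

definition "E = dsum_mod (right_ideal A (cl [x1])) (right_ideal A (cl [x2]))"
definition "m = (cl [x1, z], cl [x2, z])"
definition "V = E\<lparr>carrier := generated_submodule A E m\<rparr>"
definition "D = dsum_mod (right_ideal A (cl [x1, z, xn])) (right_ideal A (cl [x2, z, x3]))"
definition "N1 = carrier (right_ideal A (cl [x1, z, xn])) \<times> {pcls s 0}"

lemma rng_module_E: "rng_module A E"
  unfolding E_def by (intro dsum_rng_module right_ideal_rng_module pcls_in_carrier pc)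

lemma rng_module_D: "rng_module A D"
  unfolding D_def by (intro dsum_rng_module right_ideal_rng_module pcls_in_carrier pc)

sublocale E: rng_module A E by (rule rng_module_E)
sublocale D: rng_module A D by (rule rng_module_D)

lemma E_simps:
  "\<zero>\<^bsub>E\<^esub> = (pcls s 0, pcls s 0)" "(a, b) \<oplus>\<^bsub>E\<^esub> (a', b') = (a \<oplus>\<^bsub>A\<^esub> a', b \<oplus>\<^bsub>A\<^esub> b')"
  "r \<odot>\<^bsub>E\<^esub> (a, b) = (a \<otimes>\<^bsub>A\<^esub> r, b \<otimes>\<^bsub>A\<^esub> r)"
  by (simp_all add: E_def dsum_simps right_ideal_simps rauzy_algebra_zero)

lemma D_simps:
  "\<zero>\<^bsub>D\<^esub> = (pcls s 0, pcls s 0)" "(a, b) \<oplus>\<^bsub>D\<^esub> (a', b') = (a \<oplus>\<^bsub>A\<^esub> a', b \<oplus>\<^bsub>A\<^esub> b')"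
  "r \<odot>\<^bsub>D\<^esub> (a, b) = (a \<otimes>\<^bsub>A\<^esub> r, b \<otimes>\<^bsub>A\<^esub> r)"
  by (simp_all add: D_def dsum_simps right_ideal_simps rauzy_algebra_zero)

lemma act_E: "f \<in> pcar \<Longrightarrow> g \<in> pcar \<Longrightarrow> h \<in> pcar \<Longrightarrow>
    pcls s f \<odot>\<^bsub>E\<^esub> (pcls s g, pcls s h) = (pcls s (path_mult g f), pcls s (path_mult h f))"
  by (simp add: E_simps rauzy_algebra_mult)

lemma m_E: "m \<in> carrier E"
proof -
  have "cl [x1, z] = cl [x1] \<otimes>\<^bsub>A\<^esub> cl [x1, z]" "cl [x2, z] = cl [x2] \<otimes>\<^bsub>A\<^esub> cl [x2, z]"
    by (simp_all add: rauzy_algebra_mult path_mult_single)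
  moreover have "cl [x1, z] \<in> carrier A" "cl [x2, z] \<in> carrier A" by (simp_all add: pcls_in_carrier)
  ultimately show ?thesis unfolding m_def E_def dsum_simps right_ideal_simps by blast
qed

lemma V_carrier: "carrier V = {a \<odot>\<^bsub>E\<^esub> m |a. a \<in> carrier A}"
  by (simp add: V_def E.generated_submodule_eq[OF m_E])

lemma V_submodule: "submodule (carrier V) A E"
  unfolding V_carrier by (rule E.cyclic_submodule[OF m_E])

lemma m_V: "m \<in> carrier V"
proof -
  obtain a where "a \<in> carrier A" "a \<odot>\<^bsub>E\<^esub> m = m" using E.unital[OF m_E] by blast
  then show ?thesis unfolding V_carrier by (metis (mono_tags, lifting) mem_Collect_eq)
qed

text \<open>The path from \<open>x2\<close> through \<open>z\<close> to \<open>xn\<close> vanishes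
  because \<open>xn\<close> is none of \<open>x1\<close>, \<open>x2\<close>, \<open>x3\<close>. Here
  n at least 4 enters: each of the arrows to \<open>xn\<close> and \<open>x3\<close> isolates one
  component of the generator, which puts \<open>D\<close> into \<open>V\<close>.\<close>

lemma act_m_n: "cl [z, xn] \<odot>\<^bsub>E\<^esub> m = (cl [x1, z, xn], pcls s 0)"
  using cl_zero[OF kill2[of xn]] dist ne En by (simp add: m_def act_E path_mult_single)

lemma act_m_3: "cl [z, x3] \<odot>\<^bsub>E\<^esub> m = (pcls s 0, cl [x2, z, x3])"
  using cl_zero[OF kill1[of x3]] dist ne E2 by (simp add: m_def act_E path_mult_single)

lemma zero_times: "f \<in> pcar \<Longrightarrow> pcls s 0 \<otimes>\<^bsub>A\<^esub> pcls s f = pcls s 0"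
  by (simp add: rauzy_algebra_mult pcar_closed)

lemma D_V: "carrier D \<subseteq> carrier V"
proof
  fix t assume "t \<in> carrier D"
  then obtain a b where ab: "a \<in> carrier A" "b \<in> carrier A"
      "t = (cl [x1, z, xn] \<otimes>\<^bsub>A\<^esub> a, cl [x2, z, x3] \<otimes>\<^bsub>A\<^esub> b)"
    unfolding D_def dsum_simps right_ideal_simps by blast
  obtain f where f: "f \<in> pcar" "a = pcls s f" using ab(1) by (rule rauzy_algebra_cases)
  obtain g where g: "g \<in> pcar" "b = pcls s g" using ab(2) by (rule rauzy_algebra_cases)
  have "a \<odot>\<^bsub>E\<^esub> (cl [z, xn] \<odot>\<^bsub>E\<^esub> m) \<oplus>\<^bsub>E\<^esub> b \<odot>\<^bsub>E\<^esub> (cl [z, x3] \<odot>\<^bsub>E\<^esub> m) = t"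
    by (simp add: act_m_n act_m_3 E_simps ab(3) f g zero_times rauzy_algebra_mult rauzy_algebra_add path_mult_closed)
  moreover have "a \<odot>\<^bsub>E\<^esub> (cl [z, xn] \<odot>\<^bsub>E\<^esub> m) \<oplus>\<^bsub>E\<^esub> b \<odot>\<^bsub>E\<^esub> (cl [z, x3] \<odot>\<^bsub>E\<^esub> m) \<in> carrier V"
    by (intro E.submoduleD(3)[OF V_submodule] E.submoduleD(5)[OF V_submodule] ab m_V pcls_in_carrier pc)
  ultimately show "t \<in> carrier V" by simp
qed

lemma V_E: "carrier V \<subseteq> carrier E" by (rule E.submoduleD(1)[OF V_submodule])

lemma D_submodule: "submodule (carrier D) A E"
proof (rule E.submoduleI)
  show "carrier D \<subseteq> carrier E" using D_V V_E by blast
  show "\<zero>\<^bsub>E\<^esub> \<in> carrier D" using D.zero_closed by (simp add: E_simps D_simps)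
  show "t \<oplus>\<^bsub>E\<^esub> t' \<in> carrier D" if "t \<in> carrier D" "t' \<in> carrier D" for t t'
    using D.a_closed[OF that] by (cases t, cases t') (simp add: E_simps D_simps)
  show "a \<odot>\<^bsub>E\<^esub> t \<in> carrier D" if "a \<in> carrier A" "t \<in> carrier D" for a t
    using D.act_closed[OF that] by (cases t) (simp add: E_simps D_simps)
qed

lemma N1_D: "N1 \<subseteq> carrier D"
proof -
  interpret R: rng_module A "right_ideal A (cl [x2, z, x3])" by (intro right_ideal_rng_module pcls_in_carrier pc)
  show ?thesis using R.zero_closed by (auto simp: N1_def D_def dsum_simps right_ideal_simps(2) rauzy_algebra_zero)
qed

lemma N1_submodule: "submodule N1 A E"
proof -
  interpret R: rng_module A "right_ideal A (cl [x1, z, xn])" by (intro right_ideal_rng_module pcls_in_carrier pc)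
  show ?thesis
  proof (rule E.submoduleI)
    show "N1 \<subseteq> carrier E" using N1_D D_V V_E by blast
    show "\<zero>\<^bsub>E\<^esub> \<in> N1" using R.zero_closed by (simp add: N1_def E_simps right_ideal_simps(2) rauzy_algebra_zero)
    show "t \<oplus>\<^bsub>E\<^esub> t' \<in> N1" if "t \<in> N1" "t' \<in> N1" for t t'
      using that R.a_closed by (auto simp: N1_def E_simps right_ideal_simps(3) rauzy_algebra_add)
    show "a \<odot>\<^bsub>E\<^esub> t \<in> N1" if a: "a \<in> carrier A" and t: "t \<in> N1" for a t
    proof -
      obtain f where f: "f \<in> pcar" "a = pcls s f" using a by (rule rauzy_algebra_cases)
      obtain p where p: "p \<in> carrier (right_ideal A (cl [x1, z, xn]))" "t = (p, pcls s 0)"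
        using t unfolding N1_def by (elim SigmaE singletonE) simp
      have "p \<otimes>\<^bsub>A\<^esub> a \<in> carrier (right_ideal A (cl [x1, z, xn]))"
        using R.act_closed[OF a p(1)] by (simp only: right_ideal_simps(4))
      moreover have "a \<odot>\<^bsub>E\<^esub> t = (p \<otimes>\<^bsub>A\<^esub> a, pcls s 0)"
        by (simp add: p(2) E_simps(3) f zero_times)
      ultimately show ?thesis unfolding N1_def by simp
    qed
  qed
qed

section \<open>The map onto the third rhombus module\<close>

definition g where "g t = cl [y1, x1] \<otimes>\<^bsub>A\<^esub> fst t" for t :: "'k path_comb set \<times> 'k path_comb set"

lemma g_act_m: "f \<in> pcar \<Longrightarrow> g (pcls s f \<odot>\<^bsub>E\<^esub> m) = pcls s (path_mult (sgl [y1, x1, z] 1) f)"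
  by (simp add: g_def m_def act_E rauzy_algebra_mult path_mult_closed path_mult_assoc[symmetric])
    (simp add: path_mult_single)

text \<open>The path y1, x1, z, xn runs through a rhombus to the opposite corner and then leaves it,
  hence vanishes. The second component is not seen by \<open>g\<close>.\<close>

lemma g_D: assumes "t \<in> carrier D" shows "g t = pcls s 0"
proof -
  from assms obtain a b where ab: "a \<in> carrier A" "t = (cl [x1, z, xn] \<otimes>\<^bsub>A\<^esub> a, b)"
    unfolding D_def dsum_simps right_ideal_simps by blast
  obtain f where f: "f \<in> pcar" "a = pcls s f" using ab(1) by (rule rauzy_algebra_cases)
  have "sgl [y1, x1, z, xn] 1 \<in> rauzy_ideal s"
    using rhombus_path_extend_zero[OF rhombus_opposite[OF r1] En(1)] dist ne by simp
  then have "path_mult (sgl [y1, x1, z, xn] 1) f \<in> rauzy_ideal s" by (rule rauzy_ideal_mult(2)[OF f(1)])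
  moreover have "g t = pcls s (path_mult (path_mult (sgl [y1, x1] 1) (sgl [x1, z, xn] 1)) f)"
    using f by (simp add: g_def ab rauzy_algebra_mult path_mult_closed path_mult_assoc)
  ultimately show ?thesis by (simp add: path_mult_single pcls_eq_iff)
qed

text \<open>The map \<open>g\<close> serves as a detector: it vanishes on \<open>D\<close> but sends
  this element to the closed path at \<open>y1\<close> that the trace shows to be nonzero.\<close>

lemma V_top_nonzero: "cl [z, x1, y1] \<odot>\<^bsub>E\<^esub> m \<notin> carrier D"
proof
  assume "cl [z, x1, y1] \<odot>\<^bsub>E\<^esub> m \<in> carrier D"
  from g_D[OF this] have "cl [y1, x1, z, x1, y1] = pcls s 0" by (simp add: g_act_m path_mult_single)
  then have "sgl [y1, x1, z, x1, y1] 1 \<in> rauzy_ideal s" by (simp add: pcls_eq_iff)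
  with rhombus_loop_nonzero[OF sc r1] show False by blast
qed

lemma kill_m: assumes "edge z w" "w \<noteq> x1" "w \<noteq> x2" shows "cl [z, w] \<odot>\<^bsub>E\<^esub> m \<in> carrier D"
proof -
  have inD: "a \<odot>\<^bsub>E\<^esub> m \<in> carrier D" if "a \<odot>\<^bsub>E\<^esub> m = (p, q)" "p \<in> carrier (right_ideal A (cl [x1, z, xn]))"
    "q \<in> carrier (right_ideal A (cl [x2, z, x3]))" for a p q
    using that by (simp add: D_def dsum_simps)
  interpret R1: rng_module A "right_ideal A (cl [x1, z, xn])" by (intro right_ideal_rng_module pcls_in_carrier pc)
  interpret R2: rng_module A "right_ideal A (cl [x2, z, x3])" by (intro right_ideal_rng_module pcls_in_carrier pc)
  have z1: "pcls s 0 \<in> carrier (right_ideal A (cl [x1, z, xn]))" "pcls s 0 \<in> carrier (right_ideal A (cl [x2, z, x3]))"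
    using R1.zero_closed R2.zero_closed by (simp_all add: right_ideal_simps(2) rauzy_algebra_zero)
  have "cl [x1, z, xn] \<otimes>\<^bsub>A\<^esub> cl [xn] = cl [x1, z, xn]" "cl [x2, z, x3] \<otimes>\<^bsub>A\<^esub> cl [x3] = cl [x2, z, x3]"
    by (simp_all add: rauzy_algebra_mult path_mult_single)
  moreover have "cl [xn] \<in> carrier A" "cl [x3] \<in> carrier A" by (simp_all add: pcls_in_carrier)
  ultimately have z2: "cl [x1, z, xn] \<in> carrier (right_ideal A (cl [x1, z, xn]))"
      "cl [x2, z, x3] \<in> carrier (right_ideal A (cl [x2, z, x3]))"
    unfolding right_ideal_simps by (metis (mono_tags, lifting) mem_Collect_eq)+
  consider "w = xn" | "w = x3" | "w \<noteq> xn" "w \<noteq> x3" by blast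
  then show ?thesis
  proof cases
    case 1
    then show ?thesis using inD[OF act_m_n z2(1) z1(2)] by simp
  next
    case 2
    then show ?thesis using inD[OF act_m_3 z1(1) z2(2)] by simp
  next
    case 3
    have "sgl [z, w] 1 \<in> (pcar :: 'k path_comb set)" by (intro pcar_closed edge_path assms)
    then have "cl [z, w] \<odot>\<^bsub>E\<^esub> m = (pcls s 0, pcls s 0)"
      using cl_zero[OF kill1[OF assms 3(1)]] cl_zero[OF kill2[OF assms 3(2)]]
      by (simp add: m_def act_E path_mult_single)
    from inD[OF this z1] show ?thesis .
  qed
qed

section \<open>The three rhombus quotients\<close>

lemma rauzy_mod_E_sub: "submodule H A E \<Longrightarrow> rauzy_mod s (E\<lparr>carrier := H\<rparr>)"
  unfolding rauzy_mod_def by (rule E.submodule_rng_module)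

text \<open>The top is at \<open>z\<close> and the socle at \<open>y1\<close>; modulo
  \<open>D\<close> only the arrows to \<open>x1\<close> and \<open>x2\<close> act on the
  generator.\<close>

lemma quotient_3: "rhombus_gen s (quot_mod V (carrier D)) y1 x1 z x2 (carrier D +>\<^bsub>V\<^esub> m)"
proof -
  have V: "V = E\<lparr>carrier := carrier V\<rparr>" by (simp add: V_def)
  interpret V: rauzy_mod s V using rauzy_mod_E_sub[OF V_submodule] V by simp
  have sub: "submodule (carrier D) A V"
    using E.submodule_of_submodule[OF V_submodule D_submodule D_V] V by simp
  have act: "a \<odot>\<^bsub>V\<^esub> t = a \<odot>\<^bsub>E\<^esub> t" "t \<oplus>\<^bsub>V\<^esub> t' = t \<oplus>\<^bsub>E\<^esub> t'" for a t t' by (simp_all add: V_def)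
  show ?thesis
  proof (rule V.quotient_rhombus_gen[OF sub sc rhombus_opposite[OF r1] m_V])
    fix h assume "h \<in> carrier V"
    then obtain a where a: "a \<in> carrier A" "h = a \<odot>\<^bsub>E\<^esub> m" unfolding V_carrier by blast
    have "h = \<zero>\<^bsub>E\<^esub> \<oplus>\<^bsub>E\<^esub> a \<odot>\<^bsub>E\<^esub> m" using a E.act_closed[OF a(1) m_E] by simp
    then show "\<exists>a\<in>carrier A. \<exists>n\<in>carrier D. h = n \<oplus>\<^bsub>V\<^esub> a \<odot>\<^bsub>V\<^esub> m"
      unfolding act using a(1) E.submoduleD(2)[OF D_submodule] by blast
  next
    show "V.pact (sgl [z] 1) m = m"
      by (simp add: V.pact_def act m_def act_E path_mult_single)
    show "V.pact (sgl [z, w] 1) m \<in> carrier D" if "edge z w" "w \<noteq> x1" "w \<noteq> x2" for w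
      using kill_m[OF that] by (simp add: V.pact_def act)
    show "V.pact (sgl [z, x1, y1] 1) m \<notin> carrier D"
      using V_top_nonzero by (simp add: V.pact_def act)
  qed
qed

text \<open>The top is at \<open>xn\<close> and the socle at \<open>x1\<close>. The quotient by zero
  is the shape in which the filtration asks for its lowest term.\<close>

lemma quotient_1: "is_rhombus_module s (quot_mod (E\<lparr>carrier := N1\<rparr>) {\<zero>\<^bsub>E\<^esub>})"
proof -
  let ?H = "E\<lparr>carrier := N1\<rparr>"
  interpret H: rauzy_mod s ?H by (rule rauzy_mod_E_sub[OF N1_submodule])
  have sub: "submodule {\<zero>\<^bsub>E\<^esub>} A ?H" using H.zero_submodule by simp
  have r: "rhombus x1 z xn yn" "rhombus xn z x1 yn"
    using rhombus_rotate[OF rhombus_rotate[OF rhombus_rotate[OF rn]]]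
      rhombus_opposite[OF rhombus_rotate[OF rhombus_rotate[OF rhombus_rotate[OF rn]]]] by simp_all
  let ?m = "(cl [x1, z, xn], pcls s 0)"
  have act: "pcls s f \<odot>\<^bsub>E\<^esub> ?m = (pcls s (path_mult (sgl [x1, z, xn] 1) f), pcls s 0)" if "f \<in> pcar" for f
    using that by (simp add: E_simps rauzy_algebra_mult pcar_closed)
  have unit: "cl [xn] \<odot>\<^bsub>E\<^esub> ?m = ?m" by (simp add: act path_mult_single)
  have mN: "?m \<in> N1"
  proof -
    have "cl [x1, z, xn] = cl [x1, z, xn] \<otimes>\<^bsub>A\<^esub> cl [xn]" by (simp add: rauzy_algebra_mult path_mult_single)
    moreover have "cl [xn] \<in> carrier A" by (simp add: pcls_in_carrier)
    ultimately show ?thesis unfolding N1_def right_ideal_simps by blast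
  qed
  have "rhombus_gen s (quot_mod ?H {\<zero>\<^bsub>E\<^esub>}) x1 z xn yn ({\<zero>\<^bsub>E\<^esub>} +>\<^bsub>?H\<^esub> ?m)"
  proof (rule H.quotient_rhombus_gen[OF sub sc r(1)])
    show "?m \<in> carrier ?H" using mN by simp
    show "H.pact (sgl [xn] 1) ?m = ?m" using unit by (simp add: H.pact_def)
    fix h assume "h \<in> carrier ?H"
    then obtain a where a: "a \<in> carrier A" "h = (cl [x1, z, xn] \<otimes>\<^bsub>A\<^esub> a, pcls s 0)"
      unfolding N1_def right_ideal_simps by auto
    obtain f where f: "f \<in> pcar" "a = pcls s f" using a(1) by (rule rauzy_algebra_cases)
    have "h = \<zero>\<^bsub>E\<^esub> \<oplus>\<^bsub>E\<^esub> a \<odot>\<^bsub>E\<^esub> ?m"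
      using a f by (simp add: act E_simps(1,2) rauzy_algebra_mult rauzy_algebra_add)
    then show "\<exists>a\<in>carrier A. \<exists>n\<in>{\<zero>\<^bsub>E\<^esub>}. h = n \<oplus>\<^bsub>?H\<^esub> a \<odot>\<^bsub>?H\<^esub> ?m" using a(1) by auto
  next
    fix w assume w: "edge xn w" "w \<noteq> z" "w \<noteq> yn"
    have "sgl [xn, w] 1 \<in> (pcar :: 'k path_comb set)" by (intro pcar_closed edge_path w)
    then show "H.pact (sgl [xn, w] 1) ?m \<in> {\<zero>\<^bsub>E\<^esub>}"
      using cl_zero[OF rhombus_path_extend_zero[OF r(1) w]] by (simp add: H.pact_def act path_mult_single E_simps(1))
  next
    have "sgl [x1, z, xn, z, x1] 1 \<notin> rauzy_ideal s" by (rule rhombus_loop_nonzero[OF sc r(2)])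
    then show "H.pact (sgl [xn, z, x1] 1) ?m \<notin> {\<zero>\<^bsub>E\<^esub>}"
      by (simp add: H.pact_def act path_mult_single E_simps(1) pcls_eq_iff)
  qed
  then show ?thesis by (rule rhombus_gen.rhombus_module)
qed

text \<open>The top is at \<open>x3\<close> and the socle at \<open>x2\<close>. Elements of
  \<open>N1\<close> have zero second component, so membership is tested there.\<close>

lemma quotient_2: "is_rhombus_module s (quot_mod (E\<lparr>carrier := carrier D\<rparr>) N1)"
proof -
  let ?H = "E\<lparr>carrier := carrier D\<rparr>"
  interpret H: rauzy_mod s ?H by (rule rauzy_mod_E_sub[OF D_submodule])
  have sub: "submodule N1 A ?H" by (rule E.submodule_of_submodule[OF D_submodule N1_submodule N1_D])
  have r: "rhombus x2 z x3 y2" "rhombus x3 z x2 y2"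
    using rhombus_rotate[OF rhombus_rotate[OF rhombus_rotate[OF rhombus_flip[OF r2]]]]
      rhombus_opposite[OF rhombus_rotate[OF rhombus_rotate[OF rhombus_rotate[OF rhombus_flip[OF r2]]]]] by simp_all
  let ?m = "(pcls s 0, cl [x2, z, x3])"
  have act: "pcls s f \<odot>\<^bsub>E\<^esub> ?m = (pcls s 0, pcls s (path_mult (sgl [x2, z, x3] 1) f))" if "f \<in> pcar" for f
    using that by (simp add: E_simps rauzy_algebra_mult pcar_closed)
  have mD: "?m \<in> carrier D"
    using kill_m[of x3] act_m_3 E2 dist ne by simp
  have N1I: "(pcls s 0, pcls s 0) \<in> N1" using E.submoduleD(2)[OF N1_submodule] by (simp add: E_simps)
  have "rhombus_gen s (quot_mod ?H N1) x2 z x3 y2 (N1 +>\<^bsub>?H\<^esub> ?m)"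
  proof (rule H.quotient_rhombus_gen[OF sub sc r(1)])
    show "?m \<in> carrier ?H" using mD by simp
    show "H.pact (sgl [x3] 1) ?m = ?m" by (simp add: H.pact_def act path_mult_single)
    fix h assume "h \<in> carrier ?H"
    then obtain a b where ab: "a \<in> carrier A" "b \<in> carrier A"
      "h = (cl [x1, z, xn] \<otimes>\<^bsub>A\<^esub> a, cl [x2, z, x3] \<otimes>\<^bsub>A\<^esub> b)"
      by (auto simp: D_def dsum_simps right_ideal_simps)
    obtain f where f: "f \<in> pcar" "a = pcls s f" using ab(1) by (rule rauzy_algebra_cases)
    obtain k where k: "k \<in> pcar" "b = pcls s k" using ab(2) by (rule rauzy_algebra_cases)
    have "h = (cl [x1, z, xn] \<otimes>\<^bsub>A\<^esub> a, pcls s 0) \<oplus>\<^bsub>E\<^esub> b \<odot>\<^bsub>E\<^esub> ?m"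
      by (simp add: ab(3) f k act E_simps(2) rauzy_algebra_mult rauzy_algebra_add)
    moreover have "(cl [x1, z, xn] \<otimes>\<^bsub>A\<^esub> a, pcls s 0) \<in> N1"
      unfolding N1_def right_ideal_simps using ab(1) by blast
    ultimately show "\<exists>a\<in>carrier A. \<exists>n\<in>N1. h = n \<oplus>\<^bsub>?H\<^esub> a \<odot>\<^bsub>?H\<^esub> ?m" using ab(2) by auto
  next
    fix w assume w: "edge x3 w" "w \<noteq> z" "w \<noteq> y2"
    have "sgl [x3, w] 1 \<in> (pcar :: 'k path_comb set)" by (intro pcar_closed edge_path w)
    then show "H.pact (sgl [x3, w] 1) ?m \<in> N1"
      using cl_zero[OF rhombus_path_extend_zero[OF r(1) w]] N1I by (simp add: H.pact_def act path_mult_single)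
  next
    have "sgl [x2, z, x3, z, x2] 1 \<notin> rauzy_ideal s" by (rule rhombus_loop_nonzero[OF sc r(2)])
    then show "H.pact (sgl [x3, z, x2] 1) ?m \<notin> N1"
      by (simp add: H.pact_def act path_mult_single N1_def pcls_eq_iff)
  qed
  then show ?thesis by (rule rhombus_gen.rhombus_module)
qed

section \<open>The filtration and the exact sequence\<close>

lemma cl_products:
  "cl [x1, z] \<otimes>\<^bsub>A\<^esub> cl [z, xn] = cl [x1, z, xn]" "cl [x2, z] \<otimes>\<^bsub>A\<^esub> cl [z, x3] = cl [x2, z, x3]"
  "cl [y1, x1] \<otimes>\<^bsub>A\<^esub> cl [x1, z] = cl [y1, x1, z]"
  by (simp_all add: rauzy_algebra_mult path_mult_single)

theorem filtration: "has_rhombus_filtration s V 3"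
proof -
  have V: "V = E\<lparr>carrier := carrier V\<rparr>" by (simp add: V_def)
  have VH: "V\<lparr>carrier := H\<rparr> = E\<lparr>carrier := H\<rparr>" for H by (simp add: V_def)
  have sub: "submodule H A V" if "submodule H A E" "H \<subseteq> carrier V" for H
    using E.submodule_of_submodule[OF V_submodule that] V by simp
  have z: "\<zero>\<^bsub>V\<^esub> = \<zero>\<^bsub>E\<^esub>" by (simp add: V_def)
  define N where "N j = (if j = 0 then {\<zero>\<^bsub>E\<^esub>} else if j = 1 then N1 else if j = 2 then carrier D else carrier V)" for j :: nat
  have "submodule (N j) A V" for j
    unfolding N_def using N1_D D_V E.zero_submodule E.submoduleD(2)[OF V_submodule]
    by (auto intro!: sub N1_submodule D_submodule V_submodule)
  moreover have "N (j - 1) \<subseteq> N j \<and> is_rhombus_module s (quot_mod (V\<lparr>carrier := N j\<rparr>) (N (j - 1)))"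
    if "j \<in> {1..3}" for j
  proof -
    from that have "j = 1 \<or> j = 2 \<or> j = 3" by auto
    then show ?thesis
    proof (elim disjE)
      assume j: "j = 1"
      show ?thesis using quotient_1 E.submoduleD(2)[OF N1_submodule] by (simp add: j N_def VH)
    next
      assume j: "j = 2"
      show ?thesis using quotient_2 N1_D by (simp add: j N_def VH)
    next
      assume j: "j = 3"
      have "is_rhombus_module s (quot_mod (E\<lparr>carrier := carrier V\<rparr>) (carrier D))"
        using rhombus_gen.rhombus_module[OF quotient_3] V by simp
      then show ?thesis using D_V by (simp add: j N_def VH)
    qed
  qed
  ultimately show ?thesis
    unfolding has_rhombus_filtration_def by (intro exI[of _ N]) (simp add: z N_def)
qed

theorem exact: "short_exact A D V (right_ideal A (cl [y1, x1, z]))"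
  unfolding short_exact_def
proof (intro bexI conjI)
  let ?W = "right_ideal A (cl [y1, x1, z])"
  show "inj_on (\<lambda>t. t) (carrier D)" by simp
  have opV: "a \<odot>\<^bsub>V\<^esub> t = a \<odot>\<^bsub>E\<^esub> t" "t \<oplus>\<^bsub>V\<^esub> t' = t \<oplus>\<^bsub>E\<^esub> t'" for a t t' by (simp_all add: V_def)
  show "(\<lambda>t. t) \<in> mod_hom A D V"
  proof (rule mod_homI)
    show "t \<in> carrier V" if "t \<in> carrier D" for t using that D_V by blast
    show "t \<oplus>\<^bsub>D\<^esub> t' = t \<oplus>\<^bsub>V\<^esub> t'" for t t' by (cases t, cases t') (simp add: opV E_simps D_simps)
    show "pcls s f \<odot>\<^bsub>D\<^esub> t = pcls s f \<odot>\<^bsub>V\<^esub> t" for f t by (cases t) (simp add: opV E_simps D_simps)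
  qed
  have elem: "\<exists>f\<in>pcar. t = pcls s f \<odot>\<^bsub>E\<^esub> m" if "t \<in> carrier V" for t
    using that unfolding V_carrier rauzy_algebra_carrier by blast
  have img: "g (pcls s f \<odot>\<^bsub>E\<^esub> m) = cl [y1, x1, z] \<otimes>\<^bsub>A\<^esub> pcls s f" if "f \<in> pcar" for f
    using that by (simp add: g_act_m rauzy_algebra_mult)
  have ac: "pcls s f \<odot>\<^bsub>E\<^esub> (pcls s f' \<odot>\<^bsub>E\<^esub> m) = pcls s (path_mult f' f) \<odot>\<^bsub>E\<^esub> m" if "f \<in> pcar" "f' \<in> pcar" for f f'
    using E.act_act[OF pcls_in_carrier[OF that(2)] pcls_in_carrier[OF that(1)] m_E] that by (simp add: rauzy_algebra_mult)
  have ad: "pcls s f \<odot>\<^bsub>E\<^esub> m \<oplus>\<^bsub>E\<^esub> pcls s f' \<odot>\<^bsub>E\<^esub> m = pcls s (f + f') \<odot>\<^bsub>E\<^esub> m" if "f \<in> pcar" "f' \<in> pcar" for f f'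
    using E.add_act[OF pcls_in_carrier[OF that(1)] pcls_in_carrier[OF that(2)] m_E] by (simp add: rauzy_algebra_add)
  show "g \<in> mod_hom A V ?W"
  proof (rule mod_homI)
    show "g t \<in> carrier ?W" if tV: "t \<in> carrier V" for t
    proof -
      obtain f where f: "f \<in> pcar" "t = pcls s f \<odot>\<^bsub>E\<^esub> m" using elem[OF tV] by (rule bexE)
      have "g t = cl [y1, x1, z] \<otimes>\<^bsub>A\<^esub> pcls s f" unfolding f(2) by (rule img[OF f(1)])
      then show ?thesis unfolding right_ideal_simps using pcls_in_carrier[OF f(1), of s] by blast
    qed
    show "g (t \<oplus>\<^bsub>V\<^esub> t') = g t \<oplus>\<^bsub>?W\<^esub> g t'" if "t \<in> carrier V" "t' \<in> carrier V" for t t'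
      using elem[OF that(1)] elem[OF that(2)]
      by (auto simp: opV ad g_act_m pcar_closed right_ideal_simps rauzy_algebra_add path_mult_add_right)
    show "g (pcls s f \<odot>\<^bsub>V\<^esub> t) = pcls s f \<odot>\<^bsub>?W\<^esub> g t" if "f \<in> pcar" "t \<in> carrier V" for f t
      using elem[OF that(2)] that(1)
      by (auto simp: opV ac g_act_m right_ideal_simps rauzy_algebra_mult path_mult_closed path_mult_assoc)
  qed
  show "g ` carrier V = carrier ?W"
  proof -
    have "carrier V = (\<lambda>f. pcls s f \<odot>\<^bsub>E\<^esub> m) ` pcar" unfolding V_carrier rauzy_algebra_carrier by blast
    moreover have "carrier ?W = (\<lambda>f. cl [y1, x1, z] \<otimes>\<^bsub>A\<^esub> pcls s f) ` pcar"
      unfolding right_ideal_simps rauzy_algebra_carrier by blast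
    ultimately show ?thesis using img by (simp add: image_image cong: image_cong)
  qed
  interpret Q: rhombus_gen s "quot_mod V (carrier D)" y1 x1 z x2 "carrier D +>\<^bsub>V\<^esub> m" by (rule quotient_3)
  have V: "V = E\<lparr>carrier := carrier V\<rparr>" by (simp add: V_def)
  interpret V: rng_module A V using E.submodule_rng_module[OF V_submodule] V by simp
  have sub: "submodule (carrier D) A V"
    using E.submodule_of_submodule[OF V_submodule D_submodule D_V] V by simp
  \<comment> \<open>An element outside \<open>D\<close> is nonzero in the third quotient, so some
    \<open>a\<close> moves it, modulo \<open>D\<close>, to the generator of the socle. As
    \<open>g\<close> is compatible with the action and vanishes on \<open>D\<close>, it would vanish
    on that generator as well, against the trace.\<close>
  have "t \<in> carrier D" if t: "t \<in> carrier V" "g t = pcls s 0" for t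
  proof (rule ccontr)
    assume "t \<notin> carrier D"
    then have c1: "carrier D +>\<^bsub>V\<^esub> t \<noteq> \<zero>\<^bsub>quot_mod V (carrier D)\<^esub>"
      using V.coset_zero_iff[OF sub t(1)] by (simp add: V.quot_zero)
    have c2: "carrier D +>\<^bsub>V\<^esub> t \<in> carrier (quot_mod V (carrier D))" using t(1) by (simp add: V.quot_carrier)
    obtain a where a: "a \<in> carrier A"
      "a \<odot>\<^bsub>quot_mod V (carrier D)\<^esub> (carrier D +>\<^bsub>V\<^esub> t) = Q.pact (sgl [z, x1, y1] 1) (carrier D +>\<^bsub>V\<^esub> m)"
      by (rule Q.essential[OF c2 c1])
    let ?q = "cl [z, x1, y1] \<odot>\<^bsub>E\<^esub> m"
    have qV: "?q \<in> carrier V" by (rule E.submoduleD(5)[OF V_submodule pcls_in_carrier[OF pc(12)] m_V])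
    have aV: "a \<odot>\<^bsub>E\<^esub> t \<in> carrier V" using E.submoduleD(5)[OF V_submodule a(1) t(1)] .
    have "carrier D +>\<^bsub>V\<^esub> (a \<odot>\<^bsub>E\<^esub> t) = carrier D +>\<^bsub>V\<^esub> ?q"
      using a(2) V.quot_act[OF sub t(1) a(1)] V.quot_act[OF sub m_V pcls_in_carrier[OF pc(12), of s 1]]
      by (simp add: Q.pact_def opV)
    then have "a \<odot>\<^bsub>E\<^esub> t \<in> carrier D +>\<^bsub>V\<^esub> ?q" using V.coset_self[OF sub aV] by simp
    then obtain d where d: "d \<in> carrier D" "a \<odot>\<^bsub>E\<^esub> t = d \<oplus>\<^bsub>E\<^esub> ?q"
      by (auto simp: a_r_coset_def r_coset_def opV)
    obtain f where f: "f \<in> pcar" "a = pcls s f" using a(1) by (rule rauzy_algebra_cases)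
    obtain f' where f': "f' \<in> pcar" "t = pcls s f' \<odot>\<^bsub>E\<^esub> m" using elem[OF t(1)] by (rule bexE)
    have dV: "d \<in> carrier V" using D_V d(1) by (rule subsetD)
    obtain f'' where f'': "f'' \<in> pcar" "d = pcls s f'' \<odot>\<^bsub>E\<^esub> m" using elem[OF dV] by (rule bexE)
    have "g (a \<odot>\<^bsub>E\<^esub> t) = g t \<otimes>\<^bsub>A\<^esub> a"
      using f f' by (simp add: ac g_act_m rauzy_algebra_mult path_mult_closed path_mult_assoc)
    then have "g (a \<odot>\<^bsub>E\<^esub> t) = pcls s 0" using t(2) f by (simp add: zero_times)
    moreover have "g (d \<oplus>\<^bsub>E\<^esub> ?q) = g d \<oplus>\<^bsub>A\<^esub> g ?q"
      using f'' by (simp add: ad g_act_m pcar_closed rauzy_algebra_add path_mult_add_right)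
    ultimately have "pcls s 0 = g ?q"
      using g_D[OF d(1)] d(2) by (simp add: g_act_m rauzy_algebra_add)
    then have "sgl [y1, x1, z, x1, y1] 1 \<in> rauzy_ideal s"
      using pcls_eq_iff[of s "sgl [y1, x1, z, x1, y1] 1" 0] by (simp add: g_act_m path_mult_single)
    with rhombus_loop_nonzero[OF sc r1] show False by simp
  qed
  note ker = this
  have W0: "\<zero>\<^bsub>?W\<^esub> = pcls s 0" by (simp add: right_ideal_simps(2) rauzy_algebra_zero)
  show "(\<lambda>t. t) ` carrier D = a_kernel V ?W g"
    unfolding a_kernel_def' W0 image_ident
  proof (intro equalityI subsetI)
    fix t assume t: "t \<in> carrier D"
    have "t \<in> carrier V" using D_V t by (rule subsetD)
    then show "t \<in> {x \<in> carrier V. g x = pcls s 0}" using g_D[OF t] by simp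
  next
    fix t assume "t \<in> {x \<in> carrier V. g x = pcls s 0}"
    then show "t \<in> carrier D" using ker by simp
  qed
qed

end

theorem lemma4:
  fixes s :: "3 \<Rightarrow> point \<Rightarrow> 'k::field"
    and n :: nat and z :: point and x y :: "nat \<Rightarrow> point"
  assumes "sign_choice s"
    and "n_vertex n z" and "n \<ge> 4"
    and "local_labelling n z x y"
  shows "let A = rauzy_algebra s;
             e = (\<lambda>v. path_class s [v]);
             b = (\<lambda>j. path_class s [z, x j]);
             b_bar = (\<lambda>j. path_class s [x j, z]);
             d_bar = (\<lambda>j. path_class s [y j, x j]);
             E = dsum_mod (right_ideal A (e (x 1))) (right_ideal A (e (x 2)));
             V = E\<lparr>carrier := generated_submodule A E (b_bar 1, b_bar 2)\<rparr>
         in has_rhombus_filtration s V 3 \<and>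
            short_exact A
              (dsum_mod (right_ideal A (b_bar 1 \<otimes>\<^bsub>A\<^esub> b n)) (right_ideal A (b_bar 2 \<otimes>\<^bsub>A\<^esub> b 3)))
              V
              (right_ideal A (d_bar 1 \<otimes>\<^bsub>A\<^esub> b_bar 1))"
proof -
  have rhomb: "\<And>j. j \<in> {1..n} \<Longrightarrow> rhombus z (x j) (y j) (x (j mod n + 1))" and inj: "inj_on x {1..n}"
    using assms(4) by (auto simp: local_labelling_def bij_betw_def)
  have ne: "x i \<noteq> x j" if "i \<in> {1..n}" "j \<in> {1..n}" "i \<noteq> j" for i j
    using inj_onD[OF inj] that by blast
  interpret local_config s z "x 1" "x 2" "x 3" "x n" "y 1" "y 2" "y n"
  proof
    show "sign_choice s" by fact
    \<comment> \<open>For j = n the cyclic successor \<open>j mod n + 1\<close> is 1, which gives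
      the rhombus between the last and the first neighbour.\<close>
    show "rhombus z (x 1) (y 1) (x 2)" "rhombus z (x 2) (y 2) (x 3)" "rhombus z (x n) (y n) (x 1)"
      using rhomb[of 1] rhomb[of 2] rhomb[of n] assms(3) by (simp_all add: numeral_2_eq_2 numeral_3_eq_3)
    show "x 1 \<noteq> x 3" "x n \<noteq> x 2" "x n \<noteq> x 3" using ne assms(3) by auto
  qed
  show ?thesis
    unfolding Let_def path_class_pcls cl_products
    using filtration exact unfolding V_def E_def m_def D_def by (rule conjI)
qed

end
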